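(* Let $X,Y,A,B$ and $R$ be finite sets, $\xi\in\mathbb C^{XY}\otimes\mathbb C^R$ a unit vector, and $P=\sum_k\lambda_k\gamma_k\gamma_k^*$ with $(\gamma_k)_k$ an orthonormal family in $\mathbb C^{AB}\otimes\mathbb C^R$ and $0\le\lambda_k\le1$. Regard $\xi\xi^*\otimes P$ as an element of $\mathcal S_1^X(M_A)\otimes\mathcal S_1^Y(M_B)\otimes M_R\otimes M_R$ and set $\mathbb G=\overline{({\rm id}\otimes\phi_R)(\xi\xi^*\otimes P)}$, where $\phi_R:M_R\otimes M_R\to\mathbb C$, $a\otimes b\mapsto{\rm Tr}(ab)$. Then (i) $\omega_{\rm loc}(\xi,P)=\|\mathbb G\|_{\mathcal S_1^X(M_A)\otimes_\varepsilon\mathcal S_1^Y(M_B)}$ and (ii) $\omega_{\rm q}(\xi,P)=\|\mathbb G\|_{\mathcal S_1^X(M_A)\otimes_{\min}\mathcal S_1^Y(M_B)}$.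
   Context: The overline is entrywise complex conjugation in standard bases. The element $\xi\xi^*\otimes P\in M_X\otimes M_Y\otimes M_R\otimes M_A\otimes M_B\otimes M_R$ is reshuffled into $(M_X\otimes M_A)\otimes(M_Y\otimes M_B)\otimes M_R\otimes M_R$ (the first $M_R$ from $\xi\xi^*$, the second from $P$). $\mathcal S_1^A$ denotes $M_A$ with the operator space structure making $(\mathcal S_1^A)^*=M_A$ via $\langle S,T\rangle={\rm Tr}(ST)$ completely isometric; $\mathcal S_1^X(M_A)$ is the operator space dual of $M_X\otimes_{\min}\mathcal S_1^A$, identified with $M_X\otimes M_A$ via the pairing $\langle S\otimes T,S'\otimes T'\rangle={\rm Tr}(SS'){\rm Tr}(TT')$; similarly $\mathcal S_1^Y(M_B)$. $\otimes_{\min}$ is the minimal operator space tensor product and $\otimes_\varepsilon$ the Banach injective tensor product. A stochastic operator matrix over $(X,A)$ on $H$ is a positive $E=(E_{x,x',a,a'})\in M_{XA}(\mathcal B(H))$ with $\sum_aE_{x,x',a,a}=\delta_{x,x'}I_H$. $\mathcal Q_{\rm q}$ is the set of maps $\Gamma:M_{XY}\to M_{AB}$, $\Gamma(\epsilon_{x,x'}\otimes\epsilon_{y,y'})=\sum\langle(\tilde E_{x,x',a,a'}\otimes\tilde F_{y,y',b,b'})\zeta,\zeta\rangle\epsilon_{a,a'}\otimes\epsilon_{b,b'}$, for finite dimensional $H_A,H_B$, a unit vector $\zeta\in H_A\otimes H_B$ and stochastic operator matrices $\tilde E$ over $(X,A)$ on $H_A$ and $\tilde F$ over $(Y,B)$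 on $H_B$; $\mathcal Q_{\rm loc}$ is the set of convex combinations of $\Phi\otimes\Psi$ with channels $\Phi:M_X\to M_A$, $\Psi:M_Y\to M_B$. For ${\rm t}\in\{{\rm q,loc}\}$, $\omega_{\rm t}(\xi,P)=\sup_{\Gamma\in\mathcal Q_{\rm t}}{\rm Tr}((\Gamma\otimes{\rm id}_R)(\xi\xi^* )P)$. *)

theory Defs
  imports "HOL-Analysis.Analysis"
begin

text \<open>A matrix with rows indexed by I and columns by J is a function  i => j => complex
  (only the values on I x J matter).  Hilbert space C^I has the standard inner product.\<close>

definition vnorm :: "'i set \<Rightarrow> ('i \<Rightarrow> complex) \<Rightarrow> real" where
  "vnorm I v = sqrt (\<Sum>i\<in>I. (cmod (v i))\<^sup>2)"

definition opnorm :: "'i set \<Rightarrow> 'j set \<Rightarrow> ('i \<Rightarrow> 'j \<Rightarrow> complex) \<Rightarrow> real" where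
  "opnorm I J M = Sup {vnorm I (\<lambda>i. \<Sum>j\<in>J. M i j * v j) | v. vnorm J v \<le> 1}"

definition psd_on :: "'i set \<Rightarrow> ('i \<Rightarrow> 'i \<Rightarrow> complex) \<Rightarrow> bool" where
  "psd_on I M \<longleftrightarrow> (\<forall>v. (\<Sum>i\<in>I. \<Sum>j\<in>I. cnj (v i) * M i j * v j) \<in> \<real> \<and>
                         Re (\<Sum>i\<in>I. \<Sum>j\<in>I. cnj (v i) * M i j * v j) \<ge> 0)"

text \<open>A linear map Phi : M_X -> M_A is given by its coefficients
  K x x' a a' = (Phi(eps_{x,x'}))_{a,a'}, i.e. Phi(rho)_{a,a'} = sum_{x,x'} rho_{x,x'} K x x' a a'.
  A channel is a completely positive trace preserving such map; complete positivity means
  positivity of id_{M_n} (x) Phi for every n.\<close>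

definition lin_apply :: "('x \<Rightarrow> 'x \<Rightarrow> 'a \<Rightarrow> 'a \<Rightarrow> complex) \<Rightarrow> ('x::finite \<Rightarrow> 'x \<Rightarrow> complex) \<Rightarrow> 'a \<Rightarrow> 'a \<Rightarrow> complex" where
  "lin_apply K \<rho> a a' = (\<Sum>x\<in>UNIV. \<Sum>x'\<in>UNIV. \<rho> x x' * K x x' a a')"

definition completely_positive :: "('x::finite \<Rightarrow> 'x \<Rightarrow> 'a::finite \<Rightarrow> 'a \<Rightarrow> complex) \<Rightarrow> bool" where
  "completely_positive K \<longleftrightarrow>
     (\<forall>(n::nat) (N :: nat \<Rightarrow> nat \<Rightarrow> 'x \<Rightarrow> 'x \<Rightarrow> complex).
        psd_on ({..<n} \<times> UNIV) (\<lambda>(p,x) (q,x'). N p q x x') \<longrightarrow>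
        psd_on ({..<n} \<times> UNIV) (\<lambda>(p,a) (q,a'). lin_apply K (N p q) a a'))"

definition trace_preserving :: "('x::finite \<Rightarrow> 'x \<Rightarrow> 'a::finite \<Rightarrow> 'a \<Rightarrow> complex) \<Rightarrow> bool" where
  "trace_preserving K \<longleftrightarrow> (\<forall>\<rho>. (\<Sum>a\<in>UNIV. lin_apply K \<rho> a a) = (\<Sum>x\<in>UNIV. \<rho> x x))"

definition is_channel :: "('x::finite \<Rightarrow> 'x \<Rightarrow> 'a::finite \<Rightarrow> 'a \<Rightarrow> complex) \<Rightarrow> bool" where
  "is_channel K \<longleftrightarrow> completely_positive K \<and> trace_preserving K"

text \<open>A map Gamma : M_{XY} -> M_{AB} is given by coefficients
  G (x,y) (x',y') (a,b) (a',b') = (Gamma(eps_{x,x'} (x) eps_{y,y'}))_{(a,b),(a',b')}.\<close>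

type_synonym ('x,'y,'a,'b) qmap = "'x \<times> 'y \<Rightarrow> 'x \<times> 'y \<Rightarrow> 'a \<times> 'b \<Rightarrow> 'a \<times> 'b \<Rightarrow> complex"

definition Q_loc :: "('x::finite,'y::finite,'a::finite,'b::finite) qmap set" where
  "Q_loc = {G. \<exists>(m::nat) (c :: nat \<Rightarrow> real) K L.
      (\<forall>i<m. c i \<ge> 0) \<and> (\<Sum>i<m. c i) = 1 \<and>
      (\<forall>i<m. is_channel (K i) \<and> is_channel (L i)) \<and>
      G = (\<lambda>(x,y) (x',y') (a,b) (a',b'). \<Sum>i<m. complex_of_real (c i) * K i x x' a a' * L i y y' b b')}"

text \<open>Stochastic operator matrix over (X,A) on H = C^d (basis indexed by {..<d}):
  E x x' a a' is the (x,x',a,a') entry, an operator on C^d given as a d x d matrix.\<close>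
definition stoch_op_matrix :: "nat \<Rightarrow> ('x::finite \<Rightarrow> 'x \<Rightarrow> 'a::finite \<Rightarrow> 'a \<Rightarrow> nat \<Rightarrow> nat \<Rightarrow> complex) \<Rightarrow> bool" where
  "stoch_op_matrix d E \<longleftrightarrow>
     psd_on (UNIV \<times> {..<d}) (\<lambda>((x,a),i) ((x',a'),j). E x x' a a' i j) \<and>
     (\<forall>x x'. \<forall>i<d. \<forall>j<d. (\<Sum>a\<in>UNIV. E x x' a a i j) = (if x = x' \<and> i = j then 1 else 0))"

text \<open>Q_q: quantum correlations with finite dimensional H_A = C^dA, H_B = C^dB, unit vector
  zeta in H_A (x) H_B; entry <(E (x) F) zeta, zeta>.\<close>
definition Q_q :: "('x::finite,'y::finite,'a::finite,'b::finite) qmap set" where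
  "Q_q = {G. \<exists>(dA::nat) (dB::nat) (\<zeta> :: nat \<times> nat \<Rightarrow> complex) E F.
      stoch_op_matrix dA E \<and> stoch_op_matrix dB F \<and>
      (\<Sum>p\<in>{..<dA} \<times> {..<dB}. (cmod (\<zeta> p))\<^sup>2) = 1 \<and>
      G = (\<lambda>(x,y) (x',y') (a,b) (a',b').
             \<Sum>i<dA. \<Sum>k<dB. \<Sum>j<dA. \<Sum>l<dB.
               E x x' a a' i j * F y y' b b' k l * \<zeta> (j,l) * cnj (\<zeta> (i,k)))}"

text \<open>Tr((Gamma (x) id_R)(xi xi^* ) P).\<close>
definition game_value :: "(('x::finite \<times> 'y::finite) \<times> 'r::finite \<Rightarrow> complex) \<Rightarrow>
    (('a::finite \<times> 'b::finite) \<times> 'r \<Rightarrow> ('a \<times> 'b) \<times> 'r \<Rightarrow> complex) \<Rightarrow> ('x,'y,'a,'b) qmap \<Rightarrow> complex" where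
  "game_value \<xi> P G =
     (\<Sum>(ab,r)\<in>UNIV. \<Sum>(ab',r')\<in>UNIV.
        (\<Sum>xy\<in>UNIV. \<Sum>xy'\<in>UNIV. \<xi> (xy,r) * cnj (\<xi> (xy',r')) * G xy xy' ab ab') * P (ab',r') (ab,r))"

text \<open>omega_t(xi,P); the game value is real for every Gamma in Q_t, we take real parts.\<close>
definition omega_loc :: "(('x::finite \<times> 'y::finite) \<times> 'r::finite \<Rightarrow> complex) \<Rightarrow>
    (('a::finite \<times> 'b::finite) \<times> 'r \<Rightarrow> ('a \<times> 'b) \<times> 'r \<Rightarrow> complex) \<Rightarrow> real" where
  "omega_loc \<xi> P = Sup {Re (game_value \<xi> P G) | G. G \<in> Q_loc}"

definition omega_q :: "(('x::finite \<times> 'y::finite) \<times> 'r::finite \<Rightarrow> complex) \<Rightarrow>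
    (('a::finite \<times> 'b::finite) \<times> 'r \<Rightarrow> ('a \<times> 'b) \<times> 'r \<Rightarrow> complex) \<Rightarrow> real" where
  "omega_q \<xi> P = Sup {Re (game_value \<xi> P G) | G. G \<in> Q_q}"

text \<open>Norm in M_I(S_1^A), I a finite index set: S_1^A carries the operator space structure
  dual to M_A under <S,T> = Tr(ST), so the norm of u = [u_ij] in M_I(S_1^A) is the cb norm of
  T_u : M_A -> M_I, T_u(b) = [Tr(u_ij b)], i.e. the sup over n and over contractions N in
  M_n(M_A) of the operator norm of (id_n (x) T_u)(N).\<close>
definition S1_matnorm :: "'i set \<Rightarrow> ('i \<Rightarrow> 'i \<Rightarrow> 'a::finite \<Rightarrow> 'a \<Rightarrow> complex) \<Rightarrow> real" where
  "S1_matnorm I u = Sup {opnorm ({..<n} \<times> I) ({..<n} \<times> I)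
        (\<lambda>(p,i) (q,j). \<Sum>a\<in>UNIV. \<Sum>a'\<in>UNIV. u i j a a' * N p q a' a) | (n::nat) N.
      opnorm ({..<n} \<times> (UNIV::'a set)) ({..<n} \<times> UNIV) (\<lambda>(p,a) (q,a'). N p q a a') \<le> 1}"

text \<open>Norm in M_k(M_X (x)_min S_1^A) = M_k(M_X(S_1^A)) = M_{k x X}(S_1^A).  An element is
  w p q x x' a a' = coefficient of eps_{p,q} (x) eps_{x,x'} (x) eps_{a,a'}.\<close>
definition E_matnorm :: "nat \<Rightarrow> (nat \<Rightarrow> nat \<Rightarrow> 'x::finite \<Rightarrow> 'x \<Rightarrow> 'a::finite \<Rightarrow> 'a \<Rightarrow> complex) \<Rightarrow> real" where
  "E_matnorm k w = S1_matnorm ({..<k} \<times> (UNIV::'x set)) (\<lambda>(p,x) (q,x'). w p q x x')"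

text \<open>Elements of S_1^X(M_A) (x) S_1^Y(M_B): g x x' a a' y y' b b' is the coefficient of
  (eps_{x,x'} (x) eps_{a,a'}) (x) (eps_{y,y'} (x) eps_{b,b'}).\<close>
type_synonym ('x,'a,'y,'b) tens4 = "'x \<Rightarrow> 'x \<Rightarrow> 'a \<Rightarrow> 'a \<Rightarrow> 'y \<Rightarrow> 'y \<Rightarrow> 'b \<Rightarrow> 'b \<Rightarrow> complex"

text \<open>Matrix pairing <<g, u (x) v>> in M_k (x) M_l for u in M_k(M_X (x) S_1^A),
  v in M_l(M_Y (x) S_1^B), using <S (x) T, S' (x) T'> = Tr(SS')Tr(TT').\<close>
definition pair_mat :: "('x::finite,'a::finite,'y::finite,'b::finite) tens4 \<Rightarrow>
    (nat \<Rightarrow> nat \<Rightarrow> 'x \<Rightarrow> 'x \<Rightarrow> 'a \<Rightarrow> 'a \<Rightarrow> complex) \<Rightarrow>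
    (nat \<Rightarrow> nat \<Rightarrow> 'y \<Rightarrow> 'y \<Rightarrow> 'b \<Rightarrow> 'b \<Rightarrow> complex) \<Rightarrow> nat \<times> nat \<Rightarrow> nat \<times> nat \<Rightarrow> complex" where
  "pair_mat g u v = (\<lambda>(p,r) (q,s).
     \<Sum>x\<in>UNIV. \<Sum>x'\<in>UNIV. \<Sum>a\<in>UNIV. \<Sum>a'\<in>UNIV. \<Sum>y\<in>UNIV. \<Sum>y'\<in>UNIV. \<Sum>b\<in>UNIV. \<Sum>b'\<in>UNIV.
       g x x' a a' y y' b b' * u p q x' x a' a * v r s y' y b' b)"

text \<open>Minimal operator space tensor norm on E^* (x) F^* (E = M_X (x)_min S_1^A, F = M_Y (x)_min S_1^B):
  sup of ||<<g, u (x) v>>|| over u in Ball(M_k(E)), v in Ball(M_l(F)), k,l >= 1.\<close>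
definition min_norm :: "('x::finite,'a::finite,'y::finite,'b::finite) tens4 \<Rightarrow> real" where
  "min_norm g = Sup {opnorm ({..<k} \<times> {..<l}) ({..<k} \<times> {..<l}) (pair_mat g u v) | k l u v.
      E_matnorm k u \<le> 1 \<and> E_matnorm l v \<le> 1}"

text \<open>Banach injective tensor norm: sup of |<g, u (x) v>| over u in Ball(E), v in Ball(F)
  (E, F being the Banach preduals of S_1^X(M_A), S_1^Y(M_B)).\<close>
definition eps_norm :: "('x::finite,'a::finite,'y::finite,'b::finite) tens4 \<Rightarrow> real" where
  "eps_norm g = Sup {cmod (pair_mat g u v (0,0) (0,0)) | u v.
      E_matnorm 1 u \<le> 1 \<and> E_matnorm 1 v \<le> 1}"

definition proj_comb :: "nat \<Rightarrow> (nat \<Rightarrow> real) \<Rightarrow> (nat \<Rightarrow> 'z \<Rightarrow> complex) \<Rightarrow> 'z \<Rightarrow> 'z \<Rightarrow> complex" where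
  "proj_comb n lam \<gamma> = (\<lambda>z z'. \<Sum>k<n. complex_of_real (lam k) * \<gamma> k z * cnj (\<gamma> k z'))"

text \<open>G = conj((id (x) phi_R)(xi xi^* (x) P)), phi_R(a (x) b) = Tr(ab).\<close>
definition G_tensor :: "(('x::finite \<times> 'y::finite) \<times> 'r::finite \<Rightarrow> complex) \<Rightarrow>
    (('a::finite \<times> 'b::finite) \<times> 'r \<Rightarrow> ('a \<times> 'b) \<times> 'r \<Rightarrow> complex) \<Rightarrow> ('x,'a,'y,'b) tens4" where
  "G_tensor \<xi> P = (\<lambda>x x' a a' y y' b b'.
     cnj (\<Sum>r\<in>UNIV. \<Sum>r'\<in>UNIV. \<xi> ((x,y),r) * cnj (\<xi> ((x',y'),r')) * P ((a,b),r') ((a',b'),r)))"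

end

theory Submission
  imports Defs
begin

text \<open>
  An element \<open>u\<close> of the unit ball of \<open>M\<^sub>k(M\<^sub>X \<otimes> S\<^sub>1\<^sup>A)\<close> is a complete contraction on \<open>M\<^sub>A\<close>, hence the
  off-diagonal corner of a completely positive map with unital diagonal corners. In coordinates,
  \<open>u\<close> transposed in \<open>A\<close> factors as \<open>f\<^sup>* g\<close>, where \<open>f\<^sup>* f\<close> and \<open>g\<^sup>* g\<close> are stochastic operator
  matrices. The tensor \<open>G\<close> is positive, so with such factorizations of \<open>u\<close> and \<open>v\<close> the pairing
  of \<open>G\<close> with \<open>u \<otimes> v\<close> is an inner product of amplitude vectors, and Cauchy-Schwarz bounds it by
  the game values of the two correlations obtained from the diagonal corners. Conversely, a
  stochastic operator matrix, transposed in \<open>A\<close>, itself lies in the unit ball. Dimension one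
  gives the local value and the injective norm, arbitrary dimensions the quantum value and the
  minimal norm.

  The factorization comes from semidefinite duality: if it failed, a dual certificate would give,
  after Cholesky factorization of its diagonal blocks, a contraction \<open>N\<close> whose image under the
  amplification of \<open>u\<close> has norm greater than one.
\<close>

subsection \<open>Cholesky factorization\<close>

text \<open>The obstacle is to pass from a norm bound at every matrix level to one factorization.
  The unknown is a single positive matrix on two copies of I x A, with prescribed partial traces and
  a prescribed corner. The traces bound its diagonal, hence all its entries, so compactness provides
  a nearest point and the separation argument stays finite dimensional. The diagonal blocks of a
  separating functional are in general neither Hermitian nor invertible, whereas building the
  contraction \<open>N\<close> requires inverses of their Cholesky factors. They are replaced by
  their Hermitian parts plus e times the identity, which is why the factorization is proved for
  coercive matrices together with a two-sided inverse; the error of order e is absorbed at the end.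
  The factors of an element of level k are stochastic operator matrices on C^k with the same k: the
  auxiliary dimension goes into the summation index and not into the Hilbert space. Hence level one
  yields exactly channels. The operator norm is tested on two vectors w, w', and Cauchy-Schwarz
  separates them, so that z |w|^2 and z |w'|^2 combine to z |w| |w'|.\<close>

definition form :: "'i set \<Rightarrow> 'j set \<Rightarrow> ('i \<Rightarrow> 'j \<Rightarrow> complex) \<Rightarrow> ('i \<Rightarrow> complex) \<Rightarrow> ('j \<Rightarrow> complex) \<Rightarrow> complex" where
  "form I J M w v = (\<Sum>i\<in>I. \<Sum>j\<in>J. cnj (w i) * M i j * v j)"

lemma form_cong:
  assumes "\<And>i. i \<in> I \<Longrightarrow> w i = w' i" "\<And>j. j \<in> J \<Longrightarrow> v j = v' j"
    "\<And>i j. i \<in> I \<Longrightarrow> j \<in> J \<Longrightarrow> M i j = M' i j"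
  shows "form I J M w v = form I J M' w' v'"
  unfolding form_def using assms by (auto intro!: sum.cong)

lemma form_add_left: "form I J M (\<lambda>i. w i + w' i) v = form I J M w v + form I J M w' v"
  by (simp add: form_def algebra_simps sum.distrib)

lemma form_add_right: "form I J M w (\<lambda>i. v i + v' i) = form I J M w v + form I J M w v'"
  by (simp add: form_def algebra_simps sum.distrib)

lemma form_scale_left: "form I J M (\<lambda>i. c * w i) v = cnj c * form I J M w v"
  by (simp add: form_def sum_distrib_left mult.assoc)

lemma form_scale_right: "form I J M w (\<lambda>i. c * v i) = c * form I J M w v"
  by (simp add: form_def sum_distrib_left mult_ac)

lemma form_delta:
  assumes "finite I" "finite J" "i \<in> I" "j \<in> J"
  shows "form I J M (\<lambda>k. if k = i then 1 else 0) (\<lambda>k. if k = j then 1 else 0) = M i j"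
proof -
  have "form I J M (\<lambda>k. if k = i then 1 else 0) (\<lambda>k. if k = j then 1 else 0)
      = (\<Sum>k\<in>I. \<Sum>l\<in>J. if k = i then (if l = j then M k l else 0) else 0)"
    unfolding form_def by (intro sum.cong refl) auto
  also have "\<dots> = (\<Sum>k\<in>I. if k = i then (\<Sum>l\<in>J. if l = j then M k l else 0) else 0)"
    by (intro sum.cong refl) auto
  also have "\<dots> = M i j"
    using assms by simp
  finally show ?thesis .
qed

text \<open>One notion for two regimes: e = 0 is positivity, while e > 0 is positivity with a
  spectral gap, where the Cholesky factor has an inverse.\<close>

definition coercive_on :: "real \<Rightarrow> 'i set \<Rightarrow> ('i \<Rightarrow> 'i \<Rightarrow> complex) \<Rightarrow> bool" where
  "coercive_on e I M \<longleftrightarrow>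
     (\<forall>v. form I I M v v \<in> \<real> \<and> e * (\<Sum>i\<in>I. (cmod (v i))\<^sup>2) \<le> Re (form I I M v v))"

lemma psd_on_iff_coercive: "psd_on I M \<longleftrightarrow> coercive_on 0 I M"
  by (simp add: psd_on_def coercive_on_def form_def)

lemma form_two:
  assumes "finite I" "i \<in> I" "j \<in> I"
  defines "v \<equiv> \<lambda>s t k. s * (if k = i then 1 else 0) + t * (if k = j then 1 else 0)"
  shows "form I I M (v s t) (v s t) =
    cnj s * s * M i i + cnj s * t * M i j + cnj t * s * M j i + cnj t * t * M j j"
  unfolding v_def
  by (simp only: form_add_left form_add_right form_scale_left form_scale_right form_delta assms)
     (simp add: algebra_simps)

text \<open>Polarization: the form is real at the vectors with coefficients (1, 1) and (1, \<i>) on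
  the coordinates i, j, which fixes the imaginary and the real part respectively.\<close>

lemma coercive_hermitian:
  assumes "finite I" "coercive_on e I M" "i \<in> I" "j \<in> I"
  shows "M j i = cnj (M i j)"
proof -
  have r: "cnj s * s * M i i + cnj s * t * M i j + cnj t * s * M j i + cnj t * t * M j j \<in> \<real>" for s t
    using assms(2) unfolding coercive_on_def
    by (subst form_two[OF assms(1,3,4), symmetric]) blast
  have "M i i \<in> \<real>" "M j j \<in> \<real>" using r[of 1 0] r[of 0 1] by auto
  then have im: "Im (M i i) = 0" "Im (M j j) = 0" by (auto simp: complex_is_Real_iff)
  have "Im (M i j) + Im (M j i) = 0" using r[of 1 1] im by (simp add: complex_is_Real_iff)
  moreover have "Re (M i j) - Re (M j i) = 0"
    using r[of 1 \<i>] im by (simp add: complex_is_Real_iff)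
  ultimately show ?thesis by (simp add: complex_eq_iff)
qed

lemma coercive_diag:
  assumes "finite I" "coercive_on e I M" "i \<in> I"
  shows "M i i = of_real (Re (M i i))" "e \<le> Re (M i i)"
proof -
  let ?d = "\<lambda>k. if k = i then 1 else 0"
  have f: "form I I M ?d ?d = M i i" using assms by (simp add: form_delta)
  have "M i i \<in> \<real>" using assms(2) f unfolding coercive_on_def by metis
  then show "M i i = of_real (Re (M i i))" by simp
  have "(\<Sum>k\<in>I. (cmod (?d k))\<^sup>2) = (\<Sum>k\<in>I. if k = i then 1 else 0)"
    by (intro sum.cong) auto
  also have "\<dots> = 1" using assms by simp
  finally have "(\<Sum>k\<in>I. (cmod (?d k))\<^sup>2) = 1" .
  then show "e \<le> Re (M i i)" using assms(2) f unfolding coercive_on_def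
    by (metis mult.right_neutral)
qed

lemma psd_entry_bound:
  assumes "finite I" "psd_on I M" "i \<in> I" "j \<in> I"
  shows "2 * cmod (M i j) \<le> Re (M i i) + Re (M j j)"
proof (cases "M i j = 0")
  case True
  then show ?thesis using assms coercive_diag(2)[of I 0 M] by (simp add: psd_on_iff_coercive)
next
  case False
  \<comment> \<open>This phase makes both cross terms equal to
    \<open>- cmod (M i j)\<close>.\<close>
  define t where "t = - cnj (M i j) / cmod (M i j)"
  have c: "coercive_on 0 I M" using assms(2) by (simp add: psd_on_iff_coercive)
  have "0 \<le> Re (cnj 1 * 1 * M i i + cnj 1 * t * M i j + cnj t * 1 * M j i + cnj t * t * M j j)"
    using c unfolding coercive_on_def
    by (subst form_two[OF assms(1,3,4), symmetric]) simp
  then have "0 \<le> Re (M i i + t * M i j + cnj t * M j i + cnj t * t * M j j)" by simp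
  moreover have "t * M i j = - of_real (cmod (M i j))"
    using False complex_norm_square[of "M i j"]
    by (simp add: t_def field_simps power2_eq_square)
  moreover have "cnj t * M j i = cnj (t * M i j)"
    using coercive_hermitian[OF assms(1) c assms(3,4)] by simp
  moreover have "cnj t * t = 1"
    using False complex_norm_square[of "M i j"]
    by (simp add: t_def field_simps power2_eq_square)
  ultimately show ?thesis by simp
qed

lemma psd_zero_diag:
  assumes "finite I" "psd_on I M" "i \<in> I" "j \<in> I" "M i i = 0"
  shows "M i j = 0"
proof (rule ccontr)
  assume nz: "M i j \<noteq> 0"
  define m where "m = Re (M j j)"
  \<comment> \<open>With this coefficient the cross terms contribute -2 (1 + m) and the diagonal
    contributes m, so the form would take the negative value -2 - m.\<close>
  define s where "s = - of_real (1 + m) * M i j / (cmod (M i j))\<^sup>2"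
  have c: "coercive_on 0 I M" using assms(2) by (simp add: psd_on_iff_coercive)
  have "0 \<le> Re (cnj s * s * M i i + cnj s * 1 * M i j + cnj 1 * s * M j i + cnj 1 * 1 * M j j)"
    using c unfolding coercive_on_def
    by (subst form_two[OF assms(1,3,4), symmetric]) simp
  then have "0 \<le> Re (cnj s * s * M i i + cnj s * M i j + s * M j i + M j j)" by simp
  moreover have "cnj s * M i j = - of_real (1 + m)"
    using nz complex_norm_square[of "M i j"] by (simp add: s_def field_simps)
  moreover have "s * M j i = cnj (cnj s * M i j)"
    using coercive_hermitian[OF assms(1) c assms(3,4)] by simp
  moreover have "0 \<le> m" using coercive_diag(2)[OF assms(1) c assms(4)] by (simp add: m_def)
  ultimately show False using assms(5) by (simp add: m_def)
qed

lemma form_insert: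
  assumes "finite I" "z \<notin> I"
  shows "form (insert z I) (insert z I) M w v = cnj (w z) * M z z * v z
    + cnj (w z) * (\<Sum>j\<in>I. M z j * v j) + (\<Sum>i\<in>I. cnj (w i) * M i z) * v z + form I I M w v"
  using assms by (simp add: form_def sum.distrib sum_distrib_left sum_distrib_right mult.assoc)

text \<open>Completing the square: the choice - s / M z z of the eliminated coordinate turns the
  form of \<open>M\<close> into that of the Schur complement. The added coordinate can only increase
  the norm, so the constant \<open>e\<close> survives elimination; this keeps every later pivot away
  from 0.\<close>

lemma schur_complement_coercive:
  assumes I: "finite I" "z \<notin> I" and M: "coercive_on e (insert z I) M" and e: "0 \<le> e"
    and nz: "M z z \<noteq> 0"
  shows "coercive_on e I (\<lambda>i j. M i j - M i z * M z j / M z z)"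
  unfolding coercive_on_def
proof
  fix v
  define s where "s = (\<Sum>j\<in>I. M z j * v j)"
  define v' where "v' = (\<lambda>i. if i = z then - s / M z z else v i)"
  have cz: "cnj (M z z) = M z z"
    using coercive_diag(1)[OF _ M, of z] I by (metis complex_cnj_complex_of_real finite_insert insertI1)
  have h: "M i z = cnj (M z i)" if "i \<in> I" for i
    using coercive_hermitian[OF _ M, of z i] I that by simp
  have vI: "v' i = v i" if "i \<in> I" for i using that I by (auto simp: v'_def)
  have s1: "(\<Sum>j\<in>I. M z j * v' j) = s" by (simp add: s_def vI)
  have s2: "(\<Sum>i\<in>I. cnj (v' i) * M i z) = cnj s"
    by (simp add: s_def vI h mult.commute)
  have q: "form I I (\<lambda>i j. M i j - M i z * M z j / M z z) v v = form I I M v v - cnj s * s / M z z"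
  proof -
    have "cnj s = (\<Sum>i\<in>I. cnj (v i) * M i z)" by (simp add: s_def h mult.commute)
    then have "cnj s * s / M z z = (\<Sum>i\<in>I. cnj (v i) * M i z) * (\<Sum>j\<in>I. M z j * v j) / M z z"
      by (simp add: s_def)
    also have "\<dots> = form I I (\<lambda>i j. M i z * M z j / M z z) v v"
      unfolding form_def sum_product sum_divide_distrib by (intro sum.cong refl) (simp add: mult_ac)
    finally have "cnj s * s / M z z = form I I (\<lambda>i j. M i z * M z j / M z z) v v" .
    then show ?thesis by (simp add: form_def algebra_simps sum_subtractf)
  qed
  have "form (insert z I) (insert z I) M v' v' = form I I M v v - cnj s * s / M z z"
    using nz cz by (simp only: form_insert[OF I] s1 s2 vI cong: form_cong)
      (simp add: v'_def field_simps)
  then have eq: "form (insert z I) (insert z I) M v' v' = form I I (\<lambda>i j. M i j - M i z * M z j / M z z) v v"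
    by (simp add: q)
  have "(\<Sum>i\<in>I. (cmod (v i))\<^sup>2) \<le> (\<Sum>i\<in>insert z I. (cmod (v' i))\<^sup>2)"
    using I by (simp add: vI)
  then have "e * (\<Sum>i\<in>I. (cmod (v i))\<^sup>2) \<le> e * (\<Sum>i\<in>insert z I. (cmod (v' i))\<^sup>2)"
    using e by (rule mult_left_mono)
  moreover have "form (insert z I) (insert z I) M v' v' \<in> \<real>"
    "e * (\<Sum>i\<in>insert z I. (cmod (v' i))\<^sup>2) \<le> Re (form (insert z I) (insert z I) M v' v')"
    using M unfolding coercive_on_def by blast+
  ultimately show "form I I (\<lambda>i j. M i j - M i z * M z j / M z z) v v \<in> \<real> \<and>
    e * (\<Sum>i\<in>I. (cmod (v i))\<^sup>2) \<le> Re (form I I (\<lambda>i j. M i j - M i z * M z j / M z z) v v)"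
    unfolding eq by linarith
qed

lemma coercive_on_subset:
  assumes "finite I" "z \<notin> I" "coercive_on e (insert z I) M" "0 \<le> e"
  shows "coercive_on e I M"
  unfolding coercive_on_def
proof
  fix v :: "'a \<Rightarrow> complex"
  define v' where "v' = (\<lambda>i. if i = z then 0 else v i)"
  have vI: "v' i = v i" if "i \<in> I" for i using that assms by (auto simp: v'_def)
  have "form (insert z I) (insert z I) M v' v' = form I I M v v"
    using assms by (simp add: form_insert vI cong: form_cong) (simp add: v'_def)
  moreover have "(\<Sum>i\<in>insert z I. (cmod (v' i))\<^sup>2) = (\<Sum>i\<in>I. (cmod (v i))\<^sup>2)"
    using assms by (simp add: vI) (simp add: v'_def)
  ultimately show "form I I M v v \<in> \<real> \<and> e * (\<Sum>i\<in>I. (cmod (v i))\<^sup>2) \<le> Re (form I I M v v)"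
    using assms(3) unfolding coercive_on_def by metis
qed

text \<open>One elimination step per induction step. Both inverse identities are used later: V L = 1
  recovers the off-diagonal block of a certificate from its normalization, and L V = 1 evaluates the
  form at normalized vectors.\<close>

lemma cholesky:
  assumes "finite I" "coercive_on e I M" "0 \<le> e"
  shows "\<exists>L V. (\<forall>i\<in>I. \<forall>j\<in>I. M i j = (\<Sum>m\<in>I. cnj (L m i) * L m j)) \<and>
    (0 < e \<longrightarrow> (\<forall>i\<in>I. \<forall>j\<in>I. (\<Sum>m\<in>I. V i m * L m j) = (if i = j then 1 else 0)) \<and>
                (\<forall>i\<in>I. \<forall>j\<in>I. (\<Sum>m\<in>I. L i m * V m j) = (if i = j then 1 else 0)))"
  using assms
proof (induction I arbitrary: M rule: finite_induct)
  case empty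
  then show ?case by simp
next
  case (insert z I)
  have fin: "finite (insert z I)" using insert by simp
  note dz = coercive_diag[OF fin insert.prems(1) insertI1]
  show ?case
  proof (cases "M z z = 0")
    case True
    \<comment> \<open>A vanishing pivot forces e = 0, where no inverse is claimed. Row and column
      \<open>z\<close> then vanish, so the factor is padded with zeros.\<close>
    have e0: "e = 0" using True dz(2) insert.prems(2) by simp
    have psd: "psd_on (insert z I) M" using insert.prems(1) e0 by (simp add: psd_on_iff_coercive)
    have zr: "M z j = 0" if "j \<in> insert z I" for j
      using psd_zero_diag[OF fin psd insertI1 that True] .
    have zc: "M j z = 0" if "j \<in> insert z I" for j
      using coercive_hermitian[OF fin insert.prems(1) insertI1 that] zr[OF that] by simp
    obtain L where L: "\<forall>i\<in>I. \<forall>j\<in>I. M i j = (\<Sum>m\<in>I. cnj (L m i) * L m j)"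
      using insert.IH[OF coercive_on_subset[OF insert.hyps insert.prems] insert.prems(2)] by blast
    define L' where "L' = (\<lambda>m j. if m = z \<or> j = z then 0 else L m j)"
    have "M i j = (\<Sum>m\<in>insert z I. cnj (L' m i) * L' m j)" if "i \<in> insert z I" "j \<in> insert z I" for i j
    proof (cases "i = z \<or> j = z")
      case True
      then show ?thesis using zr zc that by (auto simp: L'_def)
    next
      case False
      then have "(\<Sum>m\<in>insert z I. cnj (L' m i) * L' m j) = (\<Sum>m\<in>I. cnj (L m i) * L m j)"
        using insert.hyps by (auto simp: L'_def intro!: sum.cong)
      then show ?thesis using L that False by auto
    qed
    then show ?thesis using e0 by blast
  next
    case False
    define c where "c = Re (M z z)"
    have Mzz: "M z z = of_real c" using dz(1) by (simp add: c_def)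
    have "0 \<le> c" using dz(2) insert.prems(2) by (simp add: c_def)
    then have c: "0 < c" using False by (cases "c = 0") (auto simp: Mzz)
    define r where "r = complex_of_real (sqrt c)"
    have r: "r * r = of_real c" "cnj r = r" "r \<noteq> 0"
      using c by (auto simp: r_def simp flip: of_real_mult)
    have rr: "r * (r * x) = of_real c * x" for x by (simp flip: mult.assoc add: r(1))
    have h: "M i z = cnj (M z i)" if "i \<in> insert z I" for i
      using coercive_hermitian[OF fin insert.prems(1) insertI1 that] .
    obtain L V where L: "\<forall>i\<in>I. \<forall>j\<in>I. M i j - M i z * M z j / M z z = (\<Sum>m\<in>I. cnj (L m i) * L m j)"
      and V: "0 < e \<Longrightarrow> (\<forall>i\<in>I. \<forall>j\<in>I. (\<Sum>m\<in>I. V i m * L m j) = (if i = j then 1 else 0)) \<and>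
                (\<forall>i\<in>I. \<forall>j\<in>I. (\<Sum>m\<in>I. L i m * V m j) = (if i = j then 1 else 0))"
      using insert.IH[OF schur_complement_coercive[OF insert.hyps insert.prems False] insert.prems(2)]
      by blast
    \<comment> \<open>In block form, with m the remainder of row \<open>z\<close> of
      \<open>M\<close> and r^2 = c: L' = [[r, m / r], [0, L]] and V' = [[1 / r, - (m V) / c],
      [0, V]].\<close>
    define L' where "L' = (\<lambda>m j. if m = z then M z j / r else if j = z then 0 else L m j)"
    define V' where "V' = (\<lambda>m j. if m = z then (if j = z then 1 / r else - (\<Sum>k\<in>I. M z k * V k j) / of_real c)
       else if j = z then 0 else V m j)"
    have ne: "m \<noteq> z" if "m \<in> I" for m using that insert.hyps by auto
    have "M i j = (\<Sum>m\<in>insert z I. cnj (L' m i) * L' m j)" if ij: "i \<in> insert z I" "j \<in> insert z I" for i j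
    proof -
      have Lij: "i \<noteq> z \<Longrightarrow> j \<noteq> z \<Longrightarrow> (\<Sum>m\<in>I. cnj (L m i) * L m j) = M i j - M i z * M z j / M z z"
        using L ij by simp
      have "(\<Sum>m\<in>insert z I. cnj (L' m i) * L' m j) = M i z * M z j / M z z +
          (\<Sum>m\<in>I. if i = z \<or> j = z then 0 else cnj (L m i) * L m j)"
      proof -
        have "(\<Sum>m\<in>I. cnj (L' m i) * L' m j) = (\<Sum>m\<in>I. if i = z \<or> j = z then 0 else cnj (L m i) * L m j)"
          using ne by (intro sum.cong refl) (auto simp: L'_def)
        moreover have "cnj (L' z i) * L' z j = M i z * M z j / M z z"
          unfolding h[OF ij(1)] Mzz using r by (simp add: L'_def)
        ultimately show ?thesis using insert.hyps by simp
      qed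
      also have "\<dots> = M i j"
        using ij c False Lij by (cases "i = z"; cases "j = z") auto
      finally show ?thesis by simp
    qed
    moreover have "(\<Sum>m\<in>insert z I. V' i m * L' m j) = (if i = j then 1 else 0)"
      if e: "0 < e" and ij: "i \<in> insert z I" "j \<in> insert z I" for i j
    proof -
      have *: "(\<Sum>m\<in>insert z I. V' i m * L' m j) = V' i z * L' z j + (\<Sum>m\<in>I. V' i m * L' m j)"
        using insert.hyps by simp
      consider "i = z" "j = z" | "i = z" "j \<in> I" | "i \<in> I" "j = z" | "i \<in> I" "j \<in> I" using ij by auto
      then show ?thesis
      proof cases
        case 1
        have "(\<Sum>m\<in>I. V' i m * L' m j) = 0" using 1 ne by (auto simp: L'_def intro!: sum.neutral)
        then show ?thesis unfolding * using 1 r c by (simp add: V'_def L'_def Mzz)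
      next
        case 2
        have "(\<Sum>m\<in>I. V' i m * L' m j) = (\<Sum>m\<in>I. - (\<Sum>k\<in>I. M z k * V k m) * L m j / of_real c)"
          using 2 ne by (auto simp: L'_def V'_def intro!: sum.cong)
        also have "\<dots> = (\<Sum>m\<in>I. - (\<Sum>k\<in>I. M z k * V k m) * L m j) / of_real c"
          by (simp only: sum_divide_distrib)
        also have "(\<Sum>m\<in>I. - (\<Sum>k\<in>I. M z k * V k m) * L m j) = - (\<Sum>m\<in>I. \<Sum>k\<in>I. M z k * V k m * L m j)"
          by (simp add: sum_negf sum_distrib_right)
        also have "\<dots> = - (\<Sum>k\<in>I. M z k * (\<Sum>m\<in>I. V k m * L m j))"
          by (subst sum.swap) (simp add: sum_distrib_left mult.assoc)
        also have "\<dots> = - (\<Sum>k\<in>I. M z k * (if k = j then 1 else 0))"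
          using V[OF e] 2 by simp
        also have "\<dots> = - M z j" using insert.hyps 2 by (simp add: if_distrib cong: if_cong)
        finally show ?thesis unfolding * using 2 ne r c by (auto simp: V'_def L'_def field_simps rr)
      next
        case 3
        then show ?thesis unfolding * using ne by (auto simp: V'_def L'_def intro!: sum.neutral)
      next
        case 4
        then have "(\<Sum>m\<in>I. V' i m * L' m j) = (\<Sum>m\<in>I. V i m * L m j)"
          using ne by (auto simp: L'_def V'_def intro!: sum.cong)
        then show ?thesis unfolding * using 4 V[OF e] ne by (auto simp: V'_def L'_def)
      qed
    qed
    moreover have "(\<Sum>m\<in>insert z I. L' i m * V' m j) = (if i = j then 1 else 0)"
      if e: "0 < e" and ij: "i \<in> insert z I" "j \<in> insert z I" for i j
    proof -
      have *: "(\<Sum>m\<in>insert z I. L' i m * V' m j) = L' i z * V' z j + (\<Sum>m\<in>I. L' i m * V' m j)"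
        using insert.hyps by simp
      consider "i = z" "j = z" | "i = z" "j \<in> I" | "i \<in> I" "j = z" | "i \<in> I" "j \<in> I" using ij by auto
      then show ?thesis
      proof cases
        case 1
        have "(\<Sum>m\<in>I. L' i m * V' m j) = 0" using 1 ne by (auto simp: V'_def intro!: sum.neutral)
        then show ?thesis unfolding * using 1 r c by (simp add: V'_def L'_def Mzz)
      next
        case 2
        have "(\<Sum>m\<in>I. L' i m * V' m j) = (\<Sum>m\<in>I. M z m * V m j) / r"
          using 2 ne by (auto simp: L'_def V'_def sum_divide_distrib intro!: sum.cong)
        then show ?thesis unfolding * using 2 ne r c by (auto simp: V'_def L'_def field_simps Mzz)
      next
        case 3
        then show ?thesis unfolding * using ne by (auto simp: V'_def L'_def intro!: sum.neutral)
      next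
        case 4
        then have "(\<Sum>m\<in>I. L' i m * V' m j) = (\<Sum>m\<in>I. L i m * V m j)"
          using ne by (auto simp: L'_def V'_def intro!: sum.cong)
        then show ?thesis unfolding * using 4 V[OF e] ne by (auto simp: V'_def L'_def)
      qed
    qed
    ultimately show ?thesis by blast
  qed
qed

lemma psd_gram:
  assumes "finite I" "psd_on I M"
  obtains L where "\<And>i j. i \<in> I \<Longrightarrow> j \<in> I \<Longrightarrow> M i j = (\<Sum>m\<in>I. cnj (L m i) * L m j)"
  using cholesky[of I 0 M] assms by (auto simp: psd_on_iff_coercive)

lemma form_gram:
  assumes "\<And>i j. i \<in> I \<Longrightarrow> j \<in> I \<Longrightarrow> M i j = (\<Sum>m\<in>F. cnj (L m i) * L m j)"
  shows "form I I M v v = of_real (\<Sum>m\<in>F. (cmod (\<Sum>i\<in>I. L m i * v i))\<^sup>2)"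
proof -
  have "form I I M v v = (\<Sum>i\<in>I. \<Sum>j\<in>I. \<Sum>m\<in>F. cnj (L m i * v i) * (L m j * v j))"
    unfolding form_def by (intro sum.cong refl) (simp add: assms sum_distrib_left sum_distrib_right mult_ac)
  also have "\<dots> = (\<Sum>i\<in>I. \<Sum>m\<in>F. \<Sum>j\<in>I. cnj (L m i * v i) * (L m j * v j))"
    by (intro sum.cong refl sum.swap)
  also have "\<dots> = (\<Sum>m\<in>F. \<Sum>i\<in>I. \<Sum>j\<in>I. cnj (L m i * v i) * (L m j * v j))"
    by (rule sum.swap)
  also have "\<dots> = (\<Sum>m\<in>F. cnj (\<Sum>i\<in>I. L m i * v i) * (\<Sum>i\<in>I. L m i * v i))"
    by (simp only: cnj_sum sum_product)
  also have "\<dots> = of_real (\<Sum>m\<in>F. (cmod (\<Sum>i\<in>I. L m i * v i))\<^sup>2)"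
    by (simp only: of_real_sum complex_norm_square) (simp add: mult.commute)
  finally show ?thesis .
qed

lemma gram_psd:
  assumes "\<And>i j. i \<in> I \<Longrightarrow> j \<in> I \<Longrightarrow> M i j = (\<Sum>m\<in>F. cnj (L m i) * L m j)"
  shows "psd_on I M"
  unfolding psd_on_iff_coercive coercive_on_def by (auto simp: form_gram[OF assms] intro!: sum_nonneg)

subsection \<open>Operator norms and amplifications\<close>

lemma vnorm_nonneg: "0 \<le> vnorm I v"
  by (simp add: vnorm_def sum_nonneg)

lemma vnorm_power2: "(vnorm I v)\<^sup>2 = (\<Sum>i\<in>I. (cmod (v i))\<^sup>2)"
  by (simp add: vnorm_def sum_nonneg)

lemma vnorm_scale: "vnorm I (\<lambda>i. c * v i) = cmod c * vnorm I v"
  by (simp add: vnorm_def norm_mult power_mult_distrib real_sqrt_mult flip: sum_distrib_left)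

lemma norm_sum_mult_le_vnorm: "cmod (\<Sum>i\<in>I. a i * b i) \<le> vnorm I a * vnorm I b"
proof -
  have "cmod (\<Sum>i\<in>I. a i * b i) \<le> (\<Sum>i\<in>I. \<bar>cmod (a i)\<bar> * \<bar>cmod (b i)\<bar>)"
    by (rule order_trans[OF norm_sum]) (simp add: norm_mult)
  also have "\<dots> \<le> vnorm I a * vnorm I b"
    using L2_set_mult_ineq[of "\<lambda>i. cmod (a i)" "\<lambda>i. cmod (b i)" I]
    by (simp add: vnorm_def L2_set_def)
  finally show ?thesis .
qed

lemma vnorm_cnj [simp]: "vnorm I (\<lambda>i. cnj (v i)) = vnorm I v"
  by (simp add: vnorm_def)

lemma form_eq_inner: "form I J M w v = (\<Sum>i\<in>I. cnj (w i) * (\<Sum>j\<in>J. M i j * v j))"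
  by (simp add: form_def sum_distrib_left mult.assoc)

text \<open>Cauchy-Schwarz in each row bounds the set by the Frobenius norm. Boundedness is what
  lets a real \<open>Sup\<close> dominate its members.\<close>

lemma opnorm_bdd: "bdd_above {vnorm I (\<lambda>i. \<Sum>j\<in>J. M i j * v j) | v. vnorm J v \<le> 1}"
proof (rule bdd_aboveI)
  fix x assume "x \<in> {vnorm I (\<lambda>i. \<Sum>j\<in>J. M i j * v j) | v. vnorm J v \<le> 1}"
  then obtain v where v: "vnorm J v \<le> 1" and x: "x = vnorm I (\<lambda>i. \<Sum>j\<in>J. M i j * v j)" by blast
  have "cmod (\<Sum>j\<in>J. M i j * v j) \<le> vnorm J (M i)" for i
  proof -
    have "cmod (\<Sum>j\<in>J. M i j * v j) \<le> vnorm J (M i) * vnorm J v"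
      by (rule norm_sum_mult_le_vnorm)
    also have "\<dots> \<le> vnorm J (M i) * 1"
      using v vnorm_nonneg by (rule mult_left_mono)
    finally show ?thesis by simp
  qed
  then show "x \<le> sqrt (\<Sum>i\<in>I. (vnorm J (M i))\<^sup>2)"
    unfolding x by (subst vnorm_def, intro real_sqrt_le_mono sum_mono power_mono) auto
qed

lemma vnorm_apply_le_opnorm: "vnorm I (\<lambda>i. \<Sum>j\<in>J. M i j * v j) \<le> opnorm I J M * vnorm J v"
proof (cases "vnorm J v = 0")
  case True
  have "cmod (\<Sum>j\<in>J. M i j * v j) \<le> 0" for i
    using norm_sum_mult_le_vnorm[of "M i" v J] True by simp
  then show ?thesis using True by (simp add: vnorm_def)
next
  case False
  then have pos: "0 < vnorm J v" using vnorm_nonneg[of J v] by simp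
  define v' where "v' = (\<lambda>j. of_real (1 / vnorm J v) * v j)"
  have "vnorm J v' = 1" using pos by (simp only: v'_def vnorm_scale) (simp add: norm_divide)
  then have "vnorm I (\<lambda>i. \<Sum>j\<in>J. M i j * v' j) \<le> opnorm I J M"
    unfolding opnorm_def by (intro cSup_upper opnorm_bdd) auto
  moreover have "(\<lambda>i. \<Sum>j\<in>J. M i j * v' j) = (\<lambda>i. of_real (1 / vnorm J v) * (\<Sum>j\<in>J. M i j * v j))"
    by (simp add: v'_def sum_distrib_left mult_ac)
  ultimately have "(1 / vnorm J v) * vnorm I (\<lambda>i. \<Sum>j\<in>J. M i j * v j) \<le> opnorm I J M"
    using pos by (simp only: vnorm_scale) (simp add: norm_divide)
  then show ?thesis using pos by (simp add: field_simps)
qed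

lemma form_le_opnorm: "cmod (form I J M w v) \<le> opnorm I J M * (vnorm I w * vnorm J v)"
proof -
  have "cmod (form I J M w v) \<le> vnorm I (\<lambda>i. cnj (w i)) * vnorm I (\<lambda>i. \<Sum>j\<in>J. M i j * v j)"
    unfolding form_eq_inner by (rule norm_sum_mult_le_vnorm)
  also have "\<dots> \<le> vnorm I (\<lambda>i. cnj (w i)) * (opnorm I J M * vnorm J v)"
    by (intro mult_left_mono vnorm_apply_le_opnorm vnorm_nonneg)
  finally show ?thesis by (simp add: mult_ac)
qed

text \<open>The norm of M v is recovered by pairing M v with its own normalization.\<close>

lemma opnorm_le_unit:
  assumes "0 \<le> c" "\<And>w v. vnorm I w \<le> 1 \<Longrightarrow> vnorm J v \<le> 1 \<Longrightarrow> cmod (form I J M w v) \<le> c"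
  shows "opnorm I J M \<le> c"
  unfolding opnorm_def
proof (rule cSup_least)
  show "{vnorm I (\<lambda>i. \<Sum>j\<in>J. M i j * v j) | v. vnorm J v \<le> 1} \<noteq> {}"
    by (auto simp: vnorm_def intro!: exI[of _ "\<lambda>_. 0"])
next
  fix x assume "x \<in> {vnorm I (\<lambda>i. \<Sum>j\<in>J. M i j * v j) | v. vnorm J v \<le> 1}"
  then obtain v where v: "vnorm J v \<le> 1" and x: "x = vnorm I (\<lambda>i. \<Sum>j\<in>J. M i j * v j)" by blast
  define y where "y = (\<lambda>i. \<Sum>j\<in>J. M i j * v j)"
  show "x \<le> c"
  proof (cases "x = 0")
    case False
    then have pos: "0 < x" using vnorm_nonneg[of I y] by (simp add: x y_def)
    have "form I J M y v = of_real (x\<^sup>2)"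
      unfolding form_eq_inner x y_def[symmetric] vnorm_power2
      by (simp only: of_real_sum complex_norm_square) (simp add: y_def mult.commute)
    then have "form I J M (\<lambda>i. of_real (1 / x) * y i) v = of_real x"
      using pos unfolding form_scale_left by (simp add: power2_eq_square)
    moreover have "vnorm I (\<lambda>i. of_real (1 / x) * y i) = 1"
      using pos unfolding vnorm_scale by (simp add: x y_def norm_divide)
    ultimately show ?thesis using assms(2)[OF _ v, of "\<lambda>i. of_real (1 / x) * y i"] pos by simp
  qed (use assms in auto)
qed

lemma opnorm_le:
  assumes "0 \<le> c" "\<And>w v. cmod (form I J M w v) \<le> c * (vnorm I w * vnorm J v)"
  shows "opnorm I J M \<le> c"
proof (rule opnorm_le_unit[OF assms(1)])
  fix w v assume "vnorm I w \<le> 1" "vnorm J v \<le> 1"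
  then have "c * (vnorm I w * vnorm J v) \<le> c * 1"
    using assms(1) by (intro mult_left_mono mult_le_one vnorm_nonneg)
  then show "cmod (form I J M w v) \<le> c" using assms(2)[of w v] by simp
qed

text \<open>\<open>ampl u N\<close> is \<open>(id \<otimes> T)(N)\<close> for the map \<open>T(b) = [Tr (u i j b)]\<close> whose cb norm is \<open>S1_matnorm I u\<close>.\<close>

definition ampl :: "('i \<Rightarrow> 'i \<Rightarrow> 'a::finite \<Rightarrow> 'a \<Rightarrow> complex) \<Rightarrow> (nat \<Rightarrow> nat \<Rightarrow> 'a \<Rightarrow> 'a \<Rightarrow> complex) \<Rightarrow>
    nat \<times> 'i \<Rightarrow> nat \<times> 'i \<Rightarrow> complex" where
  "ampl u N = (\<lambda>(p,i) (q,j). \<Sum>a\<in>UNIV. \<Sum>a'\<in>UNIV. u i j a a' * N p q a' a)"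

text \<open>With \<open>u\<close> moved outside, the form becomes a trace pairing of
  \<open>u\<close> with the compression of \<open>N\<close> by \<open>w\<close> and
  \<open>v\<close>. Finiteness of the norm, the dual certificate and the converse bound are all read
  off from this shape.\<close>

lemma form_ampl:
  "form ({..<n} \<times> I) ({..<n} \<times> I) (ampl u N) w v =
   (\<Sum>i\<in>I. \<Sum>j\<in>I. \<Sum>a\<in>UNIV. \<Sum>a'\<in>UNIV. u i j a a' *
      (\<Sum>p<n. \<Sum>q<n. cnj (w (p, i)) * N p q a' a * v (q, j)))"
proof -
  have "form ({..<n} \<times> I) ({..<n} \<times> I) (ampl u N) w v =
    (\<Sum>p<n. \<Sum>i\<in>I. \<Sum>q<n. \<Sum>j\<in>I. \<Sum>a\<in>UNIV. \<Sum>a'\<in>UNIV. u i j a a' *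
      (cnj (w (p, i)) * N p q a' a * v (q, j)))"
    by (simp add: form_def ampl_def sum.cartesian_product' sum_distrib_left sum_distrib_right mult_ac)
  also have "\<dots> = (\<Sum>i\<in>I. \<Sum>j\<in>I. \<Sum>p<n. \<Sum>q<n. \<Sum>a\<in>UNIV. \<Sum>a'\<in>UNIV. u i j a a' *
      (cnj (w (p, i)) * N p q a' a * v (q, j)))"
    by (subst sum.swap[of _ I], rule sum.cong[OF refl], subst sum.swap[of _ I], subst sum.swap[of _ I])
      (simp add: sum.swap[of _ _ I])
  also have "\<dots> = (\<Sum>i\<in>I. \<Sum>j\<in>I. \<Sum>a\<in>UNIV. \<Sum>a'\<in>UNIV. \<Sum>p<n. \<Sum>q<n. u i j a a' *
      (cnj (w (p, i)) * N p q a' a * v (q, j)))"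
    by (intro sum.cong refl) (simp add: sum.swap[of _ UNIV "{..<n}"])
  finally show ?thesis by (simp add: sum_distrib_left)
qed

section \<open>Finiteness of the completely bounded norm and access to its supremum\<close>

abbreviation contractive :: "nat \<Rightarrow> (nat \<Rightarrow> nat \<Rightarrow> 'a::finite \<Rightarrow> 'a \<Rightarrow> complex) \<Rightarrow> bool" where
  "contractive n N \<equiv> opnorm ({..<n} \<times> (UNIV::'a set)) ({..<n} \<times> UNIV) (\<lambda>(p,a) (q,a'). N p q a a') \<le> 1"

lemma S1_matnorm_alt:
  "S1_matnorm I u = Sup {opnorm ({..<n} \<times> I) ({..<n} \<times> I) (ampl u N) | n N. contractive n N}"
  by (simp add: S1_matnorm_def ampl_def)

lemma contractive_zero: "contractive 0 N"
  by (rule opnorm_le) (simp_all add: form_def vnorm_nonneg)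

text \<open>In \<open>form_ampl\<close> each coefficient of \<open>u\<close> multiplies a form of
  \<open>N\<close> at vectors supported on a single answer, whose norms are at most those of
  \<open>w\<close> and \<open>v\<close>. The sum of the moduli of the coefficients is therefore a
  bound at every level.\<close>

lemma S1_matnorm_bdd:
  fixes u :: "'i \<Rightarrow> 'i \<Rightarrow> 'a::finite \<Rightarrow> 'a \<Rightarrow> complex"
  assumes I: "finite I"
  shows "bdd_above {opnorm ({..<n} \<times> I) ({..<n} \<times> I) (ampl u N) | n N. contractive n N}"
proof (rule bdd_aboveI)
  define K where "K = (\<Sum>i\<in>I. \<Sum>j\<in>I. \<Sum>a\<in>UNIV. \<Sum>a'\<in>UNIV. cmod (u i j a a'))"
  fix x assume "x \<in> {opnorm ({..<n} \<times> I) ({..<n} \<times> I) (ampl u N) | n N. contractive n N}"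
  then obtain n N where N: "contractive n N" and x: "x = opnorm ({..<n} \<times> I) ({..<n} \<times> I) (ampl u N)"
    by blast
  show "x \<le> K"
    unfolding x
  proof (rule opnorm_le)
    show "0 \<le> K" by (simp add: K_def sum_nonneg)
    fix w v :: "nat \<times> 'i \<Rightarrow> complex"
    let ?B = "vnorm ({..<n} \<times> I) w * vnorm ({..<n} \<times> I) v"
    have slice: "vnorm ({..<n} \<times> UNIV) (\<lambda>(p,b). if b = a then v (p,i) else 0) \<le> vnorm ({..<n} \<times> I) v"
      if "i \<in> I" for v :: "nat \<times> 'i \<Rightarrow> complex" and i and a :: 'a
    proof -
      have "(\<Sum>z\<in>{..<n} \<times> UNIV. (cmod (case z of (p,b) \<Rightarrow> if b = a then v (p,i) else 0))\<^sup>2)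
         = (\<Sum>p<n. \<Sum>b\<in>UNIV. if b = a then (cmod (v (p,i)))\<^sup>2 else 0)"
        unfolding sum.cartesian_product' by (intro sum.cong refl) auto
      also have "\<dots> = (\<Sum>p<n. (cmod (v (p,i)))\<^sup>2)" by simp
      also have "\<dots> \<le> (\<Sum>p<n. \<Sum>j\<in>I. (cmod (v (p,j)))\<^sup>2)"
        by (intro sum_mono member_le_sum) (use that I in auto)
      finally show ?thesis unfolding vnorm_def by (simp add: sum.cartesian_product')
    qed
    have inner: "cmod (\<Sum>p<n. \<Sum>q<n. cnj (w (p, i)) * N p q a' a * v (q, j)) \<le> ?B"
      if "i \<in> I" "j \<in> I" for i j a a'
    proof -
      let ?w = "\<lambda>(p,b). if b = a' then w (p,i) else 0" and ?v = "\<lambda>(q,b). if b = a then v (q,j) else 0"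
      have "form ({..<n} \<times> UNIV) ({..<n} \<times> UNIV) (\<lambda>(p,a) (q,a'). N p q a a') ?w ?v
        = (\<Sum>p<n. \<Sum>b\<in>UNIV. \<Sum>q<n. \<Sum>c\<in>UNIV. if c = a then (if b = a' then cnj (w (p, i)) * N p q b c * v (q, j) else 0) else 0)"
        unfolding form_def sum.cartesian_product' by (intro sum.cong refl) auto
      also have "\<dots> = (\<Sum>p<n. \<Sum>q<n. cnj (w (p, i)) * N p q a' a * v (q, j))"
        by (simp, subst sum.swap) simp
      finally have eq: "(\<Sum>p<n. \<Sum>q<n. cnj (w (p, i)) * N p q a' a * v (q, j)) =
        form ({..<n} \<times> UNIV) ({..<n} \<times> UNIV) (\<lambda>(p,a) (q,a'). N p q a a') ?w ?v" by simp
      have "cmod (form ({..<n} \<times> UNIV) ({..<n} \<times> UNIV) (\<lambda>(p,a) (q,a'). N p q a a') ?w ?v)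
        \<le> 1 * (vnorm ({..<n} \<times> UNIV) ?w * vnorm ({..<n} \<times> UNIV) ?v)"
        by (rule order_trans[OF form_le_opnorm mult_right_mono[OF N]]) (simp add: vnorm_nonneg)
      also have "\<dots> \<le> ?B" using slice that by (simp add: mult_mono vnorm_nonneg)
      finally show ?thesis unfolding eq .
    qed
    have "cmod (form ({..<n} \<times> I) ({..<n} \<times> I) (ampl u N) w v) \<le>
      (\<Sum>i\<in>I. \<Sum>j\<in>I. \<Sum>a\<in>UNIV. \<Sum>a'\<in>UNIV. cmod (u i j a a') * ?B)"
      unfolding form_ampl
      by (intro sum_norm_le) (simp add: norm_mult mult_left_mono inner)
    then show "cmod (form ({..<n} \<times> I) ({..<n} \<times> I) (ampl u N) w v) \<le> K * ?B"
      by (simp add: K_def sum_distrib_right)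
  qed
qed

lemma S1_matnorm_leD:
  assumes "finite I" "S1_matnorm I u \<le> 1" "contractive n N"
  shows "cmod (form ({..<n} \<times> I) ({..<n} \<times> I) (ampl u N) w v) \<le> vnorm ({..<n} \<times> I) w * vnorm ({..<n} \<times> I) v"
proof -
  have "opnorm ({..<n} \<times> I) ({..<n} \<times> I) (ampl u N) \<le> S1_matnorm I u"
    unfolding S1_matnorm_alt by (intro cSup_upper S1_matnorm_bdd) (use assms in auto)
  then have "opnorm ({..<n} \<times> I) ({..<n} \<times> I) (ampl u N) \<le> 1" using assms(2) by simp
  then have "opnorm ({..<n} \<times> I) ({..<n} \<times> I) (ampl u N) * (vnorm ({..<n} \<times> I) w * vnorm ({..<n} \<times> I) v)
     \<le> 1 * (vnorm ({..<n} \<times> I) w * vnorm ({..<n} \<times> I) v)"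
    by (intro mult_right_mono) (auto simp: vnorm_nonneg)
  then show ?thesis
    using form_le_opnorm[of "{..<n} \<times> I" "{..<n} \<times> I" "ampl u N" w v] by simp
qed

lemma S1_matnorm_le:
  assumes "\<And>n N w v. contractive n N \<Longrightarrow>
    cmod (form ({..<n} \<times> I) ({..<n} \<times> I) (ampl u N) w v) \<le> vnorm ({..<n} \<times> I) w * vnorm ({..<n} \<times> I) v"
  shows "S1_matnorm I u \<le> 1"
  unfolding S1_matnorm_alt
proof (rule cSup_least)
  show "{opnorm ({..<n} \<times> I) ({..<n} \<times> I) (ampl u N) | n N. contractive n N} \<noteq> {}"
    using contractive_zero by blast
  fix x assume "x \<in> {opnorm ({..<n} \<times> I) ({..<n} \<times> I) (ampl u N) | n N. contractive n N}"
  then show "x \<le> 1" using assms by (auto intro!: opnorm_le)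
qed

lemma contractive_form_le:
  assumes "contractive n N"
  shows "cmod (\<Sum>p<n. \<Sum>a\<in>UNIV. \<Sum>q<n. \<Sum>b\<in>UNIV. cnj (w p a) * N p q a b * v q b)
    \<le> vnorm ({..<n} \<times> UNIV) (\<lambda>(p,a). w p a) * vnorm ({..<n} \<times> UNIV) (\<lambda>(p,a). v p a)"
proof -
  have "cmod (form ({..<n} \<times> UNIV) ({..<n} \<times> UNIV) (\<lambda>(p,a) (q,a'). N p q a a') (\<lambda>(p,a). w p a) (\<lambda>(p,a). v p a))
    \<le> 1 * (vnorm ({..<n} \<times> UNIV) (\<lambda>(p,a). w p a) * vnorm ({..<n} \<times> UNIV) (\<lambda>(p,a). v p a))"
    by (rule order_trans[OF form_le_opnorm mult_right_mono[OF assms]]) (simp add: vnorm_nonneg)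
  then show ?thesis by (simp add: form_def sum.cartesian_product')
qed

subsection \<open>Semidefinite duality\<close>

lemma form_lincomb:
  "form I J (\<lambda>i j. Z i j + c * W i j) w v = form I J Z w v + c * form I J W w v"
  by (simp add: form_def algebra_simps sum.distrib sum_distrib_left)

lemma psd_on_add_scale:
  assumes "psd_on I Z" "psd_on I W" "0 \<le> s"
  shows "psd_on I (\<lambda>i j. Z i j + of_real s * W i j)"
  using assms unfolding psd_on_iff_coercive coercive_on_def form_lincomb by simp

lemma psd_on_zero: "psd_on I (\<lambda>i j. 0)"
  by (simp add: psd_on_def)

lemma psd_on_scale:
  assumes "psd_on I W" "0 \<le> s"
  shows "psd_on I (\<lambda>i j. of_real s * W i j)"
  using psd_on_add_scale[OF psd_on_zero assms] by simp

lemma psd_on_cong: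
  assumes "\<And>i j. i \<in> I \<Longrightarrow> j \<in> I \<Longrightarrow> Z i j = W i j"
  shows "psd_on I Z \<longleftrightarrow> psd_on I W"
proof -
  have "form I I Z v v = form I I W v v" for v by (rule form_cong) (auto simp: assms)
  then show ?thesis by (simp add: psd_on_iff_coercive coercive_on_def)
qed

text \<open>The type \<open>'j\<close> may be infinite, so entries outside J x J are pinned to 0.
  What remains is a product of compact sets (Tychonoff), cut by closed conditions.\<close>

lemma compact_psd_bounded:
  assumes "finite J"
  shows "compact {\<zeta> :: 'j \<times> 'j \<Rightarrow> complex. \<zeta> \<in> PiE UNIV (\<lambda>p. if p \<in> J \<times> J then cball 0 K else {0}) \<and>
    psd_on J (\<lambda>i j. \<zeta> (i, j))}"
proof -
  let ?B = "PiE UNIV (\<lambda>p. if p \<in> J \<times> J then cball 0 K else {0}) :: ('j \<times> 'j \<Rightarrow> complex) set"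
  have "compactin (product_topology (\<lambda>_. euclidean) UNIV) ?B"
    unfolding compactin_PiE by simp
  then have "compact ?B"
    unfolding euclidean_product_topology[symmetric] by (simp add: euclidean_product_topology)
  moreover have cont: "continuous_on UNIV (\<lambda>\<zeta>. form J J (\<lambda>i j. \<zeta> (i, j)) v v)" for v :: "'j \<Rightarrow> complex"
    unfolding form_def by (intro continuous_intros continuous_on_product_coordinates)
  have "closed {\<zeta> :: 'j \<times> 'j \<Rightarrow> complex. psd_on J (\<lambda>i j. \<zeta> (i, j))}"
    unfolding psd_on_iff_coercive coercive_on_def complex_is_Real_iff
    by (intro closed_Collect_all closed_Collect_conj closed_Collect_eq closed_Collect_le
        continuous_intros cont) 
  ultimately show ?thesis
    using compact_Int_closed unfolding Collect_conj_eq by auto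
qed

lemma quadratic_first_order:
  fixes a b :: real
  assumes "\<And>s. 0 < s \<Longrightarrow> s \<le> 1 \<Longrightarrow> 0 \<le> 2 * s * a + s\<^sup>2 * b" "0 \<le> b"
  shows "0 \<le> a"
proof (rule ccontr)
  assume "\<not> 0 \<le> a"
  then have a: "a < 0" by simp
  \<comment> \<open>Small enough that the linear term dominates: s (b + 1) \<le> - a makes 2 a + s b
    negative. The 1 added to \<open>b\<close> keeps the quotient meaningful for b = 0.\<close>
  define s where "s = min 1 (- a / (b + 1))"
  have s: "0 < s" "s \<le> 1" using a assms(2) by (auto simp: s_def divide_neg_pos)
  have "s * (b + 1) \<le> - a" 
  proof -
    have "s \<le> - a / (b + 1)" by (simp add: s_def)
    moreover have "0 < b + 1" using assms(2) by simp
    ultimately show ?thesis by (simp only: pos_le_divide_eq)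
  qed
  then have "2 * a + s * b < 0" using a s by (simp add: algebra_simps)
  then have "s * (2 * a + s * b) < 0" using s by (simp add: mult_less_0_iff)
  then show False using assms(1)[OF s] by (simp add: power2_eq_square algebra_simps)
qed

text \<open>A Farkas lemma for the cone of positive semidefinite matrices. The last two hypotheses
  say that the level sets are bounded and that no dual certificate separates \<open>t\<close> from the
  image of the cone; the point of the cone whose image is nearest to \<open>t\<close> is then a solution,
  since otherwise its residual would be such a certificate.\<close>

lemma psd_cone_farkas:
  fixes \<Lambda> :: "'c \<Rightarrow> ('j \<Rightarrow> 'j \<Rightarrow> complex) \<Rightarrow> complex" and t :: "'c \<Rightarrow> complex"
  assumes J: "finite J" and C: "finite C"
    and cong: "\<And>c Z Z'. c \<in> C \<Longrightarrow> (\<And>i j. i \<in> J \<Longrightarrow> j \<in> J \<Longrightarrow> Z i j = Z' i j) \<Longrightarrow> \<Lambda> c Z = \<Lambda> c Z'"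
    and lin: "\<And>c Z W s. c \<in> C \<Longrightarrow> \<Lambda> c (\<lambda>i j. Z i j + of_real s * W i j) = \<Lambda> c Z + of_real s * \<Lambda> c W"
    and cont: "\<And>c. c \<in> C \<Longrightarrow> continuous_on UNIV (\<lambda>\<zeta>. \<Lambda> c (\<lambda>i j. \<zeta> (i, j)))"
    and bounded: "\<And>b. \<exists>K. \<forall>Z. psd_on J Z \<longrightarrow> (\<forall>c\<in>C. cmod (\<Lambda> c Z) \<le> b) \<longrightarrow> (\<forall>i\<in>J. Re (Z i i) \<le> K)"
    and dual: "\<And>D. (\<And>Z. psd_on J Z \<Longrightarrow> 0 \<le> Re (\<Sum>c\<in>C. cnj (D c) * \<Lambda> c Z)) \<Longrightarrow>
      0 \<le> Re (\<Sum>c\<in>C. cnj (D c) * t c)"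
  shows "\<exists>Z. psd_on J Z \<and> (\<forall>c\<in>C. \<Lambda> c Z = t c)"
proof -
  define f where "f = (\<lambda>Z. \<Sum>c\<in>C. (cmod (\<Lambda> c Z - t c))\<^sup>2)"
  have L0: "\<Lambda> c (\<lambda>i j. 0) = 0" if "c \<in> C" for c
    using lin[OF that, of "\<lambda>i j. 0" 1 "\<lambda>i j. 0"] by simp
  define F where "F = (\<Sum>c\<in>C. (cmod (t c))\<^sup>2)"
  have f0: "f (\<lambda>i j. 0) = F" by (simp add: f_def F_def L0)
  \<comment> \<open>\<open>F\<close> is the objective at the zero matrix. On the level set f Z \<le>
    F both the residual and \<open>t\<close> have components of modulus at most
    \<open>sqrt F\<close>, whence the factor 2.\<close>
  obtain K0 where K0: "\<And>Z i. psd_on J Z \<Longrightarrow> (\<forall>c\<in>C. cmod (\<Lambda> c Z) \<le> 2 * sqrt F) \<Longrightarrow> i \<in> J \<Longrightarrow> Re (Z i i) \<le> K0"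
    using bounded by meson
  \<comment> \<open>Nonnegative, so that the discs contain 0 and the zero matrix lies in
    \<open>S\<close>.\<close>
  define K where "K = max K0 0"
  have entry: "cmod (Z i j) \<le> K" if Z: "psd_on J Z" "f Z \<le> F" and ij: "i \<in> J" "j \<in> J" for Z i j
  proof -
    have "cmod (\<Lambda> c Z) \<le> 2 * sqrt F" if c: "c \<in> C" for c
    proof -
      have "(cmod (\<Lambda> c Z - t c))\<^sup>2 \<le> f Z"
        unfolding f_def by (rule member_le_sum) (use c C in auto)
      then have 1: "cmod (\<Lambda> c Z - t c) \<le> sqrt F" using Z(2) by (simp add: real_le_rsqrt)
      have "(cmod (t c))\<^sup>2 \<le> F"
        unfolding F_def by (rule member_le_sum) (use c C in auto)
      then have 2: "cmod (t c) \<le> sqrt F" by (simp add: real_le_rsqrt)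
      show ?thesis using 1 2 norm_triangle_ineq[of "\<Lambda> c Z - t c" "t c"] by simp
    qed
    then have "Re (Z i i) \<le> K0" "Re (Z j j) \<le> K0" using K0 Z ij by blast+
    then show ?thesis using psd_entry_bound[OF J Z(1) ij] by (simp add: K_def)
  qed
  define S where "S = {\<zeta> :: 'j \<times> 'j \<Rightarrow> complex. \<zeta> \<in> PiE UNIV (\<lambda>p. if p \<in> J \<times> J then cball 0 K else {0}) \<and>
    psd_on J (\<lambda>i j. \<zeta> (i, j))}"
  have "compact S" unfolding S_def by (rule compact_psd_bounded[OF J])
  moreover have zS: "(\<lambda>_. 0) \<in> S" by (auto simp: S_def K_def psd_on_zero)
  moreover have "continuous_on S (\<lambda>\<zeta>. f (\<lambda>i j. \<zeta> (i, j)))"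
    unfolding f_def by (intro continuous_intros continuous_on_subset[OF cont]) auto
  ultimately obtain \<zeta> where \<zeta>: "\<zeta> \<in> S" and min: "\<And>\<eta>. \<eta> \<in> S \<Longrightarrow> f (\<lambda>i j. \<zeta> (i, j)) \<le> f (\<lambda>i j. \<eta> (i, j))"
    using continuous_attains_inf[of S "\<lambda>\<zeta>. f (\<lambda>i j. \<zeta> (i, j))"] by blast
  define Z0 where "Z0 = (\<lambda>i j. \<zeta> (i, j))"
  have Z0: "psd_on J Z0" using \<zeta> by (simp add: S_def Z0_def)
  have glob: "f Z0 \<le> f Z" if Z: "psd_on J Z" for Z
  proof (cases "f Z \<le> F")
    case True
    \<comment> \<open>Truncating to J x J lands in the compact set; by \<open>cong\<close> it leaves
      the objective unchanged.\<close>
    define \<eta> where "\<eta> = (\<lambda>(i,j). if i \<in> J \<and> j \<in> J then Z i j else 0)"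
    have "psd_on J (\<lambda>i j. \<eta> (i, j))"
      using Z by (subst psd_on_cong[of J _ Z]) (auto simp: \<eta>_def)
    then have "\<eta> \<in> S" using entry[OF Z True] by (auto simp: S_def \<eta>_def)
    moreover have "f (\<lambda>i j. \<eta> (i, j)) = f Z"
    proof -
      have "\<Lambda> c (\<lambda>i j. \<eta> (i, j)) = \<Lambda> c Z" if "c \<in> C" for c
        by (rule cong[OF that]) (auto simp: \<eta>_def)
      then show ?thesis by (simp add: f_def)
    qed
    ultimately show ?thesis using min[of \<eta>] by (simp add: Z0_def)
  next
    case False
    then show ?thesis using min[OF zS] f0 by (simp add: Z0_def)
  qed
  define D where "D = (\<lambda>c. \<Lambda> c Z0 - t c)"
  have direction: "0 \<le> Re (\<Sum>c\<in>C. cnj (D c) * \<Lambda> c W)"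
    if W: "\<And>s. 0 < s \<Longrightarrow> s \<le> 1 \<Longrightarrow> psd_on J (\<lambda>i j. Z0 i j + of_real s * W i j)" for W
  proof (rule quadratic_first_order)
    show "0 \<le> (\<Sum>c\<in>C. (cmod (\<Lambda> c W))\<^sup>2)" by (simp add: sum_nonneg)
    fix s :: real assume s: "0 < s" "s \<le> 1"
    have "(cmod (D c + of_real s * \<Lambda> c W))\<^sup>2 =
      (cmod (D c))\<^sup>2 + 2 * s * Re (cnj (D c) * \<Lambda> c W) + s\<^sup>2 * (cmod (\<Lambda> c W))\<^sup>2" for c
      unfolding cmod_power2 by (simp add: power2_eq_square algebra_simps)
    then have "f (\<lambda>i j. Z0 i j + of_real s * W i j) =
      (\<Sum>c\<in>C. (cmod (D c))\<^sup>2 + 2 * s * Re (cnj (D c) * \<Lambda> c W) + s\<^sup>2 * (cmod (\<Lambda> c W))\<^sup>2)"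
      unfolding f_def by (intro sum.cong refl) (simp add: lin D_def algebra_simps)
    also have "\<dots> = f Z0 + 2 * s * Re (\<Sum>c\<in>C. cnj (D c) * \<Lambda> c W) + s\<^sup>2 * (\<Sum>c\<in>C. (cmod (\<Lambda> c W))\<^sup>2)"
      by (simp only: sum.distrib f_def D_def sum_distrib_left Re_sum)
    finally show "0 \<le> 2 * s * Re (\<Sum>c\<in>C. cnj (D c) * \<Lambda> c W) + s\<^sup>2 * (\<Sum>c\<in>C. (cmod (\<Lambda> c W))\<^sup>2)"
      using glob[OF W[OF s]] by simp
  qed
  have "0 \<le> Re (\<Sum>c\<in>C. cnj (D c) * \<Lambda> c Z)" if "psd_on J Z" for Z
    by (rule direction) (use psd_on_add_scale[OF Z0 that] in auto)
  then have t: "0 \<le> Re (\<Sum>c\<in>C. cnj (D c) * t c)" by (rule dual)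
  \<comment> \<open>Shrinking \<open>Z0\<close> stays in the cone for s \<le> 1, so -Z0 is a
    feasible direction and Re <D, \<Lambda> Z0> \<le> 0. Since <D, \<Lambda> Z0> = <D, t> + |D|^2
    and Re <D, t> is nonnegative by \<open>dual\<close>, the residual vanishes.\<close>
  have "0 \<le> Re (\<Sum>c\<in>C. cnj (D c) * \<Lambda> c (\<lambda>i j. 0 + of_real (-1) * Z0 i j))"
  proof (rule direction)
    fix s :: real assume "0 < s" "s \<le> 1"
    then have "psd_on J (\<lambda>i j. of_real (1 - s) * Z0 i j)" by (intro psd_on_scale Z0) simp
    then show "psd_on J (\<lambda>i j. Z0 i j + of_real s * (0 + of_real (-1) * Z0 i j))"
      by (simp add: algebra_simps)
  qed
  also have "(\<Sum>c\<in>C. cnj (D c) * \<Lambda> c (\<lambda>i j. 0 + of_real (-1) * Z0 i j)) = - (\<Sum>c\<in>C. cnj (D c) * \<Lambda> c Z0)"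
    unfolding sum_negf[symmetric] by (intro sum.cong refl) (simp only: lin L0, simp)
  also have "\<dots> = - (\<Sum>c\<in>C. cnj (D c) * t c) - (\<Sum>c\<in>C. cnj (D c) * D c)"
    by (simp add: D_def algebra_simps sum_subtractf sum.distrib)
  also have "(\<Sum>c\<in>C. cnj (D c) * D c) = of_real (\<Sum>c\<in>C. (cmod (D c))\<^sup>2)"
    by (simp only: of_real_sum complex_norm_square mult.commute)
  finally have "(\<Sum>c\<in>C. (cmod (D c))\<^sup>2) \<le> 0" using t by simp
  then have "(\<Sum>c\<in>C. (cmod (D c))\<^sup>2) = 0" by (meson antisym sum_nonneg zero_le_power2)
  then have "\<forall>c\<in>C. D c = 0" using C by (simp add: sum_nonneg_eq_0_iff)
  then show ?thesis using Z0 by (auto simp: D_def)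
qed

subsection \<open>Factorization of complete contractions\<close>

text \<open>The summation index is moved to natural numbers because the amplification levels in
  \<open>S1_matnorm\<close> are indexed that way; the contraction to be built lives at level
  \<open>card I\<close>.\<close>

lemma cholesky_nat:
  assumes "finite I" "coercive_on e I M" "0 < e"
  obtains L :: "nat \<Rightarrow> 'i \<Rightarrow> complex" and V :: "'i \<Rightarrow> nat \<Rightarrow> complex"
  where "\<And>i j. i \<in> I \<Longrightarrow> j \<in> I \<Longrightarrow> M i j = (\<Sum>p<card I. cnj (L p i) * L p j)"
    "\<And>i j. i \<in> I \<Longrightarrow> j \<in> I \<Longrightarrow> (\<Sum>p<card I. V i p * L p j) = (if i = j then 1 else 0)"
    "\<And>p q. p < card I \<Longrightarrow> q < card I \<Longrightarrow> (\<Sum>i\<in>I. L p i * V i q) = (if p = q then 1 else 0)"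
proof -
  obtain h where h: "bij_betw h {..<card I} I"
    using ex_bij_betw_nat_finite[OF assms(1)] by (auto simp: atLeast0LessThan)
  obtain L V where *: "\<forall>i\<in>I. \<forall>j\<in>I. M i j = (\<Sum>m\<in>I. cnj (L m i) * L m j)"
    "\<forall>i\<in>I. \<forall>j\<in>I. (\<Sum>m\<in>I. V i m * L m j) = (if i = j then 1 else 0)"
    "\<forall>i\<in>I. \<forall>j\<in>I. (\<Sum>m\<in>I. L i m * V m j) = (if i = j then 1 else 0)"
    using cholesky[of I e M] assms by auto
  show ?thesis
  proof (rule that[of "\<lambda>p. L (h p)" "\<lambda>i p. V i (h p)"])
    fix i j assume ij: "i \<in> I" "j \<in> I"
    show "M i j = (\<Sum>p<card I. cnj (L (h p) i) * L (h p) j)"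
      using * ij sum.reindex_bij_betw[OF h, of "\<lambda>m. cnj (L m i) * L m j"] by simp
    show "(\<Sum>p<card I. V i (h p) * L (h p) j) = (if i = j then 1 else 0)"
      using * ij sum.reindex_bij_betw[OF h, of "\<lambda>m. V i m * L m j"] by simp
  next
    fix p q assume pq: "p < card I" "q < card I"
    then have "h p = h q \<longleftrightarrow> p = q" "h p \<in> I" "h q \<in> I"
      using h by (auto simp: bij_betw_def inj_on_def)
    then show "(\<Sum>i\<in>I. L (h p) i * V i (h q)) = (if p = q then 1 else 0)"
      using * by simp
  qed
qed

text \<open>The Hermitian part of \<open>R\<close> plus e times the identity. A dual certificate
  controls only the real part of the form of \<open>R\<close>, so \<open>R\<close> itself need not
  be Hermitian.\<close>

definition herm_shift :: "real \<Rightarrow> ('i \<Rightarrow> 'i \<Rightarrow> complex) \<Rightarrow> 'i \<Rightarrow> 'i \<Rightarrow> complex" where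
  "herm_shift e R = (\<lambda>i j. (R i j + cnj (R j i)) / 2 + (if i = j then of_real e else 0))"

lemma form_herm_shift:
  assumes "finite I"
  shows "form I I (herm_shift e R) v v = of_real (Re (form I I R v v) + e * (\<Sum>i\<in>I. (cmod (v i))\<^sup>2))"
proof -
  have c: "(\<Sum>i\<in>I. \<Sum>j\<in>I. cnj (v i) * cnj (R j i) * v j) = cnj (form I I R v v)"
    unfolding form_def cnj_sum by (subst sum.swap) (simp add: mult_ac)
  have d: "(\<Sum>i\<in>I. \<Sum>j\<in>I. cnj (v i) * (if i = j then of_real e else 0) * v j)
    = of_real (e * (\<Sum>i\<in>I. (cmod (v i))\<^sup>2))"
  proof -
    have "(\<Sum>i\<in>I. \<Sum>j\<in>I. cnj (v i) * (if i = j then of_real e else 0) * v j)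
      = (\<Sum>i\<in>I. \<Sum>j\<in>I. if i = j then of_real e * (cnj (v i) * v j) else 0)"
      by (intro sum.cong refl) auto
    also have "\<dots> = (\<Sum>i\<in>I. of_real e * (cnj (v i) * v i))" using assms by simp
    also have "\<dots> = of_real e * (\<Sum>i\<in>I. of_real ((cmod (v i))\<^sup>2))"
      by (simp only: sum_distrib_left complex_norm_square mult.commute)
    finally show ?thesis by simp
  qed
  have "form I I (herm_shift e R) v v = (form I I R v v + (\<Sum>i\<in>I. \<Sum>j\<in>I. cnj (v i) * cnj (R j i) * v j)) / 2
    + (\<Sum>i\<in>I. \<Sum>j\<in>I. cnj (v i) * (if i = j then of_real e else 0) * v j)"
    unfolding form_def herm_shift_def sum.distrib[symmetric] sum_divide_distrib
    by (intro sum.cong refl) (simp add: algebra_simps add_divide_distrib)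
  then show ?thesis unfolding c d by (simp add: complex_add_cnj)
qed

lemma coercive_herm_shift:
  assumes "finite I" "\<And>v. 0 \<le> Re (form I I R v v)"
  shows "coercive_on e I (herm_shift e R)"
  using assms by (simp add: coercive_on_def form_herm_shift)

lemma sum_swap4:
  "(\<Sum>p\<in>A. \<Sum>q\<in>B. \<Sum>i\<in>C. \<Sum>j\<in>D. t p q i j) = (\<Sum>i\<in>C. \<Sum>j\<in>D. \<Sum>p\<in>A. \<Sum>q\<in>B. t p q i j)"
proof -
  have "(\<Sum>p\<in>A. \<Sum>q\<in>B. \<Sum>i\<in>C. \<Sum>j\<in>D. t p q i j)
      = (\<Sum>x\<in>A \<times> B. \<Sum>y\<in>C \<times> D. t (fst x) (snd x) (fst y) (snd y))"
    by (simp add: sum.cartesian_product')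
  also have "\<dots> = (\<Sum>y\<in>C \<times> D. \<Sum>x\<in>A \<times> B. t (fst x) (snd x) (fst y) (snd y))"
    by (rule sum.swap)
  finally show ?thesis by (simp add: sum.cartesian_product')
qed

lemma sum_sandwich:
  fixes Y :: "'i \<Rightarrow> 'j \<Rightarrow> complex"
  shows "(\<Sum>p\<in>A. \<Sum>q\<in>B. x p * (\<Sum>i\<in>I. \<Sum>j\<in>J. c i p * Y i j * d j q) * y q)
    = (\<Sum>i\<in>I. \<Sum>j\<in>J. (\<Sum>p\<in>A. x p * c i p) * Y i j * (\<Sum>q\<in>B. d j q * y q))"
proof -
  have "(\<Sum>p\<in>A. \<Sum>q\<in>B. x p * (\<Sum>i\<in>I. \<Sum>j\<in>J. c i p * Y i j * d j q) * y q)
    = (\<Sum>p\<in>A. \<Sum>q\<in>B. \<Sum>i\<in>I. \<Sum>j\<in>J. x p * c i p * Y i j * (d j q * y q))"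
    by (simp add: sum_distrib_left sum_distrib_right mult_ac)
  also have "\<dots> = (\<Sum>i\<in>I. \<Sum>j\<in>J. \<Sum>p\<in>A. \<Sum>q\<in>B. x p * c i p * Y i j * (d j q * y q))"
    by (rule sum_swap4)
  finally show ?thesis by (simp add: sum_distrib_left sum_distrib_right mult_ac)
qed

text \<open>If M = L* L and L V = 1, then L sends V w back to w: substituting V w normalizes the
  form to the standard one.\<close>

lemma form_gram_inverse:
  fixes n :: nat
  assumes I: "finite I"
    and M: "\<And>i j. i \<in> I \<Longrightarrow> j \<in> I \<Longrightarrow> M i j = (\<Sum>p<n. cnj (L p i) * L p j)"
    and LV: "\<And>p q. p < n \<Longrightarrow> q < n \<Longrightarrow> (\<Sum>i\<in>I. L p i * V i q) = (if p = q then 1 else 0)"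
  shows "form I I M (\<lambda>i. \<Sum>q<n. V i q * w q) (\<lambda>i. \<Sum>q<n. V i q * w q) = of_real (\<Sum>p<n. (cmod (w p))\<^sup>2)"
proof -
  have "(\<Sum>i\<in>I. L p i * (\<Sum>q<n. V i q * w q)) = w p" if "p < n" for p
  proof -
    have "(\<Sum>i\<in>I. L p i * (\<Sum>q<n. V i q * w q)) = (\<Sum>q<n. (\<Sum>i\<in>I. L p i * V i q) * w q)"
      by (simp add: sum_distrib_left sum_distrib_right mult.assoc) (rule sum.swap)
    also have "\<dots> = (\<Sum>q<n. if p = q then w q else 0)"
      by (intro sum.cong refl) (use LV that in auto)
    finally show ?thesis using that by simp
  qed
  then show ?thesis by (subst form_gram[OF M]) auto
qed

text \<open>The squared Hilbert-Schmidt norm of a Cholesky factor is the trace of the matrix; the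
  shift adds \<open>e\<close> once per index.\<close>

lemma trace_herm_shift:
  fixes n :: nat
  assumes "finite I"
    and "\<And>i j. i \<in> I \<Longrightarrow> j \<in> I \<Longrightarrow> herm_shift e R i j = (\<Sum>p<n. cnj (L p i) * L p j)"
  shows "(vnorm ({..<n} \<times> I) (\<lambda>(p,i). L p i))\<^sup>2 = Re (\<Sum>i\<in>I. R i i) + e * card I"
proof -
  have "(vnorm ({..<n} \<times> I) (\<lambda>(p,i). L p i))\<^sup>2 = (\<Sum>p<n. \<Sum>i\<in>I. (cmod (L p i))\<^sup>2)"
    by (simp add: vnorm_power2 sum.cartesian_product')
  also have "\<dots> = (\<Sum>i\<in>I. \<Sum>p<n. Re (cnj (L p i) * L p i))"
    unfolding cmod_power2 by (subst sum.swap) (simp add: power2_eq_square)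
  also have "\<dots> = (\<Sum>i\<in>I. Re (herm_shift e R i i))"
    by (intro sum.cong refl) (simp only: assms Re_sum)
  also have "\<dots> = (\<Sum>i\<in>I. Re (R i i) + e)"
    by (simp add: herm_shift_def)
  finally show ?thesis by (simp add: sum.distrib mult.commute)
qed

text \<open>\<open>H\<close> says that the Hermitian part of the block matrix with diagonal blocks R
  (x) 1 and S (x) 1 and upper corner Y is positive; its off-diagonal block is Y / 2. Normalizing the
  diagonal blocks to the identity makes that block a contraction, and \<open>u\<close> is tested on
  it.\<close>

lemma S1_dual_certificate_eps:
  fixes u :: "'i \<Rightarrow> 'i \<Rightarrow> 'a::finite \<Rightarrow> 'a \<Rightarrow> complex" and e :: real
  assumes I: "finite I" and u: "S1_matnorm I u \<le> 1"
    and H: "\<And>p q. 0 \<le> (\<Sum>a\<in>UNIV. Re (form I I R (\<lambda>i. p (i,a)) (\<lambda>i. p (i,a)))) +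
       (\<Sum>a\<in>UNIV. Re (form I I S (\<lambda>i. q (i,a)) (\<lambda>i. q (i,a)))) + Re (form (I \<times> UNIV) (I \<times> UNIV) Y p q)"
    and e: "0 < e"
  shows "0 \<le> Re (\<Sum>i\<in>I. R i i) + Re (\<Sum>i\<in>I. S i i) + 2 * e * card I +
    Re (\<Sum>i\<in>I. \<Sum>j\<in>I. \<Sum>a\<in>UNIV. \<Sum>a'\<in>UNIV. u i j a a' * Y (i,a') (j,a))"
proof -
  fix a0 :: 'a
  let ?n = "card I"
  have z: "form I' J' M (\<lambda>_. 0) v = 0" "form I' J' M w (\<lambda>_. 0) = 0" for I' :: "'c set" and J' :: "'d set" and M w v
    by (simp_all add: form_def)
  \<comment> \<open>Vectors supported on the single slice \<open>a0\<close> isolate one copy of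
    \<open>R\<close>; the same choice isolates \<open>S\<close> below.\<close>
  have R0: "0 \<le> Re (form I I R v v)" for v
  proof -
    have "(\<Sum>a\<in>UNIV. Re (form I I R (\<lambda>i. if a = a0 then v i else 0) (\<lambda>i. if a = a0 then v i else 0)))
      = (\<Sum>a\<in>UNIV. if a = a0 then Re (form I I R v v) else 0)"
      by (intro sum.cong refl) (auto simp: z)
    then show ?thesis using H[of "\<lambda>(i,a). if a = a0 then v i else 0" "\<lambda>_. 0"] by (simp add: z)
  qed
  have S0: "0 \<le> Re (form I I S v v)" for v
  proof -
    have "(\<Sum>a\<in>UNIV. Re (form I I S (\<lambda>i. if a = a0 then v i else 0) (\<lambda>i. if a = a0 then v i else 0)))
      = (\<Sum>a\<in>UNIV. if a = a0 then Re (form I I S v v) else 0)"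
      by (intro sum.cong refl) (auto simp: z)
    then show ?thesis using H[of "\<lambda>_. 0" "\<lambda>(i,a). if a = a0 then v i else 0"] by (simp add: z)
  qed
  obtain L V where L: "\<And>i j. i \<in> I \<Longrightarrow> j \<in> I \<Longrightarrow> herm_shift e R i j = (\<Sum>p<?n. cnj (L p i) * L p j)"
    and VL: "\<And>i j. i \<in> I \<Longrightarrow> j \<in> I \<Longrightarrow> (\<Sum>p<?n. V i p * L p j) = (if i = j then 1 else 0)"
    and LV: "\<And>p q. p < ?n \<Longrightarrow> q < ?n \<Longrightarrow> (\<Sum>i\<in>I. L p i * V i q) = (if p = q then 1 else 0)"
    using cholesky_nat[OF I coercive_herm_shift[OF I R0, of e] e] by blast
  obtain M W where M: "\<And>i j. i \<in> I \<Longrightarrow> j \<in> I \<Longrightarrow> herm_shift e S i j = (\<Sum>p<?n. cnj (M p i) * M p j)"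
    and WM: "\<And>i j. i \<in> I \<Longrightarrow> j \<in> I \<Longrightarrow> (\<Sum>p<?n. W i p * M p j) = (if i = j then 1 else 0)"
    and MW: "\<And>p q. p < ?n \<Longrightarrow> q < ?n \<Longrightarrow> (\<Sum>i\<in>I. M p i * W i q) = (if p = q then 1 else 0)"
    using cholesky_nat[OF I coercive_herm_shift[OF I S0, of e] e] by blast
  have Rle: "Re (form I I R v v) \<le> Re (form I I (herm_shift e R) v v)" for R v
    using e by (simp add: form_herm_shift[OF I] sum_nonneg)
  \<comment> \<open>V* (Y / 2) W, the off-diagonal block after normalization. The 1/2 balances the
    two diagonal terms: each is at most 1 on the unit ball, and the cross term equals twice the form
    of \<open>N\<close>.\<close>
  define N where "N = (\<lambda>p q a a'. \<Sum>i\<in>I. \<Sum>j\<in>I. cnj (V i p) * Y (i,a) (j,a') * (W j q / 2))"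
  have "contractive ?n N"
  proof (rule opnorm_le_unit)
    fix w v :: "nat \<times> 'a \<Rightarrow> complex"
    assume w: "vnorm ({..<?n} \<times> UNIV) w \<le> 1" and v: "vnorm ({..<?n} \<times> UNIV) v \<le> 1"
    let ?f = "form ({..<?n} \<times> UNIV) ({..<?n} \<times> UNIV) (\<lambda>(p,a) (q,a'). N p q a a') w v"
    \<comment> \<open>A phase turning the form into a negative real number, so that \<open>H\<close>
      reads 0 \<le> 1 + 1 - 2 |f|.\<close>
    obtain c where c: "cmod c = 1" "c * ?f = - of_real (cmod ?f)"
    proof (cases "?f = 0")
      case True
      then show ?thesis using that[of 1] by simp
    next
      case False
      then show ?thesis
        using that[of "- cnj ?f / cmod ?f"] complex_norm_square[of ?f]
        by (simp add: norm_divide field_simps power2_eq_square)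
    qed
    define P where "P = (\<lambda>(i,a). \<Sum>p<?n. V i p * w (p,a))"
    define Q where "Q = (\<lambda>(i,a). \<Sum>p<?n. W i p * (c * v (p,a)))"
    have "form (I \<times> UNIV) (I \<times> UNIV) Y P Q = (\<Sum>i\<in>I. \<Sum>a\<in>UNIV. \<Sum>j\<in>I. \<Sum>a'\<in>UNIV.
        (\<Sum>p<?n. cnj (w (p,a)) * cnj (V i p)) * Y (i,a) (j,a') * (\<Sum>q<?n. W j q * (c * v (q,a'))))"
      by (simp add: form_def P_def Q_def sum.cartesian_product' mult.commute)
    also have "\<dots> = (\<Sum>i\<in>I. \<Sum>a\<in>UNIV. \<Sum>a'\<in>UNIV. \<Sum>j\<in>I.
        (\<Sum>p<?n. cnj (w (p,a)) * cnj (V i p)) * Y (i,a) (j,a') * (\<Sum>q<?n. W j q * (c * v (q,a'))))"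
      by (intro sum.cong refl sum.swap)
    also have "\<dots> = (\<Sum>a\<in>UNIV. \<Sum>a'\<in>UNIV. \<Sum>i\<in>I. \<Sum>j\<in>I.
        (\<Sum>p<?n. cnj (w (p,a)) * cnj (V i p)) * Y (i,a) (j,a') * (\<Sum>q<?n. W j q * (c * v (q,a'))))"
      by (subst sum.swap[of _ UNIV I], intro sum.cong refl sum.swap)
    also have "\<dots> = (\<Sum>a\<in>UNIV. \<Sum>a'\<in>UNIV. \<Sum>p<?n. \<Sum>q<?n. cnj (w (p,a)) *
       (\<Sum>i\<in>I. \<Sum>j\<in>I. cnj (V i p) * Y (i,a) (j,a') * W j q) * (c * v (q,a')))"
      by (simp only: sum_sandwich)
    also have "\<dots> = (\<Sum>a\<in>UNIV. \<Sum>a'\<in>UNIV. \<Sum>p<?n. \<Sum>q<?n. 2 * c * (cnj (w (p,a)) * N p q a a' * v (q,a')))"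
      by (simp add: N_def mult_ac flip: sum_divide_distrib)
    also have "\<dots> = 2 * c * ?f"
    proof -
      have "?f = (\<Sum>p<?n. \<Sum>a\<in>UNIV. \<Sum>q<?n. \<Sum>a'\<in>UNIV. cnj (w (p,a)) * N p q a a' * v (q,a'))"
        by (simp add: form_def sum.cartesian_product')
      also have "\<dots> = (\<Sum>a\<in>UNIV. \<Sum>p<?n. \<Sum>a'\<in>UNIV. \<Sum>q<?n. cnj (w (p,a)) * N p q a a' * v (q,a'))"
        by (subst sum.swap, intro sum.cong refl sum.swap)
      also have "\<dots> = (\<Sum>a\<in>UNIV. \<Sum>a'\<in>UNIV. \<Sum>p<?n. \<Sum>q<?n. cnj (w (p,a)) * N p q a a' * v (q,a'))"
        by (intro sum.cong refl sum.swap)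
      finally show ?thesis by (simp only: sum_distrib_left)
    qed
    finally have Y: "Re (form (I \<times> UNIV) (I \<times> UNIV) Y P Q) = - 2 * cmod ?f"
      using c(2) by (simp add: mult.assoc)
    have sq: "(\<Sum>a\<in>UNIV. Re (form I I (herm_shift e K) (\<lambda>i. \<Sum>p<?n. B i p * x (p,a)) (\<lambda>i. \<Sum>p<?n. B i p * x (p,a))))
        = (vnorm ({..<?n} \<times> UNIV) x)\<^sup>2"
      if "\<And>i j. i \<in> I \<Longrightarrow> j \<in> I \<Longrightarrow> herm_shift e K i j = (\<Sum>p<?n. cnj (A p i) * A p j)"
        "\<And>p q. p < ?n \<Longrightarrow> q < ?n \<Longrightarrow> (\<Sum>i\<in>I. A p i * B i q) = (if p = q then 1 else 0)"
      for K A B and x :: "nat \<times> 'a \<Rightarrow> complex"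
    proof -
      have "form I I (herm_shift e K) (\<lambda>i. \<Sum>p<?n. B i p * x (p,a)) (\<lambda>i. \<Sum>p<?n. B i p * x (p,a))
        = of_real (\<Sum>p<?n. (cmod (x (p,a)))\<^sup>2)" for a
        by (rule form_gram_inverse[where w = "\<lambda>p. x (p,a)", OF I that])
      then show ?thesis
        by (simp add: vnorm_power2 sum.cartesian_product') (rule sum.swap)
    qed
    have "(\<Sum>a\<in>UNIV. Re (form I I R (\<lambda>i. P (i,a)) (\<lambda>i. P (i,a)))) \<le> (vnorm ({..<?n} \<times> UNIV) w)\<^sup>2"
    proof -
      have "(\<Sum>a\<in>UNIV. Re (form I I R (\<lambda>i. P (i,a)) (\<lambda>i. P (i,a)))) \<le> (\<Sum>a\<in>UNIV. Re (form I I (herm_shift e R)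
        (\<lambda>i. \<Sum>p<?n. V i p * w (p,a)) (\<lambda>i. \<Sum>p<?n. V i p * w (p,a))))"
        unfolding P_def by (intro sum_mono) (simp add: Rle)
      also have "\<dots> = (vnorm ({..<?n} \<times> UNIV) w)\<^sup>2"
        by (rule sq) (fact L, fact LV)
      finally show ?thesis .
    qed
    also have "\<dots> \<le> 1" using w by (intro power_le_one vnorm_nonneg)
    finally have 1: "(\<Sum>a\<in>UNIV. Re (form I I R (\<lambda>i. P (i,a)) (\<lambda>i. P (i,a)))) \<le> 1" .
    have "(\<Sum>a\<in>UNIV. Re (form I I S (\<lambda>i. Q (i,a)) (\<lambda>i. Q (i,a)))) \<le> (vnorm ({..<?n} \<times> UNIV) (\<lambda>z. c * v z))\<^sup>2"
    proof -
      have "(\<Sum>a\<in>UNIV. Re (form I I S (\<lambda>i. Q (i,a)) (\<lambda>i. Q (i,a)))) \<le> (\<Sum>a\<in>UNIV. Re (form I I (herm_shift e S)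
        (\<lambda>i. \<Sum>p<?n. W i p * (c * v (p,a))) (\<lambda>i. \<Sum>p<?n. W i p * (c * v (p,a)))))"
        unfolding Q_def by (intro sum_mono) (simp add: Rle)
      also have "\<dots> = (vnorm ({..<?n} \<times> UNIV) (\<lambda>z. c * v z))\<^sup>2"
        by (rule sq) (fact M, fact MW)
      finally show ?thesis .
    qed
    also have "\<dots> \<le> 1" using v by (simp add: power_le_one vnorm_scale vnorm_nonneg c(1))
    finally have 2: "(\<Sum>a\<in>UNIV. Re (form I I S (\<lambda>i. Q (i,a)) (\<lambda>i. Q (i,a)))) \<le> 1" .
    show "cmod ?f \<le> 1" using H[of P Q] 1 2 unfolding Y by linarith
  qed simp
  \<comment> \<open>The Cholesky factors themselves are the test vectors: V L = 1 and W M = 1 undo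
    the normalization inside \<open>N\<close>, leaving half the pairing of \<open>u\<close> with
    \<open>Y\<close>.\<close>
  note bound = S1_matnorm_leD[OF I u this, of "\<lambda>(p,i). L p i" "\<lambda>(q,j). M q j"]
  have "(\<Sum>p<?n. \<Sum>q<?n. cnj (L p i) * N p q a' a * M q j) = Y (i,a') (j,a) / 2"
    if ij: "i \<in> I" "j \<in> I" for i j a a'
  proof -
    have "(\<Sum>p<?n. \<Sum>q<?n. cnj (L p i) * N p q a' a * M q j) =
      (\<Sum>k\<in>I. \<Sum>l\<in>I. (\<Sum>p<?n. cnj (L p i) * cnj (V k p)) * Y (k,a') (l,a) * (\<Sum>q<?n. W l q / 2 * M q j))"
      unfolding N_def by (rule sum_sandwich)
    also have "\<dots> = (\<Sum>k\<in>I. \<Sum>l\<in>I. cnj (\<Sum>p<?n. V k p * L p i) * Y (k,a') (l,a) * (\<Sum>q<?n. W l q * M q j) / 2)"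
      by (simp add: mult_ac flip: sum_divide_distrib)
    also have "\<dots> = (\<Sum>k\<in>I. \<Sum>l\<in>I. if l = j then (if k = i then Y (k,a') (l,a) / 2 else 0) else 0)"
      by (intro sum.cong refl) (auto simp: VL WM ij)
    also have "\<dots> = Y (i,a') (j,a) / 2" using ij I by simp
    finally show ?thesis .
  qed
  then have f: "form ({..<?n} \<times> I) ({..<?n} \<times> I) (ampl u N) (\<lambda>(p,i). L p i) (\<lambda>(q,j). M q j) =
    (\<Sum>i\<in>I. \<Sum>j\<in>I. \<Sum>a\<in>UNIV. \<Sum>a'\<in>UNIV. u i j a a' * Y (i,a') (j,a)) / 2"
    unfolding form_ampl sum_divide_distrib by (intro sum.cong refl) simp
  define X where "X = (\<Sum>i\<in>I. \<Sum>j\<in>I. \<Sum>a\<in>UNIV. \<Sum>a'\<in>UNIV. u i j a a' * Y (i,a') (j,a))"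
  have "cmod X \<le> 2 * vnorm ({..<?n} \<times> I) (\<lambda>(p,i). L p i) * vnorm ({..<?n} \<times> I) (\<lambda>(q,j). M q j)"
    using bound unfolding f X_def[symmetric] norm_divide by simp
  \<comment> \<open>The inequality 2 x y \<le> x^2 + y^2 replaces a product of norms by a sum of
    traces, which is linear in \<open>R\<close> and \<open>S\<close> as the dual objective must
    be.\<close>
  also have "\<dots> \<le> (vnorm ({..<?n} \<times> I) (\<lambda>(p,i). L p i))\<^sup>2 + (vnorm ({..<?n} \<times> I) (\<lambda>(q,j). M q j))\<^sup>2"
    by (rule sum_squares_bound)
  also have "\<dots> = Re (\<Sum>i\<in>I. R i i) + Re (\<Sum>i\<in>I. S i i) + 2 * e * card I"
    by (simp add: trace_herm_shift[OF I L] trace_herm_shift[OF I M])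
  finally show ?thesis
    using abs_Re_le_cmod[of X] unfolding X_def[symmetric] by linarith
qed

lemma S1_dual_certificate:
  fixes u :: "'i \<Rightarrow> 'i \<Rightarrow> 'a::finite \<Rightarrow> 'a \<Rightarrow> complex"
  assumes I: "finite I" and u: "S1_matnorm I u \<le> 1"
    and H: "\<And>p q. 0 \<le> (\<Sum>a\<in>UNIV. Re (form I I R (\<lambda>i. p (i,a)) (\<lambda>i. p (i,a)))) +
       (\<Sum>a\<in>UNIV. Re (form I I S (\<lambda>i. q (i,a)) (\<lambda>i. q (i,a)))) + Re (form (I \<times> UNIV) (I \<times> UNIV) Y p q)"
  shows "0 \<le> Re (\<Sum>i\<in>I. R i i) + Re (\<Sum>i\<in>I. S i i) +
    Re (\<Sum>i\<in>I. \<Sum>j\<in>I. \<Sum>a\<in>UNIV. \<Sum>a'\<in>UNIV. u i j a a' * Y (i,a') (j,a))"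
    (is "0 \<le> ?X")
proof (rule ccontr)
  define X where "X = ?X"
  assume "\<not> 0 \<le> ?X"
  then have X: "X < 0" by (simp add: X_def)
  \<comment> \<open>The error 2 e |I| then uses up at most half of the gap -X. The 1 added to
    \<open>card I\<close> keeps \<open>e\<close> positive for empty I.\<close>
  define e where "e = - X / (4 * (real (card I) + 1))"
  have e: "0 < e" using X by (simp add: e_def divide_neg_pos)
  have "0 \<le> X + 2 * e * card I"
    unfolding X_def using S1_dual_certificate_eps[OF I u H e] by linarith
  moreover have "2 * e * card I \<le> 2 * e * (real (card I) + 1)" using e by simp
  moreover have "2 * e * (real (card I) + 1) = - X / 2"
    by (simp add: e_def field_simps)
  ultimately show False using X by linarith
qed

text \<open>\<open>f\<close> is read as a map from C^I into C^F (x) C^A, with \<open>a\<close> an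
  output index: a Stinespring isometry whose Gram matrix f* f has partial trace 1 over A.\<close>

definition isometric_on :: "'i set \<Rightarrow> 'm set \<Rightarrow> ('m \<Rightarrow> 'i \<times> 'a::finite \<Rightarrow> complex) \<Rightarrow> bool" where
  "isometric_on I F f \<longleftrightarrow> (\<forall>i\<in>I. \<forall>j\<in>I.
     (\<Sum>m\<in>F. \<Sum>a\<in>UNIV. cnj (f m (i,a)) * f m (j,a)) = (if i = j then 1 else 0))"

text \<open>The unknown is the Choi matrix of a 2 x 2 block completely positive map with the map of
  \<open>u\<close> in its corner. The Gram vectors of a solution, restricted to the two summands of
  the index set, are \<open>f\<close> and \<open>g\<close>.\<close>

lemma S1_factorization:
  fixes u :: "'i \<Rightarrow> 'i \<Rightarrow> 'a::finite \<Rightarrow> 'a \<Rightarrow> complex"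
  assumes I: "finite I" and u: "S1_matnorm I u \<le> 1"
  obtains F :: "('i \<times> 'a + 'i \<times> 'a) set" and f g where "finite F"
    "\<And>i j a a'. i \<in> I \<Longrightarrow> j \<in> I \<Longrightarrow> u i j a' a = (\<Sum>m\<in>F. cnj (f m (i,a)) * g m (j,a'))"
    "isometric_on I F f" "isometric_on I F g"
proof -
  let ?IA = "I \<times> (UNIV :: 'a set)"
  let ?J = "?IA <+> ?IA"
  let ?C = "(I \<times> I) <+> ((I \<times> I) <+> (?IA \<times> ?IA))"
  \<comment> \<open>The constraints prescribe the partial traces over A of both diagonal corners and
    every entry of the upper corner; the lower corner follows by Hermitian symmetry.\<close>
  define \<Lambda> where "\<Lambda> = (\<lambda>c (Z :: 'i \<times> 'a + 'i \<times> 'a \<Rightarrow> 'i \<times> 'a + 'i \<times> 'a \<Rightarrow> complex). case c of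
      Inl (i,j) \<Rightarrow> (\<Sum>a\<in>UNIV. Z (Inl (i,a)) (Inl (j,a)))
    | Inr (Inl (i,j)) \<Rightarrow> (\<Sum>a\<in>UNIV. Z (Inr (i,a)) (Inr (j,a)))
    | Inr (Inr (\<alpha>,\<beta>)) \<Rightarrow> Z (Inl \<alpha>) (Inr \<beta>))"
  define t :: "'i \<times> 'i + 'i \<times> 'i + ('i \<times> 'a) \<times> ('i \<times> 'a) \<Rightarrow> complex" where "t = (\<lambda>c. case c of
      Inl (i,j) \<Rightarrow> (if i = j then 1 else 0)
    | Inr (Inl (i,j)) \<Rightarrow> (if i = j then 1 else 0)
    | Inr (Inr ((i,a),(j,a'))) \<Rightarrow> u i j a' a)"
  have "\<exists>Z. psd_on ?J Z \<and> (\<forall>c\<in>?C. \<Lambda> c Z = t c)"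
  proof (rule psd_cone_farkas)
    show "finite ?J" "finite ?C" using I by auto
    show "\<Lambda> c Z = \<Lambda> c Z'" if "c \<in> ?C" "\<And>i j. i \<in> ?J \<Longrightarrow> j \<in> ?J \<Longrightarrow> Z i j = Z' i j" for c Z Z'
      using that(1) by (auto simp: \<Lambda>_def intro!: sum.cong that(2))
    show "\<Lambda> c (\<lambda>i j. Z i j + of_real s * W i j) = \<Lambda> c Z + of_real s * \<Lambda> c W" for c Z W s
      by (auto simp: \<Lambda>_def sum.distrib sum_distrib_left split: sum.split)
    show "continuous_on UNIV (\<lambda>\<zeta>. \<Lambda> c (\<lambda>i j. \<zeta> (i, j)))" for c
    proof -
      consider i j where "c = Inl (i,j)" | i j where "c = Inr (Inl (i,j))" | \<alpha> \<beta> where "c = Inr (Inr (\<alpha>,\<beta>))"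
        by (metis sum.exhaust surj_pair)
      then show ?thesis
        by cases (auto simp: \<Lambda>_def intro!: continuous_on_sum)
    qed
    show "\<exists>K. \<forall>Z. psd_on ?J Z \<longrightarrow> (\<forall>c\<in>?C. cmod (\<Lambda> c Z) \<le> b) \<longrightarrow> (\<forall>i\<in>?J. Re (Z i i) \<le> K)" for b
    \<comment> \<open>A diagonal entry is one of the nonnegative summands of a constrained partial
      trace, so \<open>b\<close> itself serves as the bound.\<close>
    proof (intro exI[of _ b] allI impI ballI)
      fix Z k assume Z: "psd_on ?J Z" and b: "\<forall>c\<in>?C. cmod (\<Lambda> c Z) \<le> b" and k: "k \<in> ?J"
      have diag: "0 \<le> Re (Z k k)" if "k \<in> ?J" for k
        using coercive_diag(2)[of ?J 0 Z k] Z that I by (simp add: psd_on_iff_coercive)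
      show "Re (Z k k) \<le> b"
      proof (cases k)
        case (Inl ia)
        obtain i a where ia: "ia = (i,a)" by fastforce
        then have i: "i \<in> I" using k Inl by auto
        have "Re (Z k k) \<le> (\<Sum>a\<in>UNIV. Re (Z (Inl (i,a)) (Inl (i,a))))"
          unfolding Inl ia by (rule member_le_sum) (auto intro!: diag i)
        also have "\<dots> = Re (\<Lambda> (Inl (i,i)) Z)" by (simp add: \<Lambda>_def)
        also have "\<dots> \<le> cmod (\<Lambda> (Inl (i,i)) Z)" by (rule complex_Re_le_cmod)
        also have "\<dots> \<le> b" by (rule bspec[OF b]) (use i in auto)
        finally show ?thesis .
      next
        case (Inr ia)
        obtain i a where ia: "ia = (i,a)" by fastforce
        then have i: "i \<in> I" using k Inr by auto
        have "Re (Z k k) \<le> (\<Sum>a\<in>UNIV. Re (Z (Inr (i,a)) (Inr (i,a))))"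
          unfolding Inr ia by (rule member_le_sum) (auto intro!: diag i)
        also have "\<dots> = Re (\<Lambda> (Inr (Inl (i,i))) Z)" by (simp add: \<Lambda>_def)
        also have "\<dots> \<le> cmod (\<Lambda> (Inr (Inl (i,i))) Z)" by (rule complex_Re_le_cmod)
        also have "\<dots> \<le> b" by (rule bspec[OF b]) (use i in auto)
        finally show ?thesis .
      qed
    qed
  next
    fix D
    assume D: "\<And>Z. psd_on ?J Z \<Longrightarrow> 0 \<le> Re (\<Sum>c\<in>?C. cnj (D c) * \<Lambda> c Z)"
    define R where "R = (\<lambda>i j. cnj (D (Inl (i,j))))"
    define S where "S = (\<lambda>i j. cnj (D (Inr (Inl (i,j)))))"
    define Y where "Y = (\<lambda>\<alpha> \<beta>. cnj (D (Inr (Inr (\<alpha>,\<beta>)))))"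
    have split: "(\<Sum>c\<in>?C. cnj (D c) * h c) = (\<Sum>i\<in>I. \<Sum>j\<in>I. R i j * h (Inl (i,j)))
      + (\<Sum>i\<in>I. \<Sum>j\<in>I. S i j * h (Inr (Inl (i,j))))
      + (\<Sum>\<alpha>\<in>?IA. \<Sum>\<beta>\<in>?IA. Y \<alpha> \<beta> * h (Inr (Inr (\<alpha>,\<beta>))))" for h
    proof -
      have "(\<Sum>c\<in>?C. cnj (D c) * h c) = (\<Sum>x\<in>I \<times> I. cnj (D (Inl x)) * h (Inl x))
        + ((\<Sum>x\<in>I \<times> I. cnj (D (Inr (Inl x))) * h (Inr (Inl x))) +
           (\<Sum>x\<in>?IA \<times> ?IA. cnj (D (Inr (Inr x))) * h (Inr (Inr x))))"
        using I by (subst sum.Plus, simp, simp, subst sum.Plus) simp_all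
      then show ?thesis
        by (simp only: R_def S_def Y_def sum.cartesian_product split_def prod.collapse add.assoc)
    qed
    have swap: "(\<Sum>i\<in>I. \<Sum>j\<in>I. R i j * (\<Sum>a\<in>UNIV. cnj (p (i,a)) * p (j,a)))
      = (\<Sum>a\<in>UNIV. form I I R (\<lambda>i. p (i,a)) (\<lambda>i. p (i,a)))" for R and p :: "'i \<times> 'a \<Rightarrow> complex"
    proof -
      have "(\<Sum>i\<in>I. \<Sum>j\<in>I. R i j * (\<Sum>a\<in>UNIV. cnj (p (i,a)) * p (j,a)))
        = (\<Sum>i\<in>I. \<Sum>j\<in>I. \<Sum>a\<in>UNIV. cnj (p (i,a)) * R i j * p (j,a))"
        by (simp add: sum_distrib_left mult_ac)
      also have "\<dots> = (\<Sum>i\<in>I. \<Sum>a\<in>UNIV. \<Sum>j\<in>I. cnj (p (i,a)) * R i j * p (j,a))"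
        by (intro sum.cong refl sum.swap)
      also have "\<dots> = (\<Sum>a\<in>UNIV. form I I R (\<lambda>i. p (i,a)) (\<lambda>i. p (i,a)))"
        unfolding form_def by (rule sum.swap)
      finally show ?thesis .
    qed
    have "0 \<le> Re (\<Sum>i\<in>I. R i i) + Re (\<Sum>i\<in>I. S i i) +
      Re (\<Sum>i\<in>I. \<Sum>j\<in>I. \<Sum>a\<in>UNIV. \<Sum>a'\<in>UNIV. u i j a a' * Y (i,a') (j,a))"
    proof (rule S1_dual_certificate[where R = R and S = S and Y = Y, OF I u])
      fix p q :: "'i \<times> 'a \<Rightarrow> complex"
      \<comment> \<open>The rank-one matrix of the stacked vector (p, q) turns nonnegativity of
        \<open>D\<close> on the cone into the hypothesis on \<open>p\<close> and
        \<open>q\<close>.\<close>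
      define v where "v = case_sum p q"
      have "psd_on ?J (\<lambda>\<alpha> \<beta>. cnj (v \<alpha>) * v \<beta>)"
        by (rule gram_psd[where F = "{()}" and L = "\<lambda>_. v"]) auto
      from D[OF this]
      have "0 \<le> Re ((\<Sum>i\<in>I. \<Sum>j\<in>I. R i j * (\<Sum>a\<in>UNIV. cnj (p (i,a)) * p (j,a)))
        + (\<Sum>i\<in>I. \<Sum>j\<in>I. S i j * (\<Sum>a\<in>UNIV. cnj (q (i,a)) * q (j,a)))
        + (\<Sum>\<alpha>\<in>?IA. \<Sum>\<beta>\<in>?IA. Y \<alpha> \<beta> * (cnj (p \<alpha>) * q \<beta>)))"
        unfolding split by (simp add: \<Lambda>_def v_def)
      also have "(\<Sum>\<alpha>\<in>?IA. \<Sum>\<beta>\<in>?IA. Y \<alpha> \<beta> * (cnj (p \<alpha>) * q \<beta>)) = form ?IA ?IA Y p q"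
        by (simp add: form_def mult_ac)
      finally show "0 \<le> (\<Sum>a\<in>UNIV. Re (form I I R (\<lambda>i. p (i,a)) (\<lambda>i. p (i,a)))) +
       (\<Sum>a\<in>UNIV. Re (form I I S (\<lambda>i. q (i,a)) (\<lambda>i. q (i,a)))) + Re (form ?IA ?IA Y p q)"
        unfolding swap by simp
    qed
    moreover have "(\<Sum>\<alpha>\<in>?IA. \<Sum>\<beta>\<in>?IA. Y \<alpha> \<beta> * t (Inr (Inr (\<alpha>,\<beta>)))) =
      (\<Sum>i\<in>I. \<Sum>j\<in>I. \<Sum>a\<in>UNIV. \<Sum>a'\<in>UNIV. u i j a a' * Y (i,a') (j,a))"
    proof -
      have "(\<Sum>\<alpha>\<in>?IA. \<Sum>\<beta>\<in>?IA. Y \<alpha> \<beta> * t (Inr (Inr (\<alpha>,\<beta>)))) =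
        (\<Sum>i\<in>I. \<Sum>a\<in>UNIV. \<Sum>j\<in>I. \<Sum>a'\<in>UNIV. u i j a' a * Y (i,a) (j,a'))"
        by (simp add: t_def sum.cartesian_product' mult.commute)
      also have "\<dots> = (\<Sum>i\<in>I. \<Sum>j\<in>I. \<Sum>a\<in>UNIV. \<Sum>a'\<in>UNIV. u i j a' a * Y (i,a) (j,a'))"
        by (intro sum.cong refl sum.swap)
      also have "\<dots> = (\<Sum>i\<in>I. \<Sum>j\<in>I. \<Sum>a'\<in>UNIV. \<Sum>a\<in>UNIV. u i j a' a * Y (i,a) (j,a'))"
        by (intro sum.cong refl sum.swap)
      finally show ?thesis .
    qed
    moreover have "(\<Sum>i\<in>I. \<Sum>j\<in>I. M i j * (if i = j then 1 else 0)) = (\<Sum>i\<in>I. M i i)" for M :: "'i \<Rightarrow> 'i \<Rightarrow> complex"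
    proof -
      have "(\<Sum>i\<in>I. \<Sum>j\<in>I. M i j * (if i = j then 1 else 0)) = (\<Sum>i\<in>I. \<Sum>j\<in>I. if i = j then M i j else 0)"
        by (intro sum.cong refl) auto
      then show ?thesis using I by simp
    qed
    ultimately show "0 \<le> Re (\<Sum>c\<in>?C. cnj (D c) * t c)"
      unfolding split by (simp add: t_def)
  qed
  then obtain Z where Z: "psd_on ?J Z" and Zt: "\<And>c. c \<in> ?C \<Longrightarrow> \<Lambda> c Z = t c" by blast
  obtain L where L: "\<And>\<alpha> \<beta>. \<alpha> \<in> ?J \<Longrightarrow> \<beta> \<in> ?J \<Longrightarrow> Z \<alpha> \<beta> = (\<Sum>m\<in>?J. cnj (L m \<alpha>) * L m \<beta>)"
  proof -
    have "finite ?J" using I by simp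
    then show ?thesis using psd_gram[OF _ Z] that by blast
  qed
  show ?thesis
  proof (rule that[of ?J "\<lambda>m \<alpha>. L m (Inl \<alpha>)" "\<lambda>m \<alpha>. L m (Inr \<alpha>)"])
    show "finite ?J" using I by simp
  next
    fix i j a a' assume ij: "i \<in> I" "j \<in> I"
    show "u i j a' a = (\<Sum>m\<in>?J. cnj (L m (Inl (i,a))) * L m (Inr (j,a')))"
      using Zt[of "Inr (Inr ((i,a),(j,a')))"] L[of "Inl (i,a)" "Inr (j,a')"] ij
      by (simp add: \<Lambda>_def t_def InlI InrI)
  next
    have "(\<Sum>m\<in>?J. \<Sum>a\<in>UNIV. cnj (L m (Inl (i,a))) * L m (Inl (j,a))) = (if i = j then 1 else 0)"
      "(\<Sum>m\<in>?J. \<Sum>a\<in>UNIV. cnj (L m (Inr (i,a))) * L m (Inr (j,a))) = (if i = j then 1 else 0)"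
      if ij: "i \<in> I" "j \<in> I" for i j
    proof -
      have "(\<Sum>a\<in>UNIV. Z (Inl (i,a)) (Inl (j,a))) = (if i = j then 1 else 0)"
        using Zt[of "Inl (i,j)"] ij by (simp add: \<Lambda>_def t_def InlI InrI)
      then show "(\<Sum>m\<in>?J. \<Sum>a\<in>UNIV. cnj (L m (Inl (i,a))) * L m (Inl (j,a))) = (if i = j then 1 else 0)"
        by (subst sum.swap) (simp add: L ij InlI InrI)
      have "(\<Sum>a\<in>UNIV. Z (Inr (i,a)) (Inr (j,a))) = (if i = j then 1 else 0)"
        using Zt[of "Inr (Inl (i,j))"] ij by (simp add: \<Lambda>_def t_def InlI InrI)
      then show "(\<Sum>m\<in>?J. \<Sum>a\<in>UNIV. cnj (L m (Inr (i,a))) * L m (Inr (j,a))) = (if i = j then 1 else 0)"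
        by (subst sum.swap) (simp add: L ij InlI InrI)
    qed
    then show "isometric_on I ?J (\<lambda>m \<alpha>. L m (Inl \<alpha>))" "isometric_on I ?J (\<lambda>m \<alpha>. L m (Inr \<alpha>))"
      by (simp_all add: isometric_on_def)
  qed
qed

subsection \<open>The game functional\<close>

lemma sum_UNIV_pair: "(\<Sum>z\<in>UNIV. h z) = (\<Sum>a\<in>UNIV. \<Sum>b\<in>UNIV. h (a, b))"
  for h :: "'c::finite \<times> 'd::finite \<Rightarrow> 'e::comm_monoid_add"
  by (simp add: sum.cartesian_product flip: UNIV_Times_UNIV)

definition game_coeff :: "(('x::finite \<times> 'y::finite) \<times> 'r::finite \<Rightarrow> complex) \<Rightarrow>
    (('a::finite \<times> 'b::finite) \<times> 'r \<Rightarrow> ('a \<times> 'b) \<times> 'r \<Rightarrow> complex) \<Rightarrow>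
    ('x \<times> 'y) \<times> ('x \<times> 'y) \<times> ('a \<times> 'b) \<times> ('a \<times> 'b) \<Rightarrow> complex" where
  "game_coeff \<xi> P = (\<lambda>(xy,xy',ab,ab'). \<Sum>r\<in>UNIV. \<Sum>r'\<in>UNIV. \<xi> (xy,r) * cnj (\<xi> (xy',r')) * P (ab',r') (ab,r))"

lemma game_value_eq:
  "game_value \<xi> P G = (\<Sum>(xy,xy',ab,ab')\<in>UNIV. game_coeff \<xi> P (xy,xy',ab,ab') * G xy xy' ab ab')"
proof -
  have "game_value \<xi> P G = (\<Sum>ab\<in>UNIV. \<Sum>r\<in>UNIV. \<Sum>ab'\<in>UNIV. \<Sum>r'\<in>UNIV. \<Sum>xy\<in>UNIV. \<Sum>xy'\<in>UNIV.
      \<xi> (xy,r) * cnj (\<xi> (xy',r')) * G xy xy' ab ab' * P (ab',r') (ab,r))"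
    by (simp add: game_value_def sum_UNIV_pair[where 'd = 'c] sum_distrib_right)
  also have "\<dots> = (\<Sum>(ab,r,ab',r',xy,xy')\<in>UNIV.
      \<xi> (xy,r) * cnj (\<xi> (xy',r')) * G xy xy' ab ab' * P (ab',r') (ab,r))"
    by (simp add: sum.cartesian_product split_def flip: UNIV_Times_UNIV)
  also have "\<dots> = (\<Sum>(xy,xy',ab,ab',r,r')\<in>UNIV.
      \<xi> (xy,r) * cnj (\<xi> (xy',r')) * G xy xy' ab ab' * P (ab',r') (ab,r))"
    by (rule sum.reindex_bij_witness[of _ "\<lambda>(xy,xy',ab,ab',r,r'). (ab,r,ab',r',xy,xy')"
          "\<lambda>(ab,r,ab',r',xy,xy'). (xy,xy',ab,ab',r,r')"]) auto
  also have "\<dots> = (\<Sum>xy\<in>UNIV. \<Sum>xy'\<in>UNIV. \<Sum>ab\<in>UNIV. \<Sum>ab'\<in>UNIV. \<Sum>r\<in>UNIV. \<Sum>r'\<in>UNIV.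
      \<xi> (xy,r) * cnj (\<xi> (xy',r')) * G xy xy' ab ab' * P (ab',r') (ab,r))"
    by (simp add: sum.cartesian_product split_def flip: UNIV_Times_UNIV)
  also have "\<dots> = (\<Sum>xy\<in>UNIV. \<Sum>xy'\<in>UNIV. \<Sum>ab\<in>UNIV. \<Sum>ab'\<in>UNIV. game_coeff \<xi> P (xy,xy',ab,ab') * G xy xy' ab ab')"
    by (simp add: game_coeff_def sum_distrib_left sum_distrib_right mult_ac)
  finally show ?thesis
    by (simp add: sum.cartesian_product split_def flip: UNIV_Times_UNIV)
qed

lemma game_value_sum:
  "game_value \<xi> P (\<lambda>xy xy' ab ab'. \<Sum>i\<in>S. c i * G i xy xy' ab ab') = (\<Sum>i\<in>S. c i * game_value \<xi> P (G i))"
proof -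
  have "game_value \<xi> P (\<lambda>xy xy' ab ab'. \<Sum>i\<in>S. c i * G i xy xy' ab ab')
    = (\<Sum>z\<in>UNIV. \<Sum>i\<in>S. case z of (xy,xy',ab,ab') \<Rightarrow> c i * (game_coeff \<xi> P (xy,xy',ab,ab') * G i xy xy' ab ab'))"
    unfolding game_value_eq by (intro sum.cong refl) (auto simp: sum_distrib_left mult_ac)
  also have "\<dots> = (\<Sum>i\<in>S. \<Sum>z\<in>UNIV. case z of (xy,xy',ab,ab') \<Rightarrow> c i * (game_coeff \<xi> P (xy,xy',ab,ab') * G i xy xy' ab ab'))"
    by (rule sum.swap)
  finally show ?thesis
    by (simp add: game_value_eq sum_distrib_left split_def)
qed

text \<open>For Hermitian \<open>P\<close>, the conjugation in \<open>G_tensor\<close> amounts to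
  exchanging primed and unprimed questions. The trace pairing transposes questions and answers
  alike, so the questions return to their order while the answers stay transposed.\<close>

lemma pair_mat_eq_game_value:
  assumes herm: "\<And>z z'. cnj (P z z') = P z' z"
  shows "pair_mat (G_tensor \<xi> P) u v (p,r) (q,s)
    = game_value \<xi> P (\<lambda>(x,y) (x',y') (a,b) (a',b'). u p q x x' a' a * v r s y y' b' b)"
proof -
  have G: "G_tensor \<xi> P x' x a a' y' y b b' = game_coeff \<xi> P ((x,y),(x',y'),(a,b),(a',b'))" for x x' a a' y y' b b'
  proof -
    have "G_tensor \<xi> P x' x a a' y' y b b' = (\<Sum>r\<in>UNIV. \<Sum>r'\<in>UNIV. \<xi> ((x,y),r') * cnj (\<xi> ((x',y'),r)) * P ((a',b'),r) ((a,b),r'))"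
      by (simp add: G_tensor_def herm mult_ac)
    then show ?thesis by (simp add: game_coeff_def) (rule sum.swap)
  qed
  have "pair_mat (G_tensor \<xi> P) u v (p,r) (q,s) =
    (\<Sum>(x,x',a,a',y,y',b,b')\<in>UNIV. G_tensor \<xi> P x x' a a' y y' b b' * u p q x' x a' a * v r s y' y b' b)"
    by (simp add: pair_mat_def sum.cartesian_product split_def flip: UNIV_Times_UNIV)
  also have "\<dots> = (\<Sum>((x,y),(x',y'),(a,b),(a',b'))\<in>UNIV. G_tensor \<xi> P x' x a a' y' y b b' * u p q x x' a' a * v r s y y' b' b)"
    by (rule sum.reindex_bij_witness[of _ "\<lambda>((x,y),(x',y'),(a,b),(a',b')). (x',x,a,a',y',y,b,b')"
          "\<lambda>(x',x,a,a',y',y,b,b'). ((x,y),(x',y'),(a,b),(a',b'))"]) auto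
  also have "\<dots> = game_value \<xi> P (\<lambda>(x,y) (x',y') (a,b) (a',b'). u p q x x' a' a * v r s y y' b' b)"
    unfolding game_value_eq by (intro sum.cong refl) (auto simp: G mult.assoc)
  finally show ?thesis .
qed

lemma proj_comb_hermitian: "cnj (proj_comb n lam \<gamma> z z') = proj_comb n lam \<gamma> z' z"
  by (simp add: proj_comb_def mult_ac)

text \<open>If T is the operator from C^XY to C^AB with entries the conjugates of \<phi>, this is
  the conjugate of the inner product of \<gamma> with (T (x) 1) \<xi>. Its squared modulus is the
  probability of the outcome \<gamma>.\<close>

definition amplitude :: "(('x::finite \<times> 'y::finite) \<times> 'r::finite \<Rightarrow> complex) \<Rightarrow>
    (('a::finite \<times> 'b::finite) \<times> 'r \<Rightarrow> complex) \<Rightarrow> (('x \<times> 'y) \<times> ('a \<times> 'b) \<Rightarrow> complex) \<Rightarrow> complex" where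
  "amplitude \<xi> \<gamma> \<phi> = (\<Sum>(xy,ab)\<in>UNIV. cnj (\<Sum>r\<in>UNIV. \<xi> (xy,r) * cnj (\<gamma> (ab,r))) * \<phi> (xy,ab))"

text \<open>For \<phi> = \<psi> the map is \<rho> -> T \<rho> T* and the value is a weighted sum of
  outcome probabilities. The polarized version serves the off-diagonal products f* g.\<close>

lemma game_value_rank_one:
  "game_value \<xi> (proj_comb n lam \<gamma>) (\<lambda>xy xy' ab ab'. cnj (\<phi> (xy,ab)) * \<psi> (xy',ab'))
    = (\<Sum>k<n. of_real (lam k) * (cnj (amplitude \<xi> (\<gamma> k) \<phi>) * amplitude \<xi> (\<gamma> k) \<psi>))"
proof -
  define \<eta> where "\<eta> = (\<lambda>k xy ab. \<Sum>r\<in>UNIV. \<xi> (xy,r) * cnj (\<gamma> k (ab,r)))"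
  have coeff: "game_coeff \<xi> (proj_comb n lam \<gamma>) (xy,xy',ab,ab') =
    (\<Sum>k<n. of_real (lam k) * (\<eta> k xy ab * cnj (\<eta> k xy' ab')))" for xy xy' ab ab'
  proof -
    have "game_coeff \<xi> (proj_comb n lam \<gamma>) (xy,xy',ab,ab') = (\<Sum>r\<in>UNIV. \<Sum>r'\<in>UNIV. \<Sum>k<n. of_real (lam k) *
       ((\<xi> (xy,r) * cnj (\<gamma> k (ab,r))) * (cnj (\<xi> (xy',r')) * \<gamma> k (ab',r'))))"
      by (simp add: game_coeff_def proj_comb_def sum_distrib_left mult_ac)
    also have "\<dots> = (\<Sum>r\<in>UNIV. \<Sum>k<n. \<Sum>r'\<in>UNIV. of_real (lam k) *
       ((\<xi> (xy,r) * cnj (\<gamma> k (ab,r))) * (cnj (\<xi> (xy',r')) * \<gamma> k (ab',r'))))"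
      by (intro sum.cong refl sum.swap)
    also have "\<dots> = (\<Sum>k<n. \<Sum>r\<in>UNIV. \<Sum>r'\<in>UNIV. of_real (lam k) *
       ((\<xi> (xy,r) * cnj (\<gamma> k (ab,r))) * (cnj (\<xi> (xy',r')) * \<gamma> k (ab',r'))))"
      by (rule sum.swap)
    finally show ?thesis
      by (simp add: \<eta>_def sum_product flip: sum_distrib_left)
  qed
  have "game_value \<xi> (proj_comb n lam \<gamma>) (\<lambda>xy xy' ab ab'. cnj (\<phi> (xy,ab)) * \<psi> (xy',ab'))
    = (\<Sum>(xy,xy',ab,ab')\<in>UNIV. \<Sum>k<n. of_real (lam k) *
       (cnj (cnj (\<eta> k xy ab) * \<phi> (xy,ab)) * (cnj (\<eta> k xy' ab') * \<psi> (xy',ab'))))"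
    unfolding game_value_eq coeff by (intro sum.cong refl) (auto simp: sum_distrib_left sum_distrib_right mult_ac)
  also have "\<dots> = (\<Sum>k<n. \<Sum>(xy,xy',ab,ab')\<in>UNIV. of_real (lam k) *
       (cnj (cnj (\<eta> k xy ab) * \<phi> (xy,ab)) * (cnj (\<eta> k xy' ab') * \<psi> (xy',ab'))))"
    unfolding split_def by (rule sum.swap)
  also have "\<dots> = (\<Sum>k<n. of_real (lam k) * (cnj (amplitude \<xi> (\<gamma> k) \<phi>) * amplitude \<xi> (\<gamma> k) \<psi>))"
  proof (intro sum.cong refl)
    fix k
    have "(\<Sum>(xy,xy',ab,ab')\<in>UNIV. of_real (lam k) *
       (cnj (cnj (\<eta> k xy ab) * \<phi> (xy,ab)) * (cnj (\<eta> k xy' ab') * \<psi> (xy',ab')))) =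
      (\<Sum>((xy,ab),(xy',ab'))\<in>UNIV. of_real (lam k) *
       (cnj (cnj (\<eta> k xy ab) * \<phi> (xy,ab)) * (cnj (\<eta> k xy' ab') * \<psi> (xy',ab'))))"
      by (rule sum.reindex_bij_witness[of _ "\<lambda>((xy,ab),(xy',ab')). (xy,xy',ab,ab')"
            "\<lambda>(xy,xy',ab,ab'). ((xy,ab),(xy',ab'))"]) auto
    also have "\<dots> = of_real (lam k) * (cnj (amplitude \<xi> (\<gamma> k) \<phi>) * amplitude \<xi> (\<gamma> k) \<psi>)"
    proof -
      have amp: "amplitude \<xi> (\<gamma> k) \<theta> = (\<Sum>z\<in>UNIV. cnj (\<eta> k (fst z) (snd z)) * \<theta> z)" for \<theta>
        by (simp add: amplitude_def \<eta>_def split_def)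
      show ?thesis unfolding amp cnj_sum sum_product unfolding sum_distrib_left
        by (subst sum_UNIV_pair) (simp add: split_def)
    qed
    finally show "(\<Sum>(xy,xy',ab,ab')\<in>UNIV. of_real (lam k) *
       (cnj (cnj (\<eta> k xy ab) * \<phi> (xy,ab)) * (cnj (\<eta> k xy' ab') * \<psi> (xy',ab')))) =
      of_real (lam k) * (cnj (amplitude \<xi> (\<gamma> k) \<phi>) * amplitude \<xi> (\<gamma> k) \<psi>)" .
  qed
  finally show ?thesis .
qed

subsection \<open>Stochastic operator matrices\<close>

lemma isometric_on_norm:
  assumes "finite I" "isometric_on I F f"
  shows "(\<Sum>m\<in>F. \<Sum>a\<in>UNIV. (cmod (\<Sum>i\<in>I. f m (i,a) * w i))\<^sup>2) = (\<Sum>i\<in>I. (cmod (w i))\<^sup>2)"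
proof -
  let ?D = "\<lambda>i j. if i = j then 1 else 0 :: complex"
  have "form I I ?D w w = of_real (\<Sum>z\<in>F \<times> UNIV. (cmod (\<Sum>i\<in>I. (case z of (m,a) \<Rightarrow> \<lambda>i. f m (i,a)) i * w i))\<^sup>2)"
    by (rule form_gram) (use assms(2) in \<open>simp add: isometric_on_def sum.cartesian_product'\<close>)
  moreover have "form I I ?D w w = of_real (\<Sum>i\<in>I. (cmod (w i))\<^sup>2)"
  proof -
    have "form I I ?D w w = (\<Sum>i\<in>I. \<Sum>j\<in>I. if i = j then cnj (w i) * w j else 0)"
      unfolding form_def by (intro sum.cong refl) auto
    also have "\<dots> = (\<Sum>i\<in>I. of_real ((cmod (w i))\<^sup>2))"
      using assms(1) by (simp only: complex_norm_square mult.commute) simp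
    finally show ?thesis by simp
  qed
  ultimately have "complex_of_real (\<Sum>z\<in>F \<times> UNIV. (cmod (\<Sum>i\<in>I. (case z of (m,a) \<Rightarrow> \<lambda>i. f m (i,a)) i * w i))\<^sup>2)
    = of_real (\<Sum>i\<in>I. (cmod (w i))\<^sup>2)" by simp
  then show ?thesis unfolding of_real_eq_iff by (simp add: sum.cartesian_product')
qed

lemma norm_sum_Gram_le:
  fixes A B :: "'m \<Rightarrow> real"
  assumes "\<And>m. m \<in> F \<Longrightarrow> cmod (z m) \<le> A m * B m"
  shows "cmod (\<Sum>m\<in>F. z m) \<le> sqrt (\<Sum>m\<in>F. (A m)\<^sup>2) * sqrt (\<Sum>m\<in>F. (B m)\<^sup>2)"
proof -
  have "cmod (\<Sum>m\<in>F. z m) \<le> (\<Sum>m\<in>F. \<bar>A m\<bar> * \<bar>B m\<bar>)"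
    by (intro sum_norm_le) (metis abs_ge_self abs_mult assms order_trans)
  also have "\<dots> \<le> L2_set A F * L2_set B F" by (rule L2_set_mult_ineq)
  finally show ?thesis by (simp add: L2_set_def)
qed

lemma sum_mult_sum:
  fixes c :: "'c::comm_semiring_0"
  shows "(\<Sum>i\<in>I. A i) * c * (\<Sum>j\<in>J. B j) = (\<Sum>i\<in>I. \<Sum>j\<in>J. A i * c * B j)"
  by (simp only: sum_distrib_right[of _ I c] sum_product)

text \<open>The form splits over m into values <x m, N (y m)>, each at most |x m| |y m|.
  Cauchy-Schwarz over m and the two isometries then restore exactly |w| and |v|.\<close>

lemma S1_matnorm_le_factor:
  fixes u :: "'i \<Rightarrow> 'i \<Rightarrow> 'a::finite \<Rightarrow> 'a \<Rightarrow> complex"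
  assumes I: "finite I"
    and u: "\<And>i j a a'. i \<in> I \<Longrightarrow> j \<in> I \<Longrightarrow> u i j a' a = (\<Sum>m\<in>F. cnj (f m (i,a)) * g m (j,a'))"
    and f: "isometric_on I F f" and g: "isometric_on I F g"
  shows "S1_matnorm I u \<le> 1"
proof (rule S1_matnorm_le)
  fix n :: nat and N :: "nat \<Rightarrow> nat \<Rightarrow> 'a \<Rightarrow> 'a \<Rightarrow> complex" and w v :: "nat \<times> 'i \<Rightarrow> complex"
  assume N: "contractive n N"
  define x where "x = (\<lambda>m p a. \<Sum>i\<in>I. f m (i,a) * w (p,i))"
  define y where "y = (\<lambda>m p a. \<Sum>i\<in>I. g m (i,a) * v (p,i))"
  have "form ({..<n} \<times> I) ({..<n} \<times> I) (ampl u N) w v =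
    (\<Sum>i\<in>I. \<Sum>j\<in>I. \<Sum>a\<in>UNIV. \<Sum>a'\<in>UNIV. \<Sum>m\<in>F. \<Sum>p<n. \<Sum>q<n.
      cnj (f m (i,a') * w (p, i)) * N p q a' a * (g m (j,a) * v (q, j)))"
    unfolding form_ampl by (intro sum.cong refl)
      (simp add: u sum_distrib_left sum_distrib_right mult_ac, simp add: sum.swap[of _ _ F])
  also have "\<dots> = (\<Sum>(i,j,a,a',m,p,q)\<in>I \<times> I \<times> UNIV \<times> UNIV \<times> F \<times> {..<n} \<times> {..<n}.
      cnj (f m (i,a') * w (p, i)) * N p q a' a * (g m (j,a) * v (q, j)))"
    by (simp add: sum.cartesian_product split_def)
  also have "\<dots> = (\<Sum>(m,p,a',q,a,i,j)\<in>F \<times> {..<n} \<times> UNIV \<times> {..<n} \<times> UNIV \<times> I \<times> I.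
      cnj (f m (i,a') * w (p, i)) * N p q a' a * (g m (j,a) * v (q, j)))"
    by (rule sum.reindex_bij_witness[of _ "\<lambda>(m,p,a',q,a,i,j). (i,j,a,a',m,p,q)"
          "\<lambda>(i,j,a,a',m,p,q). (m,p,a',q,a,i,j)"]) auto
  also have "\<dots> = (\<Sum>m\<in>F. \<Sum>p<n. \<Sum>a'\<in>UNIV. \<Sum>q<n. \<Sum>a\<in>UNIV. \<Sum>i\<in>I. \<Sum>j\<in>I.
      cnj (f m (i,a') * w (p, i)) * N p q a' a * (g m (j,a) * v (q, j)))"
    by (simp add: sum.cartesian_product split_def)
  also have "\<dots> = (\<Sum>m\<in>F. \<Sum>p<n. \<Sum>a'\<in>UNIV. \<Sum>q<n. \<Sum>a\<in>UNIV. cnj (x m p a') * N p q a' a * y m q a)"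
    by (simp only: x_def y_def cnj_sum sum_mult_sum)
  finally have *: "form ({..<n} \<times> I) ({..<n} \<times> I) (ampl u N) w v =
    (\<Sum>m\<in>F. \<Sum>p<n. \<Sum>a'\<in>UNIV. \<Sum>q<n. \<Sum>a\<in>UNIV. cnj (x m p a') * N p q a' a * y m q a)" .
  have total: "(\<Sum>m\<in>F. (vnorm ({..<n} \<times> UNIV) (\<lambda>(p,a). \<Sum>i\<in>I. h m (i,a) * z (p,i)))\<^sup>2) = (vnorm ({..<n} \<times> I) z)\<^sup>2"
    if "isometric_on I F h" for h :: "'b \<Rightarrow> 'i \<times> 'a \<Rightarrow> complex" and z :: "nat \<times> 'i \<Rightarrow> complex"
  proof -
    have "(\<Sum>m\<in>F. (vnorm ({..<n} \<times> UNIV) (\<lambda>(p,a). \<Sum>i\<in>I. h m (i,a) * z (p,i)))\<^sup>2)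
      = (\<Sum>p<n. \<Sum>m\<in>F. \<Sum>a\<in>UNIV. (cmod (\<Sum>i\<in>I. h m (i,a) * z (p,i)))\<^sup>2)"
      by (simp add: vnorm_power2 sum.cartesian_product') (rule sum.swap)
    also have "\<dots> = (\<Sum>p<n. \<Sum>i\<in>I. (cmod (z (p,i)))\<^sup>2)"
      by (intro sum.cong refl isometric_on_norm I that)
    finally show ?thesis by (simp add: vnorm_power2 sum.cartesian_product')
  qed
  show "cmod (form ({..<n} \<times> I) ({..<n} \<times> I) (ampl u N) w v) \<le> vnorm ({..<n} \<times> I) w * vnorm ({..<n} \<times> I) v"
    unfolding *
    by (rule order_trans[OF norm_sum_Gram_le[OF contractive_form_le[OF N]]])
       (simp add: x_def y_def total[OF f] total[OF g] vnorm_nonneg)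
qed

text \<open>The matrix f* f. The Hilbert space index is grouped with the question because in
  \<open>E_matnorm\<close> the matrix level and X form one index set.\<close>

definition gram_op :: "'m set \<Rightarrow> ('m \<Rightarrow> (nat \<times> 'x) \<times> 'a \<Rightarrow> complex) \<Rightarrow>
    'x \<Rightarrow> 'x \<Rightarrow> 'a \<Rightarrow> 'a \<Rightarrow> nat \<Rightarrow> nat \<Rightarrow> complex" where
  "gram_op F f = (\<lambda>x x' a a' p q. \<Sum>m\<in>F. cnj (f m ((p,x),a)) * f m ((q,x'),a'))"

lemma stoch_op_matrix_gram_op:
  fixes f :: "'m \<Rightarrow> (nat \<times> 'x::finite) \<times> 'a::finite \<Rightarrow> complex"
  assumes "isometric_on ({..<d} \<times> UNIV) F f"
  shows "stoch_op_matrix d (gram_op F f)"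
  unfolding stoch_op_matrix_def
proof (intro conjI allI impI)
  show "psd_on (UNIV \<times> {..<d}) (\<lambda>((x,a),i) ((x',a'),j). gram_op F f x x' a a' i j)"
    by (rule gram_psd[where F = F and L = "\<lambda>m ((x,a),i). f m ((i,x),a)"]) (auto simp: gram_op_def)
  fix x x' i j assume "i < d" "j < d"
  then have "(\<Sum>m\<in>F. \<Sum>a\<in>UNIV. cnj (f m ((i,x),a)) * f m ((j,x'),a)) = (if (i,x) = (j,x') then 1 else 0)"
    using assms unfolding isometric_on_def by blast
  then show "(\<Sum>a\<in>UNIV. gram_op F f x x' a a i j) = (if x = x' \<and> i = j then 1 else 0)"
    unfolding gram_op_def by (subst sum.swap) auto
qed

text \<open>A Gram factorization of the positive matrix; the condition on its partial traces is
  precisely isometry of the factor.\<close>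

lemma stoch_op_matrix_factor:
  fixes E :: "'x::finite \<Rightarrow> 'x \<Rightarrow> 'a::finite \<Rightarrow> 'a \<Rightarrow> nat \<Rightarrow> nat \<Rightarrow> complex"
  assumes E: "stoch_op_matrix d E"
  obtains F :: "(('x \<times> 'a) \<times> nat) set" and f where "finite F" "isometric_on ({..<d} \<times> UNIV) F f"
    "\<And>x x' a a' p q. p < d \<Longrightarrow> q < d \<Longrightarrow> E x x' a a' p q = gram_op F f x x' a a' p q"
proof -
  let ?F = "(UNIV :: ('x \<times> 'a) set) \<times> {..<d}"
  have fin: "finite ?F" by simp
  obtain L where L: "\<And>\<alpha> \<beta>. \<alpha> \<in> ?F \<Longrightarrow> \<beta> \<in> ?F \<Longrightarrow>
     (\<lambda>((x,a),i) ((x',a'),j). E x x' a a' i j) \<alpha> \<beta> = (\<Sum>m\<in>?F. cnj (L m \<alpha>) * L m \<beta>)"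
    using psd_gram[OF fin] E unfolding stoch_op_matrix_def by blast
  define f where "f = (\<lambda>m ((p,x),a). L m ((x,a),p))"
  have eq: "E x x' a a' p q = gram_op ?F f x x' a a' p q"
    if "p < d" "q < d" for x x' a a' p q
    using L[of "((x,a),p)" "((x',a'),q)"] that by (simp add: gram_op_def f_def)
  show ?thesis
  proof (rule that[OF fin _ eq])
    show "isometric_on ({..<d} \<times> UNIV) ?F f"
      unfolding isometric_on_def
    proof (intro ballI)
      fix i j :: "nat \<times> 'x" assume "i \<in> {..<d} \<times> UNIV" "j \<in> {..<d} \<times> UNIV"
      then obtain p x q x' where i: "i = (p,x)" "p < d" and j: "j = (q,x')" "q < d" by auto
      have "(\<Sum>a\<in>UNIV. E x x' a a p q) = (if i = j then 1 else 0)"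
        using E i j by (auto simp: stoch_op_matrix_def)
      then show "(\<Sum>m\<in>?F. \<Sum>a\<in>UNIV. cnj (f m (i,a)) * f m (j,a))
        = (if i = j then 1 else 0)"
        by (subst sum.swap) (simp add: eq i j gram_op_def)
    qed
  qed
qed

text \<open>The pairing \<open>Tr (u b)\<close> reverses the \<open>A\<close>-indices: the map represented by \<open>u\<close> is completely
  positive iff the transpose of \<open>u\<close> in \<open>A\<close>, not \<open>u\<close> itself, is positive.\<close>

definition op_transpose :: "('x \<Rightarrow> 'x \<Rightarrow> 'a \<Rightarrow> 'a \<Rightarrow> nat \<Rightarrow> nat \<Rightarrow> complex) \<Rightarrow> nat \<Rightarrow> nat \<Rightarrow> 'x \<Rightarrow> 'x \<Rightarrow> 'a \<Rightarrow> 'a \<Rightarrow> complex" where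
  "op_transpose E = (\<lambda>p q x x' a a'. E x x' a' a p q)"

text \<open>This is the factorized bound with both factors equal.\<close>

lemma E_matnorm_stoch:
  fixes E :: "'x::finite \<Rightarrow> 'x \<Rightarrow> 'a::finite \<Rightarrow> 'a \<Rightarrow> nat \<Rightarrow> nat \<Rightarrow> complex"
  assumes "stoch_op_matrix d E"
  shows "E_matnorm d (op_transpose E) \<le> 1"
proof -
  obtain F :: "(('x \<times> 'a) \<times> nat) set" and f where f: "finite F" "isometric_on ({..<d} \<times> UNIV) F f"
    "\<And>x x' a a' p q. p < d \<Longrightarrow> q < d \<Longrightarrow> E x x' a a' p q = gram_op F f x x' a a' p q"
    using stoch_op_matrix_factor[OF assms] by metis
  show ?thesis unfolding E_matnorm_def
    by (rule S1_matnorm_le_factor[OF _ _ f(2) f(2)]) (auto simp: op_transpose_def f(3) gram_op_def)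
qed

lemma E_matnorm_factor:
  fixes u :: "nat \<Rightarrow> nat \<Rightarrow> 'x::finite \<Rightarrow> 'x \<Rightarrow> 'a::finite \<Rightarrow> 'a \<Rightarrow> complex"
  assumes "E_matnorm k u \<le> 1"
  obtains F :: "((nat \<times> 'x) \<times> 'a + (nat \<times> 'x) \<times> 'a) set" and f g where "finite F"
    "isometric_on ({..<k} \<times> UNIV) F f" "isometric_on ({..<k} \<times> UNIV) F g"
    "\<And>p q x x' a a'. p < k \<Longrightarrow> q < k \<Longrightarrow> u p q x x' a' a = (\<Sum>m\<in>F. cnj (f m ((p,x),a)) * g m ((q,x'),a'))"
proof -
  have fin: "finite ({..<k} \<times> (UNIV :: 'x set))" by simp
  show ?thesis
  proof (rule S1_factorization[OF fin assms[unfolded E_matnorm_def]])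
    fix F :: "((nat \<times> 'x) \<times> 'a + (nat \<times> 'x) \<times> 'a) set" and f g
    assume F: "finite F"
      and u: "\<And>i j a a'. i \<in> {..<k} \<times> UNIV \<Longrightarrow> j \<in> {..<k} \<times> UNIV \<Longrightarrow>
        (case i of (p, x) \<Rightarrow> \<lambda>(q, x'). u p q x x') j a' a = (\<Sum>m\<in>F. cnj (f m (i, a)) * g m (j, a'))"
      and iso: "isometric_on ({..<k} \<times> UNIV) F f" "isometric_on ({..<k} \<times> UNIV) F g"
    show ?thesis
    proof (rule that[OF F iso])
      show "u p q x x' a' a = (\<Sum>m\<in>F. cnj (f m ((p,x),a)) * g m ((q,x'),a'))" if "p < k" "q < k" for p q x x' a a'
        using u[of "(p,x)" "(q,x')" a' a] that by simp
    qed
  qed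
qed

subsection \<open>Game values of correlations\<close>

text \<open>Sesquilinear in two vectors, because an operator norm is tested on pairs. Answer indices
  enter transposed, as the pairing with the game tensor delivers them.\<close>

definition correlation :: "nat \<Rightarrow> nat \<Rightarrow>
    (nat \<Rightarrow> nat \<Rightarrow> 'x \<Rightarrow> 'x \<Rightarrow> 'a \<Rightarrow> 'a \<Rightarrow> complex) \<Rightarrow> (nat \<Rightarrow> nat \<Rightarrow> 'y \<Rightarrow> 'y \<Rightarrow> 'b \<Rightarrow> 'b \<Rightarrow> complex) \<Rightarrow>
    (nat \<times> nat \<Rightarrow> complex) \<Rightarrow> (nat \<times> nat \<Rightarrow> complex) \<Rightarrow> ('x,'y,'a,'b) qmap" where
  "correlation k l u v w w' = (\<lambda>xy xy' ab ab'. \<Sum>(\<alpha>,\<beta>)\<in>({..<k} \<times> {..<l}) \<times> ({..<k} \<times> {..<l}).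
     (cnj (w \<alpha>) * w' \<beta>) * (u (fst \<alpha>) (fst \<beta>) (fst xy) (fst xy') (fst ab') (fst ab) *
       v (snd \<alpha>) (snd \<beta>) (snd xy) (snd xy') (snd ab') (snd ab)))"

lemma form_pair_mat:
  assumes herm: "\<And>z z'. cnj (P z z') = P z' z"
  shows "form ({..<k} \<times> {..<l}) ({..<k} \<times> {..<l}) (pair_mat (G_tensor \<xi> P) u v) w w' =
    game_value \<xi> P (correlation k l u v w w')"
proof -
  define G where "G = (\<lambda>z xy xy' ab ab'. u (fst (fst z)) (fst (snd z)) (fst xy) (fst xy') (fst ab') (fst ab) *
       v (snd (fst z)) (snd (snd z)) (snd xy) (snd xy') (snd ab') (snd ab))"
  have G: "pair_mat (G_tensor \<xi> P) u v \<alpha> \<beta> = game_value \<xi> P (G (\<alpha>,\<beta>))" for \<alpha> \<beta>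
  proof -
    have "G (\<alpha>,\<beta>) = (\<lambda>(x,y) (x',y') (a,b) (a',b').
      u (fst \<alpha>) (fst \<beta>) x x' a' a * v (snd \<alpha>) (snd \<beta>) y y' b' b)"
      by (auto simp: G_def fun_eq_iff)
    then show ?thesis
      using pair_mat_eq_game_value[of P, OF herm, of \<xi> u v "fst \<alpha>" "snd \<alpha>" "fst \<beta>" "snd \<beta>"] by simp
  qed
  have "correlation k l u v w w' = (\<lambda>xy xy' ab ab'. \<Sum>z\<in>({..<k} \<times> {..<l}) \<times> ({..<k} \<times> {..<l}).
     (cnj (w (fst z)) * w' (snd z)) * G z xy xy' ab ab')"
    by (simp add: correlation_def G_def split_def)
  then have "game_value \<xi> P (correlation k l u v w w') = (\<Sum>z\<in>({..<k} \<times> {..<l}) \<times> ({..<k} \<times> {..<l}).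
     (cnj (w (fst z)) * w' (snd z)) * game_value \<xi> P (G z))"
    by (simp only: game_value_sum)
  also have "\<dots> = (\<Sum>\<alpha>\<in>{..<k} \<times> {..<l}. \<Sum>\<beta>\<in>{..<k} \<times> {..<l}. (cnj (w \<alpha>) * w' \<beta>) * game_value \<xi> P (G (\<alpha>,\<beta>)))"
    by (simp only: sum.cartesian_product split_def fst_conv snd_conv prod.collapse)
  finally show ?thesis by (simp add: form_def G mult_ac)
qed

text \<open>For fixed \<open>m\<close>, the conjugated entries of the m-th Kraus operator of the map
  that f* f, f'* f' and \<open>w\<close> define.\<close>

definition corr_vec :: "nat \<Rightarrow> nat \<Rightarrow> ('m \<Rightarrow> (nat \<times> 'x) \<times> 'a \<Rightarrow> complex) \<Rightarrow> ('m' \<Rightarrow> (nat \<times> 'y) \<times> 'b \<Rightarrow> complex) \<Rightarrow>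
    (nat \<times> nat \<Rightarrow> complex) \<Rightarrow> 'm \<times> 'm' \<Rightarrow> ('x \<times> 'y) \<times> ('a \<times> 'b) \<Rightarrow> complex" where
  "corr_vec k l f f' w m = (\<lambda>(xy,ab). \<Sum>\<alpha>\<in>{..<k} \<times> {..<l}.
     w \<alpha> * (f (fst m) ((fst \<alpha>, fst xy), fst ab) * f' (snd m) ((snd \<alpha>, snd xy), snd ab)))"

lemma correlation_factor:
  assumes u: "\<And>p q x x' a a'. p < k \<Longrightarrow> q < k \<Longrightarrow> u p q x x' a' a = (\<Sum>m\<in>F. cnj (f m ((p,x),a)) * g m ((q,x'),a'))"
    and v: "\<And>p q y y' b b'. p < l \<Longrightarrow> q < l \<Longrightarrow> v p q y y' b' b = (\<Sum>m\<in>F'. cnj (f' m ((p,y),b)) * g' m ((q,y'),b'))"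
  shows "correlation k l u v w w' xy xy' ab ab' =
    (\<Sum>m\<in>F \<times> F'. cnj (corr_vec k l f f' w m (xy,ab)) * corr_vec k l g g' w' m (xy',ab'))"
proof -
  let ?S = "{..<k} \<times> {..<l}"
  define A where "A = (\<lambda>m \<alpha>. w \<alpha> * (f (fst m) ((fst \<alpha>, fst xy), fst ab) * f' (snd m) ((snd \<alpha>, snd xy), snd ab)))"
  define B where "B = (\<lambda>m \<alpha>. w' \<alpha> * (g (fst m) ((fst \<alpha>, fst xy'), fst ab') * g' (snd m) ((snd \<alpha>, snd xy'), snd ab')))"
  have "correlation k l u v w w' xy xy' ab ab' = (\<Sum>z\<in>?S \<times> ?S. \<Sum>m\<in>F \<times> F'. cnj (A m (fst z)) * B m (snd z))"
    unfolding correlation_def split_def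
  proof (intro sum.cong refl)
    fix z assume z: "z \<in> ?S \<times> ?S"
    then have "u (fst (fst z)) (fst (snd z)) (fst xy) (fst xy') (fst ab') (fst ab) *
       v (snd (fst z)) (snd (snd z)) (snd xy) (snd xy') (snd ab') (snd ab) =
      (\<Sum>m\<in>F. cnj (f m ((fst (fst z), fst xy), fst ab)) * g m ((fst (snd z), fst xy'), fst ab')) *
      (\<Sum>m\<in>F'. cnj (f' m ((snd (fst z), snd xy), snd ab)) * g' m ((snd (snd z), snd xy'), snd ab'))"
      by (auto simp: u v)
    also have "\<dots> = (\<Sum>m\<in>F \<times> F'. (cnj (f (fst m) ((fst (fst z), fst xy), fst ab)) * g (fst m) ((fst (snd z), fst xy'), fst ab')) *
      (cnj (f' (snd m) ((snd (fst z), snd xy), snd ab)) * g' (snd m) ((snd (snd z), snd xy'), snd ab')))"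
      by (simp add: sum_product sum.cartesian_product')
    finally show "cnj (w (fst z)) * w' (snd z) * (u (fst (fst z)) (fst (snd z)) (fst xy) (fst xy') (fst ab') (fst ab) *
       v (snd (fst z)) (snd (snd z)) (snd xy) (snd xy') (snd ab') (snd ab)) =
      (\<Sum>m\<in>F \<times> F'. cnj (A m (fst z)) * B m (snd z))"
      by (simp add: A_def B_def sum_distrib_left mult_ac)
  qed
  also have "\<dots> = (\<Sum>m\<in>F \<times> F'. \<Sum>z\<in>?S \<times> ?S. cnj (A m (fst z)) * B m (snd z))"
    by (rule sum.swap)
  also have "\<dots> = (\<Sum>m\<in>F \<times> F'. cnj (\<Sum>\<alpha>\<in>?S. A m \<alpha>) * (\<Sum>\<alpha>\<in>?S. B m \<alpha>))"
    by (simp add: cnj_sum sum_product sum.cartesian_product split_def)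
  finally show ?thesis by (simp add: corr_vec_def A_def B_def)
qed

lemma game_value_factor:
  assumes "\<And>p q x x' a a'. p < k \<Longrightarrow> q < k \<Longrightarrow> u p q x x' a' a = (\<Sum>m\<in>F. cnj (f m ((p,x),a)) * g m ((q,x'),a'))"
    and "\<And>p q y y' b b'. p < l \<Longrightarrow> q < l \<Longrightarrow> v p q y y' b' b = (\<Sum>m\<in>F'. cnj (f' m ((p,y),b)) * g' m ((q,y'),b'))"
  shows "game_value \<xi> (proj_comb n lam \<gamma>) (correlation k l u v w w') = (\<Sum>(m,j)\<in>(F \<times> F') \<times> {..<n}.
     of_real (lam j) * (cnj (amplitude \<xi> (\<gamma> j) (corr_vec k l f f' w m)) * amplitude \<xi> (\<gamma> j) (corr_vec k l g g' w' m)))"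
proof -
  \<comment> \<open>The coefficient 1 gives the sum the shape of a linear combination expected by
    \<open>game_value_sum\<close>.\<close>
  have "correlation k l u v w w' = (\<lambda>xy xy' ab ab'. \<Sum>m\<in>F \<times> F'. 1 *
     (cnj (corr_vec k l f f' w m (xy,ab)) * corr_vec k l g g' w' m (xy',ab')))"
    unfolding mult_1 by (intro ext, rule correlation_factor) (erule (1) assms)+
  then have "game_value \<xi> (proj_comb n lam \<gamma>) (correlation k l u v w w') =
    (\<Sum>m\<in>F \<times> F'. 1 * game_value \<xi> (proj_comb n lam \<gamma>) (\<lambda>xy xy' ab ab'.
     cnj (corr_vec k l f f' w m (xy,ab)) * corr_vec k l g g' w' m (xy',ab')))"
    by (simp only: game_value_sum)
  then show ?thesis by (simp only: game_value_rank_one mult_1 sum.cartesian_product)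
qed

definition quantum_corr where
  "quantum_corr dA dB E F \<zeta> = correlation dA dB (op_transpose E) (op_transpose F) \<zeta> \<zeta>"

lemma game_value_gram:
  "game_value \<xi> (proj_comb n lam \<gamma>) (quantum_corr k l (gram_op F f) (gram_op F' f') w) =
    of_real (\<Sum>(m,j)\<in>(F \<times> F') \<times> {..<n}. lam j * (cmod (amplitude \<xi> (\<gamma> j) (corr_vec k l f f' w m)))\<^sup>2)"
proof -
  have "game_value \<xi> (proj_comb n lam \<gamma>) (quantum_corr k l (gram_op F f) (gram_op F' f') w) =
    (\<Sum>(m,j)\<in>(F \<times> F') \<times> {..<n}. of_real (lam j) *
      (cnj (amplitude \<xi> (\<gamma> j) (corr_vec k l f f' w m)) * amplitude \<xi> (\<gamma> j) (corr_vec k l f f' w m)))"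
    unfolding quantum_corr_def
    by (rule game_value_factor) (simp_all add: op_transpose_def gram_op_def)
  then show ?thesis by (simp only: of_real_sum split_def of_real_mult complex_norm_square mult.commute)
qed

lemma game_value_quantum_nonneg:
  fixes \<xi> :: "('x::finite \<times> 'y::finite) \<times> 'r::finite \<Rightarrow> complex"
    and \<gamma> :: "nat \<Rightarrow> ('a::finite \<times> 'b::finite) \<times> 'r \<Rightarrow> complex"
  assumes "\<forall>j<n. 0 \<le> lam j" "stoch_op_matrix k E" "stoch_op_matrix l F"
  shows "0 \<le> Re (game_value \<xi> (proj_comb n lam \<gamma>) (quantum_corr k l E F w))"
proof -
  obtain M :: "(('x \<times> 'a) \<times> nat) set" and f where f: "finite M" "isometric_on ({..<k} \<times> UNIV) M f"
    "\<And>x x' a a' p q. p < k \<Longrightarrow> q < k \<Longrightarrow> E x x' a a' p q = gram_op M f x x' a a' p q"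
    using stoch_op_matrix_factor[OF assms(2)] by metis
  obtain M' :: "(('y \<times> 'b) \<times> nat) set" and f' where f': "finite M'" "isometric_on ({..<l} \<times> UNIV) M' f'"
    "\<And>x x' a a' p q. p < l \<Longrightarrow> q < l \<Longrightarrow> F x x' a a' p q = gram_op M' f' x x' a a' p q"
    using stoch_op_matrix_factor[OF assms(3)] by metis
  have "quantum_corr k l E F w = quantum_corr k l (gram_op M f) (gram_op M' f') w"
    unfolding quantum_corr_def correlation_def op_transpose_def
    by (intro ext sum.cong refl) (auto simp: f(3) f'(3))
  then show ?thesis
    using assms(1) by (auto simp: game_value_gram intro!: sum_nonneg)
qed

text \<open>Cauchy-Schwarz over the Kraus index and the spectral index of \<open>P\<close> jointly.
  The factors f, f' go with w, and g, g' with w', each side being an honest correlation at the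
  original levels.\<close>

lemma game_value_correlation_bound:
  fixes \<xi> :: "('x::finite \<times> 'y::finite) \<times> 'r::finite \<Rightarrow> complex"
    and \<gamma> :: "nat \<Rightarrow> ('a::finite \<times> 'b::finite) \<times> 'r \<Rightarrow> complex"
  assumes lam: "\<forall>j<n. 0 \<le> lam j" and u: "E_matnorm k u \<le> 1" and v: "E_matnorm l v \<le> 1"
  obtains E F E' F' where "stoch_op_matrix k E" "stoch_op_matrix l F" "stoch_op_matrix k E'" "stoch_op_matrix l F'"
    "cmod (game_value \<xi> (proj_comb n lam \<gamma>) (correlation k l u v w w')) \<le>
      sqrt (Re (game_value \<xi> (proj_comb n lam \<gamma>) (quantum_corr k l E F w))) *
      sqrt (Re (game_value \<xi> (proj_comb n lam \<gamma>) (quantum_corr k l E' F' w')))"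
proof -
  obtain M :: "((nat \<times> 'x) \<times> 'a + (nat \<times> 'x) \<times> 'a) set" and f g where "finite M" and
    fg: "isometric_on ({..<k} \<times> UNIV) M f" "isometric_on ({..<k} \<times> UNIV) M g"
    and ufg: "\<And>p q x x' a a'. p < k \<Longrightarrow> q < k \<Longrightarrow> u p q x x' a' a = (\<Sum>m\<in>M. cnj (f m ((p,x),a)) * g m ((q,x'),a'))"
    by (rule E_matnorm_factor[OF u]) (rule that; assumption)
  obtain M' :: "((nat \<times> 'y) \<times> 'b + (nat \<times> 'y) \<times> 'b) set" and f' g' where "finite M'" and
    fg': "isometric_on ({..<l} \<times> UNIV) M' f'" "isometric_on ({..<l} \<times> UNIV) M' g'"
    and vfg: "\<And>p q x x' a a'. p < l \<Longrightarrow> q < l \<Longrightarrow> v p q x x' a' a = (\<Sum>m\<in>M'. cnj (f' m ((p,x),a)) * g' m ((q,x'),a'))"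
    by (rule E_matnorm_factor[OF v]) (rule that; assumption)
  \<comment> \<open>The weight is split evenly, so each squared sum carries \<open>lam j\<close>
    once; this is where nonnegativity of the weights enters.\<close>
  define A where "A = (\<lambda>(m,j). sqrt (lam j) * cmod (amplitude \<xi> (\<gamma> j) (corr_vec k l f f' w m)))"
  define B where "B = (\<lambda>(m,j). sqrt (lam j) * cmod (amplitude \<xi> (\<gamma> j) (corr_vec k l g g' w' m)))"
  let ?S = "(M \<times> M') \<times> {..<n}"
  have "cmod (game_value \<xi> (proj_comb n lam \<gamma>) (correlation k l u v w w'))
    \<le> sqrt (\<Sum>z\<in>?S. (A z)\<^sup>2) * sqrt (\<Sum>z\<in>?S. (B z)\<^sup>2)"
  proof -
    have "game_value \<xi> (proj_comb n lam \<gamma>) (correlation k l u v w w') = (\<Sum>(m,j)\<in>?S.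
      of_real (lam j) * (cnj (amplitude \<xi> (\<gamma> j) (corr_vec k l f f' w m)) * amplitude \<xi> (\<gamma> j) (corr_vec k l g g' w' m)))"
      by (rule game_value_factor) (erule (1) ufg, erule (1) vfg)
    moreover have root: "sqrt c * X * (sqrt c * Y) = c * (X * Y)" if "0 \<le> c" for c X Y :: real
    proof -
      have "sqrt c * X * (sqrt c * Y) = (sqrt c * sqrt c) * (X * Y)" by (simp only: mult_ac)
      then show ?thesis using that by simp
    qed
    ultimately show ?thesis
      by (simp only:, intro norm_sum_Gram_le) (use lam in \<open>auto simp: A_def B_def norm_mult root\<close>)
  qed
  moreover have "(\<Sum>z\<in>?S. (A z)\<^sup>2) = Re (game_value \<xi> (proj_comb n lam \<gamma>) (quantum_corr k l (gram_op M f) (gram_op M' f') w))"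
    unfolding game_value_gram Re_complex_of_real
    by (intro sum.cong refl) (use lam in \<open>auto simp: A_def power_mult_distrib\<close>)
  moreover have "(\<Sum>z\<in>?S. (B z)\<^sup>2) = Re (game_value \<xi> (proj_comb n lam \<gamma>) (quantum_corr k l (gram_op M g) (gram_op M' g') w'))"
    unfolding game_value_gram Re_complex_of_real
    by (intro sum.cong refl) (use lam in \<open>auto simp: B_def power_mult_distrib\<close>)
  ultimately show ?thesis
    using that[OF stoch_op_matrix_gram_op[OF fg(1)] stoch_op_matrix_gram_op[OF fg'(1)]
      stoch_op_matrix_gram_op[OF fg(2)] stoch_op_matrix_gram_op[OF fg'(2)]] by simp
qed

lemma quantum_corr_eq:
  "quantum_corr dA dB E F \<zeta> = (\<lambda>(x,y) (x',y') (a,b) (a',b').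
     \<Sum>i<dA. \<Sum>k<dB. \<Sum>j<dA. \<Sum>l<dB. E x x' a a' i j * F y y' b b' k l * \<zeta> (j,l) * cnj (\<zeta> (i,k)))"
  by (simp add: fun_eq_iff quantum_corr_def correlation_def op_transpose_def sum.cartesian_product' mult_ac)

lemma Q_q_eq:
  "Q_q = {G. \<exists>dA dB \<zeta> E F. stoch_op_matrix dA E \<and> stoch_op_matrix dB F \<and>
      vnorm ({..<dA} \<times> {..<dB}) \<zeta> = 1 \<and> G = quantum_corr dA dB E F \<zeta>}"
  by (simp add: Q_q_def quantum_corr_eq vnorm_def)

section \<open>Channels as stochastic operator matrices on a one-dimensional space\<close>

lemma psd_on_reindex:
  assumes h: "bij_betw h I' I" and psd: "psd_on I' (\<lambda>i j. M (h i) (h j))"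
  shows "psd_on I M"
proof -
  have "form I I M v v = form I' I' (\<lambda>i j. M (h i) (h j)) (\<lambda>i. v (h i)) (\<lambda>i. v (h i))" for v
    unfolding form_def
    by (subst sum.reindex_bij_betw[OF h, symmetric], intro sum.cong refl,
        subst sum.reindex_bij_betw[OF h, symmetric]) simp
  then show ?thesis using psd by (simp add: psd_on_iff_coercive coercive_on_def)
qed

text \<open>The Gram factor provides Kraus operators: the amplified form is a sum of forms of
  \<open>N\<close> at transformed vectors, hence positive.\<close>

lemma is_channel_of_stoch:
  fixes E :: "'x::finite \<Rightarrow> 'x \<Rightarrow> 'a::finite \<Rightarrow> 'a \<Rightarrow> nat \<Rightarrow> nat \<Rightarrow> complex"
  assumes E: "stoch_op_matrix 1 E"
  shows "is_channel (\<lambda>x x' a a'. E x x' a a' 0 0)"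
proof -
  let ?K = "\<lambda>x x' a a'. E x x' a a' 0 0"
  obtain F :: "(('x \<times> 'a) \<times> nat) set" and f where
    f: "\<And>x x' a a' p q. p < 1 \<Longrightarrow> q < 1 \<Longrightarrow> E x x' a a' p q = gram_op F f x x' a a' p q"
    using stoch_op_matrix_factor[OF E] by metis
  have "psd_on ({..<n} \<times> UNIV) (\<lambda>(p,a) (q,a'). lin_apply ?K (N p q) a a')"
    if N: "psd_on ({..<n} \<times> UNIV) (\<lambda>(p,x) (q,x'). N p q x x')" for n and N :: "nat \<Rightarrow> nat \<Rightarrow> 'x \<Rightarrow> 'x \<Rightarrow> complex"
  proof -
    have eq: "form ({..<n} \<times> UNIV) ({..<n} \<times> UNIV) (\<lambda>(p,a) (q,a'). lin_apply ?K (N p q) a a') v v =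
      (\<Sum>m\<in>F. form ({..<n} \<times> UNIV) ({..<n} \<times> UNIV) (\<lambda>(p,x) (q,x'). N p q x x')
        (\<lambda>(p,x). \<Sum>a\<in>UNIV. f m ((0,x),a) * v (p,a)) (\<lambda>(p,x). \<Sum>a\<in>UNIV. f m ((0,x),a) * v (p,a)))" for v
    proof -
      let ?t = "\<lambda>m p x a q x' a'. cnj (f m ((0,x),a) * v (p,a)) * N p q x x' * (f m ((0,x'),a') * v (q,a'))"
      have "form ({..<n} \<times> UNIV) ({..<n} \<times> UNIV) (\<lambda>(p,a) (q,a'). lin_apply ?K (N p q) a a') v v =
        (\<Sum>p<n. \<Sum>a\<in>UNIV. \<Sum>q<n. \<Sum>a'\<in>UNIV. \<Sum>x\<in>UNIV. \<Sum>x'\<in>UNIV. \<Sum>m\<in>F. ?t m p x a q x' a')"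
        by (simp add: form_def lin_apply_def f gram_op_def sum.cartesian_product' sum_distrib_left sum_distrib_right mult_ac)
      also have "\<dots> = (\<Sum>(p,a,q,a',x,x',m)\<in>{..<n} \<times> UNIV \<times> {..<n} \<times> UNIV \<times> UNIV \<times> UNIV \<times> F. ?t m p x a q x' a')"
        by (simp add: sum.cartesian_product split_def)
      also have "\<dots> = (\<Sum>(m,p,x,q,x',a,a')\<in>F \<times> {..<n} \<times> UNIV \<times> {..<n} \<times> UNIV \<times> UNIV \<times> UNIV. ?t m p x a q x' a')"
        by (rule sum.reindex_bij_witness[of _ "\<lambda>(m,p,x,q,x',a,a'). (p,a,q,a',x,x',m)"
              "\<lambda>(p,a,q,a',x,x',m). (m,p,x,q,x',a,a')"]) auto
      also have "\<dots> = (\<Sum>m\<in>F. \<Sum>p<n. \<Sum>x\<in>UNIV. \<Sum>q<n. \<Sum>x'\<in>UNIV. \<Sum>a\<in>UNIV. \<Sum>a'\<in>UNIV. ?t m p x a q x' a')"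
        by (simp add: sum.cartesian_product split_def)
      finally show ?thesis
        by (simp only: form_def sum.cartesian_product' split_conv cnj_sum sum_mult_sum)
    qed
    show ?thesis
      using N unfolding psd_on_iff_coercive coercive_on_def eq by (auto intro!: sum_in_Reals sum_nonneg)
  qed
  then have "completely_positive ?K" unfolding completely_positive_def by blast
  moreover have "trace_preserving ?K"
    unfolding trace_preserving_def
  proof
    fix \<rho> :: "'x \<Rightarrow> 'x \<Rightarrow> complex"
    have "(\<Sum>a\<in>UNIV. lin_apply ?K \<rho> a a) = (\<Sum>x\<in>UNIV. \<Sum>a\<in>UNIV. \<Sum>x'\<in>UNIV. \<rho> x x' * E x x' a a 0 0)"
      unfolding lin_apply_def by (rule sum.swap)
    also have "\<dots> = (\<Sum>x\<in>UNIV. \<Sum>x'\<in>UNIV. \<Sum>a\<in>UNIV. \<rho> x x' * E x x' a a 0 0)"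
      by (intro sum.cong refl sum.swap)
    also have "\<dots> = (\<Sum>x\<in>UNIV. \<Sum>x'\<in>UNIV. if x = x' then \<rho> x x' else 0)"
    proof (intro sum.cong refl)
      fix x x'
      have "(\<Sum>a\<in>UNIV. E x x' a a 0 0) = (if x = x' then 1 else 0)"
        using E by (simp add: stoch_op_matrix_def)
      then show "(\<Sum>a\<in>UNIV. \<rho> x x' * E x x' a a 0 0) = (if x = x' then \<rho> x x' else 0)"
        by (simp flip: sum_distrib_left)
    qed
    finally show "(\<Sum>a\<in>UNIV. lin_apply ?K \<rho> a a) = (\<Sum>x\<in>UNIV. \<rho> x x)" by simp
  qed
  ultimately show ?thesis by (simp add: is_channel_def)
qed

text \<open>Choi's argument: the amplification of a completely positive map at the positive matrix
  of all matrix units is its own coefficient matrix.\<close>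

lemma stoch_of_is_channel:
  fixes K :: "'x::finite \<Rightarrow> 'x \<Rightarrow> 'a::finite \<Rightarrow> 'a \<Rightarrow> complex"
  assumes K: "is_channel K"
  shows "stoch_op_matrix 1 (\<lambda>x x' a a' i j. K x x' a a')"
  unfolding stoch_op_matrix_def
proof (intro conjI allI impI)
  have lin: "lin_apply K (\<lambda>x x'. if x = y \<and> x' = y' then 1 else 0) a a' = K y y' a a'" for y y' a a'
  proof -
    have "lin_apply K (\<lambda>x x'. if x = y \<and> x' = y' then 1 else 0) a a' =
      (\<Sum>x\<in>UNIV. if x = y then (\<Sum>x'\<in>UNIV. if x' = y' then K x x' a a' else 0) else 0)"
      unfolding lin_apply_def by (intro sum.cong refl) (auto simp: mult_delta_left)
    then show ?thesis by simp
  qed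
  obtain h where h: "bij_betw h {..<CARD('x)} (UNIV :: 'x set)"
    using ex_bij_betw_nat_finite[of "UNIV :: 'x set"] by (auto simp: atLeast0LessThan)
  \<comment> \<open>The unnormalized maximally entangled state; \<open>h\<close> enumerates X
    because amplifications are indexed by natural numbers.\<close>
  have psd_N: "psd_on ({..<CARD('x)} \<times> UNIV) (\<lambda>(p,x) (q,x'). if x = h p \<and> x' = h q then 1 else 0)"
    by (rule gram_psd[where F = "{()}" and L = "\<lambda>_ (p,x). if x = h p then 1 else 0"]) auto
  have "psd_on ({..<CARD('x)} \<times> UNIV) (\<lambda>(p,a) (q,a'). lin_apply K (\<lambda>x x'. if x = h p \<and> x' = h q then 1 else 0) a a')"
  proof -
    have "completely_positive K" using K by (simp add: is_channel_def)
    from this[unfolded completely_positive_def, rule_format,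
        of "CARD('x)" "\<lambda>p q x x'. if x = h p \<and> x' = h q then 1 else 0"] psd_N
    show ?thesis by simp
  qed
  then have psd: "psd_on ({..<CARD('x)} \<times> UNIV) (\<lambda>(p,a) (q,a'). K (h p) (h q) a a')"
    by (simp only: lin)
  have "bij_betw (\<lambda>(p, a::'a). ((h p, a), 0::nat)) ({..<CARD('x)} \<times> UNIV) (UNIV \<times> {..<1})"
  proof (rule bij_betw_imageI)
    show "inj_on (\<lambda>(p, a::'a). ((h p, a), 0::nat)) ({..<CARD('x)} \<times> UNIV)"
      using bij_betw_imp_inj_on[OF h] by (auto simp: inj_on_def)
    have "\<exists>p\<in>{..<CARD('x)}. x = h p" for x
      using bij_betw_imp_surj_on[OF h] by (metis UNIV_I imageE)
    then show "(\<lambda>(p, a::'a). ((h p, a), 0::nat)) ` ({..<CARD('x)} \<times> UNIV) = UNIV \<times> {..<1}"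
      by (auto simp: image_iff)
  qed
  then show "psd_on (UNIV \<times> {..<1::nat}) (\<lambda>((x,a),i) ((x',a'),j). K x x' a a')"
    by (rule psd_on_reindex) (use psd in \<open>simp add: split_def\<close>)
  fix x x' and i j :: nat assume "i < 1" "j < 1"
  have "(\<Sum>a\<in>UNIV. lin_apply K (\<lambda>y y'. if y = x \<and> y' = x' then 1 else 0) a a) =
    (\<Sum>y\<in>UNIV. if y = x \<and> y = x' then 1 else 0)"
    using K unfolding is_channel_def trace_preserving_def by blast
  moreover have "\<dots> = (\<Sum>y\<in>UNIV. if y = x then (if x = x' then 1 else 0) else (0::complex))"
    by (intro sum.cong refl) auto
  ultimately show "(\<Sum>a\<in>UNIV. K x x' a a) = (if x = x' \<and> i = j then 1 else 0)"
    using \<open>i < 1\<close> \<open>j < 1\<close> by (simp add: lin)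
qed

text \<open>\<open>Sup\<close> on the reals depends only on the set of upper bounds, so boundedness is not needed here.\<close>

lemma real_Sup_eqI:
  fixes S T :: "real set"
  assumes "\<And>z. (\<forall>s\<in>S. s \<le> z) \<longleftrightarrow> (\<forall>t\<in>T. t \<le> z)"
  shows "Sup S = Sup T"
  unfolding Sup_real_def using assms by simp

text \<open>The channel with constant answer \<open>a0\<close>. A single nonnegative game value is
  enough to make every upper bound nonnegative.\<close>

lemma stoch_op_matrix_exists: "\<exists>E :: 'x::finite \<Rightarrow> 'x \<Rightarrow> 'a::finite \<Rightarrow> 'a \<Rightarrow> nat \<Rightarrow> nat \<Rightarrow> complex. stoch_op_matrix 1 E"
proof -
  fix a0 :: 'a
  define f where "f = (\<lambda>m ((p::nat,x::'x),a::'a). if m = x \<and> a = a0 then 1 else (0::complex))"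
  have "isometric_on ({..<1} \<times> UNIV) UNIV f"
    unfolding isometric_on_def
  proof (intro ballI)
    fix i j :: "nat \<times> 'x" assume ij: "i \<in> {..<1} \<times> UNIV" "j \<in> {..<1} \<times> UNIV"
    have "(\<Sum>m\<in>UNIV. \<Sum>a\<in>UNIV. cnj (f m (i,a)) * f m (j,a)) =
      (\<Sum>m\<in>UNIV. \<Sum>a\<in>UNIV. if a = a0 then (if m = snd i then (if m = snd j then 1 else 0) else 0) else 0)"
      by (intro sum.cong refl) (auto simp: f_def split: prod.splits)
    also have "\<dots> = (if i = j then 1 else 0)" using ij by (auto simp: prod_eq_iff)
    finally show "(\<Sum>m\<in>UNIV. \<Sum>a\<in>UNIV. cnj (f m (i,a)) * f m (j,a)) = (if i = j then 1 else 0)" .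
  qed
  then show ?thesis using stoch_op_matrix_gram_op by blast
qed

text \<open>The value is a quadratic form in the state, so a bound on unit vectors extends by
  homogeneity.\<close>

lemma form_quantum_bound:
  assumes ub: "\<And>\<zeta>. vnorm ({..<k} \<times> {..<l}) \<zeta> = 1 \<Longrightarrow>
      Re (game_value \<xi> (proj_comb n lam \<gamma>) (quantum_corr k l E F \<zeta>)) \<le> z"
  shows "Re (game_value \<xi> (proj_comb n lam \<gamma>) (quantum_corr k l E F w)) \<le> z * (vnorm ({..<k} \<times> {..<l}) w)\<^sup>2"
proof -
  let ?S = "{..<k} \<times> {..<l}"
  let ?M = "pair_mat (G_tensor \<xi> (proj_comb n lam \<gamma>)) (op_transpose E) (op_transpose F)"
  have V: "game_value \<xi> (proj_comb n lam \<gamma>) (quantum_corr k l E F w) = form ?S ?S ?M w w" for w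
    unfolding quantum_corr_def by (rule form_pair_mat[OF proj_comb_hermitian, symmetric])
  show ?thesis
  proof (cases "vnorm ?S w = 0")
    case True
    then have "cmod (form ?S ?S ?M w w) \<le> 0" using form_le_opnorm[of ?S ?S ?M w w] by simp
    then show ?thesis using True by (simp add: V)
  next
    case False
    define r where "r = vnorm ?S w"
    have r: "0 < r" using False vnorm_nonneg[of ?S w] by (simp add: r_def)
    define \<zeta> where "\<zeta> = (\<lambda>i. of_real (1 / r) * w i)"
    have "vnorm ?S \<zeta> = 1" unfolding \<zeta>_def vnorm_scale using r by (simp add: norm_divide flip: r_def)
    then have "Re (form ?S ?S ?M \<zeta> \<zeta>) \<le> z" using ub V by metis
    moreover have "form ?S ?S ?M \<zeta> \<zeta> = of_real (1 / r\<^sup>2) * form ?S ?S ?M w w"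
      unfolding \<zeta>_def form_scale_left form_scale_right by (simp add: power2_eq_square)
    ultimately have "Re (form ?S ?S ?M w w) / r\<^sup>2 \<le> z" by simp
    then show ?thesis using r by (simp add: V pos_divide_le_eq flip: r_def)
  qed
qed

section \<open>Comparison of the suprema through their upper bounds\<close>

lemma quantum_value_eq_min_norm:
  fixes \<xi> :: "('x::finite \<times> 'y::finite) \<times> 'r::finite \<Rightarrow> complex"
    and \<gamma> :: "nat \<Rightarrow> ('a::finite \<times> 'b::finite) \<times> 'r \<Rightarrow> complex"
  assumes lam: "\<forall>j<n. 0 \<le> lam j"
  shows "omega_q \<xi> (proj_comb n lam \<gamma>) = min_norm (G_tensor \<xi> (proj_comb n lam \<gamma>))"
  unfolding omega_q_def min_norm_def
proof (rule real_Sup_eqI)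
  fix z
  let ?P = "proj_comb n lam \<gamma>"
  let ?A = "{Re (game_value \<xi> ?P G) | G. G \<in> Q_q}"
  let ?B = "{opnorm ({..<k} \<times> {..<l}) ({..<k} \<times> {..<l}) (pair_mat (G_tensor \<xi> ?P) u v) | k l u v.
      E_matnorm k u \<le> 1 \<and> E_matnorm l v \<le> 1}"
  show "(\<forall>s\<in>?A. s \<le> z) \<longleftrightarrow> (\<forall>t\<in>?B. t \<le> z)"
  proof
    assume A: "\<forall>s\<in>?A. s \<le> z"
    have ub: "Re (game_value \<xi> ?P (quantum_corr k l E F \<zeta>)) \<le> z"
      if "stoch_op_matrix k E" "stoch_op_matrix l F" "vnorm ({..<k} \<times> {..<l}) \<zeta> = 1" for k l E F \<zeta>
      using A that unfolding Q_q_eq by blast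
    \<comment> \<open>Used for the square roots of \<open>z\<close>, and as the bound on the empty
      matrices that occur when k or l is 0.\<close>
    have z: "0 \<le> z"
    proof -
      obtain E :: "'x \<Rightarrow> 'x \<Rightarrow> 'a \<Rightarrow> 'a \<Rightarrow> nat \<Rightarrow> nat \<Rightarrow> complex" where E: "stoch_op_matrix 1 E"
        using stoch_op_matrix_exists by blast
      obtain F :: "'y \<Rightarrow> 'y \<Rightarrow> 'b \<Rightarrow> 'b \<Rightarrow> nat \<Rightarrow> nat \<Rightarrow> complex" where F: "stoch_op_matrix 1 F"
        using stoch_op_matrix_exists by blast
      have "vnorm ({..<1::nat} \<times> {..<1::nat}) (\<lambda>_. 1) = 1" by (simp add: vnorm_def)
      then show ?thesis using ub[OF E F] game_value_quantum_nonneg[OF lam E F] order_trans by blast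
    qed
    show "\<forall>t\<in>?B. t \<le> z"
    proof clarify
      fix k l and u :: "nat \<Rightarrow> nat \<Rightarrow> 'x \<Rightarrow> 'x \<Rightarrow> 'a \<Rightarrow> 'a \<Rightarrow> complex"
        and v :: "nat \<Rightarrow> nat \<Rightarrow> 'y \<Rightarrow> 'y \<Rightarrow> 'b \<Rightarrow> 'b \<Rightarrow> complex"
      assume u: "E_matnorm k u \<le> 1" and v: "E_matnorm l v \<le> 1"
      let ?S = "{..<k} \<times> {..<l}"
      show "opnorm ?S ?S (pair_mat (G_tensor \<xi> ?P) u v) \<le> z"
      proof (rule opnorm_le[OF z])
        fix w w'
        obtain E F E' F' where st: "stoch_op_matrix k E" "stoch_op_matrix l F" "stoch_op_matrix k E'" "stoch_op_matrix l F'"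
          and le: "cmod (game_value \<xi> ?P (correlation k l u v w w')) \<le>
            sqrt (Re (game_value \<xi> ?P (quantum_corr k l E F w))) * sqrt (Re (game_value \<xi> ?P (quantum_corr k l E' F' w')))"
          by (rule game_value_correlation_bound[OF lam u v]) (rule that; assumption)
        have "Re (game_value \<xi> ?P (quantum_corr k l E F w)) \<le> z * (vnorm ?S w)\<^sup>2"
          by (rule form_quantum_bound) (rule ub[OF st(1,2)])
        then have "sqrt (Re (game_value \<xi> ?P (quantum_corr k l E F w))) \<le> sqrt z * vnorm ?S w"
          using real_sqrt_le_mono[of _ "z * (vnorm ?S w)\<^sup>2"] by (simp add: real_sqrt_mult vnorm_nonneg)
        moreover have "Re (game_value \<xi> ?P (quantum_corr k l E' F' w')) \<le> z * (vnorm ?S w')\<^sup>2"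
          by (rule form_quantum_bound) (rule ub[OF st(3,4)])
        then have "sqrt (Re (game_value \<xi> ?P (quantum_corr k l E' F' w'))) \<le> sqrt z * vnorm ?S w'"
          using real_sqrt_le_mono[of _ "z * (vnorm ?S w')\<^sup>2"] by (simp add: real_sqrt_mult vnorm_nonneg)
        ultimately have "cmod (game_value \<xi> ?P (correlation k l u v w w')) \<le> (sqrt z * vnorm ?S w) * (sqrt z * vnorm ?S w')"
          using le by (rule_tac order_trans[OF le mult_mono])
            (auto simp: z vnorm_nonneg game_value_quantum_nonneg[OF lam st(3,4)])
        also have "\<dots> = (sqrt z * sqrt z) * (vnorm ?S w * vnorm ?S w')" by (simp only: mult_ac)
        finally show "cmod (form ?S ?S (pair_mat (G_tensor \<xi> ?P) u v) w w') \<le> z * (vnorm ?S w * vnorm ?S w')"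
          using z by (simp add: form_pair_mat[OF proj_comb_hermitian])
      qed
    qed
  next
    assume B: "\<forall>t\<in>?B. t \<le> z"
    show "\<forall>s\<in>?A. s \<le> z"
    proof clarify
      fix G :: "('x,'y,'a,'b) qmap" assume "G \<in> Q_q"
      then obtain k l \<zeta> E F where st: "stoch_op_matrix k E" "stoch_op_matrix l F"
        and \<zeta>: "vnorm ({..<k} \<times> {..<l}) \<zeta> = 1" and G: "G = quantum_corr k l E F \<zeta>"
        unfolding Q_q_eq by blast
      let ?S = "{..<k} \<times> {..<l}"
      let ?M = "pair_mat (G_tensor \<xi> ?P) (op_transpose E) (op_transpose F)"
      have "Re (game_value \<xi> ?P G) \<le> cmod (form ?S ?S ?M \<zeta> \<zeta>)"
        unfolding G quantum_corr_def form_pair_mat[OF proj_comb_hermitian] by (rule complex_Re_le_cmod)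
      also have "\<dots> \<le> opnorm ?S ?S ?M" using form_le_opnorm[of ?S ?S ?M \<zeta> \<zeta>] \<zeta> by simp
      also have "\<dots> \<le> z" using B E_matnorm_stoch[OF st(1)] E_matnorm_stoch[OF st(2)] by blast
      finally show "Re (game_value \<xi> ?P G) \<le> z" .
    qed
  qed
qed

lemma correlation_one:
  "correlation 1 1 u v (\<lambda>_. 1) (\<lambda>_. 1) = (\<lambda>(x,y) (x',y') (a,b) (a',b'). u 0 0 x x' a' a * v 0 0 y y' b' b)"
  by (simp add: fun_eq_iff correlation_def lessThan_Suc)

lemma local_value_eq_eps_norm:
  fixes \<xi> :: "('x::finite \<times> 'y::finite) \<times> 'r::finite \<Rightarrow> complex"
    and \<gamma> :: "nat \<Rightarrow> ('a::finite \<times> 'b::finite) \<times> 'r \<Rightarrow> complex"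
  assumes lam: "\<forall>j<n. 0 \<le> lam j"
  shows "omega_loc \<xi> (proj_comb n lam \<gamma>) = eps_norm (G_tensor \<xi> (proj_comb n lam \<gamma>))"
  unfolding omega_loc_def eps_norm_def
proof (rule real_Sup_eqI)
  fix z
  let ?P = "proj_comb n lam \<gamma>"
  let ?A = "{Re (game_value \<xi> ?P G) | G. G \<in> Q_loc}"
  let ?B = "{cmod (pair_mat (G_tensor \<xi> ?P) u v (0,0) (0,0)) | u v. E_matnorm 1 u \<le> 1 \<and> E_matnorm 1 v \<le> 1}"
  have pm: "pair_mat (G_tensor \<xi> ?P) u v (0,0) (0,0) = game_value \<xi> ?P (correlation 1 1 u v (\<lambda>_. 1) (\<lambda>_. 1))" for u v
    unfolding correlation_one by (rule pair_mat_eq_game_value[OF proj_comb_hermitian])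
  show "(\<forall>s\<in>?A. s \<le> z) \<longleftrightarrow> (\<forall>t\<in>?B. t \<le> z)"
  proof
    assume A: "\<forall>s\<in>?A. s \<le> z"
    have ub: "Re (game_value \<xi> ?P (quantum_corr 1 1 E F (\<lambda>_. 1))) \<le> z"
      if E: "stoch_op_matrix 1 E" and F: "stoch_op_matrix 1 F" for E F
    proof -
      have "quantum_corr 1 1 E F (\<lambda>_. 1) =
        (\<lambda>(x,y) (x',y') (a,b) (a',b'). \<Sum>i<(1::nat). complex_of_real 1 * E x x' a a' 0 0 * F y y' b b' 0 0)"
        by (simp add: quantum_corr_def correlation_one[unfolded One_nat_def] op_transpose_def fun_eq_iff)
      then have "quantum_corr 1 1 E F (\<lambda>_. 1) \<in> Q_loc"
        unfolding Q_loc_def using is_channel_of_stoch[OF E] is_channel_of_stoch[OF F]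
        by (intro CollectI exI[of _ 1] exI[of _ "\<lambda>_. 1"] exI[of _ "\<lambda>_ x x' a a'. E x x' a a' 0 0"]
            exI[of _ "\<lambda>_ y y' b b'. F y y' b b' 0 0"]) simp
      then show ?thesis using A by blast
    qed
    show "\<forall>t\<in>?B. t \<le> z"
    proof clarify
      fix u :: "nat \<Rightarrow> nat \<Rightarrow> 'x \<Rightarrow> 'x \<Rightarrow> 'a \<Rightarrow> 'a \<Rightarrow> complex"
        and v :: "nat \<Rightarrow> nat \<Rightarrow> 'y \<Rightarrow> 'y \<Rightarrow> 'b \<Rightarrow> 'b \<Rightarrow> complex"
      assume u: "E_matnorm 1 u \<le> 1" and v: "E_matnorm 1 v \<le> 1"
      obtain E F E' F' where st: "stoch_op_matrix 1 E" "stoch_op_matrix 1 F" "stoch_op_matrix 1 E'" "stoch_op_matrix 1 F'"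
        and le: "cmod (game_value \<xi> ?P (correlation 1 1 u v (\<lambda>_. 1) (\<lambda>_. 1))) \<le>
          sqrt (Re (game_value \<xi> ?P (quantum_corr 1 1 E F (\<lambda>_. 1)))) *
          sqrt (Re (game_value \<xi> ?P (quantum_corr 1 1 E' F' (\<lambda>_. 1))))"
        by (rule game_value_correlation_bound[OF lam u v]) (rule that; assumption)
      note nn = game_value_quantum_nonneg[OF lam st(1,2), of \<xi> \<gamma> "\<lambda>_. 1"] game_value_quantum_nonneg[OF lam st(3,4), of \<xi> \<gamma> "\<lambda>_. 1"]
      have z: "0 \<le> z" using nn(1) ub[OF st(1,2)] by linarith
      have "sqrt (Re (game_value \<xi> ?P (quantum_corr 1 1 E F (\<lambda>_. 1)))) *
          sqrt (Re (game_value \<xi> ?P (quantum_corr 1 1 E' F' (\<lambda>_. 1)))) \<le> sqrt z * sqrt z"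
        using ub[OF st(1,2)] ub[OF st(3,4)] nn z by (intro mult_mono real_sqrt_le_mono) simp_all
      with le show "cmod (pair_mat (G_tensor \<xi> ?P) u v (0,0) (0,0)) \<le> z"
        unfolding pm using z by simp
    qed
  next
    assume B: "\<forall>t\<in>?B. t \<le> z"
    \<comment> \<open>Product channels correspond to level-one elements of the two unit balls;
      convex combinations follow since the game value is linear in the correlation.\<close>
    have prod: "Re (game_value \<xi> ?P (\<lambda>(x,y) (x',y') (a,b) (a',b'). K x x' a a' * L y y' b b')) \<le> z"
      if K: "is_channel K" and L: "is_channel L" for K L
    proof -
      let ?u = "op_transpose (\<lambda>x x' a a' i j. K x x' a a')" and ?v = "op_transpose (\<lambda>x x' a a' i j. L x x' a a')"
      have "(\<lambda>(x,y) (x',y') (a,b) (a',b'). K x x' a a' * L y y' b b') = correlation 1 1 ?u ?v (\<lambda>_. 1) (\<lambda>_. 1)"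
        unfolding correlation_one by (simp add: op_transpose_def)
      then have "Re (game_value \<xi> ?P (\<lambda>(x,y) (x',y') (a,b) (a',b'). K x x' a a' * L y y' b b'))
        \<le> cmod (pair_mat (G_tensor \<xi> ?P) ?u ?v (0,0) (0,0))"
        unfolding pm by (simp only: complex_Re_le_cmod)
      also have "\<dots> \<le> z"
        using B E_matnorm_stoch[OF stoch_of_is_channel[OF K]] E_matnorm_stoch[OF stoch_of_is_channel[OF L]] by blast
      finally show ?thesis .
    qed
    show "\<forall>s\<in>?A. s \<le> z"
    proof clarify
      fix G :: "('x,'y,'a,'b) qmap" assume "G \<in> Q_loc"
      then obtain m :: nat and c K L where c: "\<forall>i<m. 0 \<le> c i" "(\<Sum>i<m. c i) = 1"
        and ch: "\<forall>i<m. is_channel (K i) \<and> is_channel (L i)"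
        and G: "G = (\<lambda>(x,y) (x',y') (a,b) (a',b'). \<Sum>i<m. complex_of_real (c i) * K i x x' a a' * L i y y' b b')"
        unfolding Q_loc_def by blast
      let ?G = "\<lambda>i (x,y) (x',y') (a,b) (a',b'). K i x x' a a' * L i y y' b b'"
      have "G = (\<lambda>xy xy' ab ab'. \<Sum>i<m. of_real (c i) * ?G i xy xy' ab ab')"
        unfolding G by (simp add: fun_eq_iff mult.assoc)
      then have "game_value \<xi> ?P G = (\<Sum>i<m. of_real (c i) * game_value \<xi> ?P (?G i))"
        by (simp only: game_value_sum)
      then have "Re (game_value \<xi> ?P G) = (\<Sum>i<m. c i * Re (game_value \<xi> ?P (?G i)))" by simp
      also have "\<dots> \<le> (\<Sum>i<m. c i * z)"
        using c(1) ch by (intro sum_mono mult_left_mono prod) auto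
      also have "\<dots> = z" using c(2) by (simp flip: sum_distrib_right)
      finally show "Re (game_value \<xi> ?P G) \<le> z" .
    qed
  qed
qed

theorem theorem6p2:
  fixes \<xi> :: "('x::finite \<times> 'y::finite) \<times> 'r::finite \<Rightarrow> complex"
    and \<gamma> :: "nat \<Rightarrow> ('a::finite \<times> 'b::finite) \<times> 'r \<Rightarrow> complex"
    and lam :: "nat \<Rightarrow> real"
    and n :: nat
  assumes unit: "(\<Sum>z\<in>UNIV. (cmod (\<xi> z))\<^sup>2) = 1"
    and orthonormal: "\<forall>k<n. \<forall>k'<n. (\<Sum>z\<in>UNIV. \<gamma> k z * cnj (\<gamma> k' z)) = (if k = k' then 1 else 0)"
    and lam_range: "\<forall>k<n. 0 \<le> lam k \<and> lam k \<le> 1"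
  shows "omega_loc \<xi> (proj_comb n lam \<gamma>) = eps_norm (G_tensor \<xi> (proj_comb n lam \<gamma>)) \<and>
         omega_q \<xi> (proj_comb n lam \<gamma>) = min_norm (G_tensor \<xi> (proj_comb n lam \<gamma>))"
  using local_value_eq_eps_norm quantum_value_eq_min_norm lam_range by blast

end
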